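(* Let $\mathcal{F}$ be a weakly idempotent complete Frobenius category, equipped with its canonical model structure, and let $A$ be a nonzero projective-injective object of $\mathcal{F}$. Let $(0_!,0^* ):\mathcal{F}=(0\downarrow\mathcal{F})\to(A\downarrow\mathcal{F})$ be the adjunction induced by the zero morphism $0\to A$. Then the left derived functor $\mathbb{L}0_!:\underline{\mathcal{F}}=\mathrm{Ho}(\mathcal{F})\to\mathrm{Ho}(A\downarrow\mathcal{F})$ is a triangle equivalence with quasi-inverse the right derived functor $\mathbb{R}0^*$.
   Context: A Frobenius category is an exact category (in the sense of Quillen) with enough projectives and enough injectives in which the projective objects coincide with the injective objects. It is weakly idempotent complete if every split monomorphism has a cokernel (equivalently, every split epimorphism has a kernel). The stable category $\underline{\mathcal{F}}$ has the same objects as $\mathcal{F}$, and morphisms are morphisms of $\mathcal{F}$ modulo those factoring through a projective-injective object. A stable equivalence is a morphism of $\mathcal{F}$ that becomes an isomorphism in $\underline{\mathcal{F}}$. The canonical model structure on $\mathcal{F}$ has as cofibrations the (admissible) monomorphisms, as fibrations the (admissible) epimorphisms, and as weak equivalences the stable equivalences; all objects are cofibrant and fibrant, and $\mathrm{Ho}(\mathcal{F})$ (the localization at the weak equivalences) is identified with $\underline{\mathcal{F}}$. The category $\underline{\mathcal{F}}$ has its usual (Happel) triangulated structure: for each $C$ fix an admissible monomorphism $i_C:C\to I(C)$ with $I(C)$ injective; the suspension is $\Sigma^{\mathcal{F}}(C)=\operatorname{coker}(i_C)$, and distinguished triangles are those isomorphic to the standard triangles $C\xrightarrow{s}D\to E\to\Sigma^{\mathcal{F}}(C)$,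 where $s:C\to D$ is a morphism, $E$ is the pushout of $s$ along $i_C$, and $E\to\Sigma^{\mathcal{F}}(C)$ is the map induced by $I(C)\to\Sigma^{\mathcal{F}}(C)$ and $0:D\to\Sigma^{\mathcal{F}}(C)$. The coslice category $(A\downarrow\mathcal{F})$ has as objects the morphisms $A\to C$ in $\mathcal{F}$ and as morphisms from $f:A\to C$ to $f':A\to C'$ the morphisms $\alpha:C\to C'$ with $f'=\alpha f$. It carries the model structure in which a map is a weak equivalence, cofibration or fibration if and only if its underlying map in $\mathcal{F}$ is one, and $\mathrm{Ho}(A\downarrow\mathcal{F})$ is the localization at the weak equivalences. All its objects are fibrant. The functor $0_!$ sends $C$ to the coproduct inclusion $u_C:A\to A\oplus C$, and its right adjoint $0^*$ is the forgetful functor sending $A\to D$ to $D$. The derived functors $\mathbb{L}0_!$ and $\mathbb{R}0^*$ are the functors induced on homotopy categories by applying $0_!$ to cofibrant replacements and $0^*$ to fibrant replacements. Triangulated structure on $\mathrm{Ho}(A\downarrow\mathcal{F})$: every object is isomorphic in $\mathrm{Ho}(A\downarrow\mathcal{F})$ to some $u_C$, and every morphism $u_C\to u_D$ in $\mathrm{Ho}(A\downarrow\mathcal{F})$ is represented by a map $\left(\begin{smallmatrix}1&0\\0&s\end{smallmatrix}\right):A\oplus C\to A\oplus D$ with $s:C\to D$ in $\mathcal{F}$. The suspension is $\Sigma(u_C)=u_{\Sigma^{\mathcal{F}}(C)}$, acting on morphisms by $s\mapsto\Sigma^{\mathcal{F}}(s)$. The distinguished triangles are Quillen's cofibration sequences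 computed in the pointed category whose objects are the $u_C$ and whose morphisms are the maps $\left(\begin{smallmatrix}1&0\\0&s\end{smallmatrix}\right)$ (zero object $1_A:A\to A$); explicitly, the triangles isomorphic to $u_C\to u_D\to u_E\to u_{\Sigma^{\mathcal{F}}(C)}$ with maps $\left(\begin{smallmatrix}1&0\\0&s\end{smallmatrix}\right),\left(\begin{smallmatrix}1&0\\0&t\end{smallmatrix}\right),\left(\begin{smallmatrix}1&0\\0&w\end{smallmatrix}\right)$, where $s:C\to D$ is a morphism of $\mathcal{F}$, $E$ is the pushout of $s$ along $i_C:C\to I(C)$, $t:D\to E$ is the canonical map into the pushout, and $w:E\to\Sigma^{\mathcal{F}}(C)$ is the map induced by the cokernel map $I(C)\to\Sigma^{\mathcal{F}}(C)$ and $0:D\to\Sigma^{\mathcal{F}}(C)$. A triangle equivalence is an equivalence of categories that commutes with suspensions up to a natural isomorphism and sends distinguished triangles to distinguished triangles. *)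

theory Defs
  imports "HOL-Algebra.Group"
begin

section \<open>Categories and functors\<close>

record ('o, 'm) cat =
  Obj :: "'o set"
  Arr :: "'m set"
  Dom :: "'m \<Rightarrow> 'o"
  Cod :: "'m \<Rightarrow> 'o"
  Ide :: "'o \<Rightarrow> 'm"
  Comp :: "'m \<Rightarrow> 'm \<Rightarrow> 'm"  (infixr "\<cdot>\<index>" 70)

definition homs :: "('o, 'm, 'e) cat_scheme \<Rightarrow> 'o \<Rightarrow> 'o \<Rightarrow> 'm set" where
  "homs C x y = {f \<in> Arr C. Dom C f = x \<and> Cod C f = y}"

locale category =
  fixes C :: "('o, 'm, 'e) cat_scheme" (structure)
  assumes Dom_in: "f \<in> Arr C \<Longrightarrow> Dom C f \<in> Obj C"
    and Cod_in: "f \<in> Arr C \<Longrightarrow> Cod C f \<in> Obj C"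
    and Ide_in: "x \<in> Obj C \<Longrightarrow> Ide C x \<in> homs C x x"
    and Comp_in: "\<lbrakk>f \<in> homs C x y; g \<in> homs C y z\<rbrakk> \<Longrightarrow> g \<cdot> f \<in> homs C x z"
    and Comp_Ide: "f \<in> homs C x y \<Longrightarrow> f \<cdot> Ide C x = f"
    and Ide_Comp: "f \<in> homs C x y \<Longrightarrow> Ide C y \<cdot> f = f"
    and Comp_assoc: "\<lbrakk>f \<in> homs C x y; g \<in> homs C y z; h \<in> homs C z t\<rbrakk>
                      \<Longrightarrow> (h \<cdot> g) \<cdot> f = h \<cdot> (g \<cdot> f)"

definition inverse_arrows :: "('o, 'm, 'e) cat_scheme \<Rightarrow> 'm \<Rightarrow> 'm \<Rightarrow> bool" where
  "inverse_arrows C f g \<longleftrightarrow> f \<in> Arr C \<and> g \<in> homs C (Cod C f) (Dom C f) \<and>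
     g \<cdot>\<^bsub>C\<^esub> f = Ide C (Dom C f) \<and> f \<cdot>\<^bsub>C\<^esub> g = Ide C (Cod C f)"

definition is_iso :: "('o, 'm, 'e) cat_scheme \<Rightarrow> 'm \<Rightarrow> bool" where
  "is_iso C f \<longleftrightarrow> (\<exists>g. inverse_arrows C f g)"

definition inv_arr :: "('o, 'm, 'e) cat_scheme \<Rightarrow> 'm \<Rightarrow> 'm" where
  "inv_arr C f = (THE g. inverse_arrows C f g)"

definition isos :: "('o, 'm, 'e) cat_scheme \<Rightarrow> 'o \<Rightarrow> 'o \<Rightarrow> 'm set" where
  "isos C x y = {f \<in> homs C x y. is_iso C f}"

definition initial_object :: "('o, 'm, 'e) cat_scheme \<Rightarrow> 'o \<Rightarrow> bool" where
  "initial_object C z \<longleftrightarrow> z \<in> Obj C \<and> (\<forall>x\<in>Obj C. \<exists>!f. f \<in> homs C z x)"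

definition terminal_object :: "('o, 'm, 'e) cat_scheme \<Rightarrow> 'o \<Rightarrow> bool" where
  "terminal_object C z \<longleftrightarrow> z \<in> Obj C \<and> (\<forall>x\<in>Obj C. \<exists>!f. f \<in> homs C x z)"

definition zero_object :: "('o, 'm, 'e) cat_scheme \<Rightarrow> 'o \<Rightarrow> bool" where
  "zero_object C z \<longleftrightarrow> initial_object C z \<and> terminal_object C z"

text \<open>The object carrying a coproduct with injections \<open>a\<close>, \<open>b\<close> is \<open>Cod C a = Cod C b\<close>.\<close>

definition is_coproduct :: "('o, 'm, 'e) cat_scheme \<Rightarrow> 'm \<Rightarrow> 'm \<Rightarrow> bool" where
  "is_coproduct C a b \<longleftrightarrow> a \<in> Arr C \<and> b \<in> Arr C \<and> Cod C a = Cod C b \<and>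
     (\<forall>z. \<forall>f\<in>homs C (Dom C a) z. \<forall>g\<in>homs C (Dom C b) z.
        \<exists>!t. t \<in> homs C (Cod C a) z \<and> t \<cdot>\<^bsub>C\<^esub> a = f \<and> t \<cdot>\<^bsub>C\<^esub> b = g)"

text \<open>In \<open>is_pushout C f g f' g'\<close> the arrow \<open>f'\<close> starts at the codomain of \<open>f\<close>, and \<open>g'\<close> at that
  of \<open>g\<close>, so the square reads \<open>f' \<cdot> f = g' \<cdot> g\<close>; dually for pullbacks.\<close>

definition is_pushout :: "('o, 'm, 'e) cat_scheme \<Rightarrow> 'm \<Rightarrow> 'm \<Rightarrow> 'm \<Rightarrow> 'm \<Rightarrow> bool" where
  "is_pushout C f g f' g' \<longleftrightarrow> f \<in> Arr C \<and> g \<in> Arr C \<and> f' \<in> Arr C \<and> g' \<in> Arr C \<and>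
     Dom C f = Dom C g \<and> Dom C f' = Cod C f \<and> Dom C g' = Cod C g \<and> Cod C f' = Cod C g' \<and>
     f' \<cdot>\<^bsub>C\<^esub> f = g' \<cdot>\<^bsub>C\<^esub> g \<and>
     (\<forall>z. \<forall>h\<in>homs C (Cod C f) z. \<forall>k\<in>homs C (Cod C g) z. h \<cdot>\<^bsub>C\<^esub> f = k \<cdot>\<^bsub>C\<^esub> g \<longrightarrow>
        (\<exists>!t. t \<in> homs C (Cod C f') z \<and> t \<cdot>\<^bsub>C\<^esub> f' = h \<and> t \<cdot>\<^bsub>C\<^esub> g' = k))"

definition is_pullback :: "('o, 'm, 'e) cat_scheme \<Rightarrow> 'm \<Rightarrow> 'm \<Rightarrow> 'm \<Rightarrow> 'm \<Rightarrow> bool" where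
  "is_pullback C f g f' g' \<longleftrightarrow> f \<in> Arr C \<and> g \<in> Arr C \<and> f' \<in> Arr C \<and> g' \<in> Arr C \<and>
     Cod C f = Cod C g \<and> Cod C f' = Dom C f \<and> Cod C g' = Dom C g \<and> Dom C f' = Dom C g' \<and>
     f \<cdot>\<^bsub>C\<^esub> f' = g \<cdot>\<^bsub>C\<^esub> g' \<and>
     (\<forall>z. \<forall>h\<in>homs C z (Dom C f). \<forall>k\<in>homs C z (Dom C g). f \<cdot>\<^bsub>C\<^esub> h = g \<cdot>\<^bsub>C\<^esub> k \<longrightarrow>
        (\<exists>!t. t \<in> homs C z (Dom C f') \<and> f' \<cdot>\<^bsub>C\<^esub> t = h \<and> g' \<cdot>\<^bsub>C\<^esub> t = k))"

record ('o, 'm, 'p, 'n) fmap =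
  omap :: "'o \<Rightarrow> 'p"
  amap :: "'m \<Rightarrow> 'n"

definition is_functor ::
  "('o, 'm, 'e) cat_scheme \<Rightarrow> ('p, 'n, 'd) cat_scheme \<Rightarrow> ('o, 'm, 'p, 'n) fmap \<Rightarrow> bool" where
  "is_functor C D G \<longleftrightarrow>
     (\<forall>x\<in>Obj C. omap G x \<in> Obj D \<and> amap G (Ide C x) = Ide D (omap G x)) \<and>
     (\<forall>f\<in>Arr C. amap G f \<in> homs D (omap G (Dom C f)) (omap G (Cod C f))) \<and>
     (\<forall>f\<in>Arr C. \<forall>g\<in>Arr C. Cod C f = Dom C g \<longrightarrow>
        amap G (g \<cdot>\<^bsub>C\<^esub> f) = amap G g \<cdot>\<^bsub>D\<^esub> amap G f)"

definition fid :: "('o, 'm, 'o, 'm) fmap" where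
  "fid = \<lparr>omap = (\<lambda>x. x), amap = (\<lambda>f. f)\<rparr>"

definition fcomp ::
  "('p, 'n, 'q, 'k) fmap \<Rightarrow> ('o, 'm, 'p, 'n) fmap \<Rightarrow> ('o, 'm, 'q, 'k) fmap"  (infixr "\<circ>\<^sub>F" 65) where
  "H \<circ>\<^sub>F G = \<lparr>omap = omap H \<circ> omap G, amap = amap H \<circ> amap G\<rparr>"

definition natural_iso ::
  "('o, 'm, 'e) cat_scheme \<Rightarrow> ('p, 'n, 'd) cat_scheme \<Rightarrow> ('o, 'm, 'p, 'n) fmap \<Rightarrow>
   ('o, 'm, 'p, 'n) fmap \<Rightarrow> ('o \<Rightarrow> 'n) \<Rightarrow> bool" where
  "natural_iso C D G H \<eta> \<longleftrightarrow>
     (\<forall>x\<in>Obj C. \<eta> x \<in> isos D (omap G x) (omap H x)) \<and>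
     (\<forall>f\<in>Arr C. \<eta> (Cod C f) \<cdot>\<^bsub>D\<^esub> amap G f = amap H f \<cdot>\<^bsub>D\<^esub> \<eta> (Dom C f))"

definition quasi_inverse ::
  "('o, 'm, 'e) cat_scheme \<Rightarrow> ('p, 'n, 'd) cat_scheme \<Rightarrow> ('o, 'm, 'p, 'n) fmap \<Rightarrow>
   ('p, 'n, 'o, 'm) fmap \<Rightarrow> bool" where
  "quasi_inverse C D G H \<longleftrightarrow> is_functor C D G \<and> is_functor D C H \<and>
     (\<exists>\<eta>. natural_iso C C fid (H \<circ>\<^sub>F G) \<eta>) \<and> (\<exists>\<epsilon>. natural_iso D D (G \<circ>\<^sub>F H) fid \<epsilon>)"

definition equivalence ::
  "('o, 'm, 'e) cat_scheme \<Rightarrow> ('p, 'n, 'd) cat_scheme \<Rightarrow> ('o, 'm, 'p, 'n) fmap \<Rightarrow> bool" where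
  "equivalence C D G \<longleftrightarrow> (\<exists>H. quasi_inverse C D G H)"


section \<open>Additive, exact and Frobenius categories\<close>

record ('o, 'm) add_cat = "('o, 'm) cat" +
  Plus :: "'m \<Rightarrow> 'm \<Rightarrow> 'm"
  Zero :: "'o \<Rightarrow> 'o \<Rightarrow> 'm"

definition hom_group :: "('o, 'm, 'e) add_cat_scheme \<Rightarrow> 'o \<Rightarrow> 'o \<Rightarrow> 'm monoid" where
  "hom_group C x y = \<lparr>carrier = homs C x y, mult = Plus C, one = Zero C x y\<rparr>"

locale additive_category = category C
  for C :: "('o, 'm, 'e) add_cat_scheme" (structure) +
  assumes hom_comm_group: "\<lbrakk>x \<in> Obj C; y \<in> Obj C\<rbrakk> \<Longrightarrow> comm_group (hom_group C x y)"
    and Comp_Plus: "\<lbrakk>f \<in> homs C x y; g \<in> homs C x y; h \<in> homs C y z\<rbrakk>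
                     \<Longrightarrow> h \<cdot> Plus C f g = Plus C (h \<cdot> f) (h \<cdot> g)"
    and Plus_Comp: "\<lbrakk>f \<in> homs C y z; g \<in> homs C y z; h \<in> homs C x y\<rbrakk>
                     \<Longrightarrow> Plus C f g \<cdot> h = Plus C (f \<cdot> h) (g \<cdot> h)"
    and has_zero: "\<exists>z. zero_object C z"
    and has_coproducts: "\<lbrakk>x \<in> Obj C; y \<in> Obj C\<rbrakk>
                     \<Longrightarrow> \<exists>a b. Dom C a = x \<and> Dom C b = y \<and> is_coproduct C a b"

definition is_kernel :: "('o, 'm, 'e) add_cat_scheme \<Rightarrow> 'm \<Rightarrow> 'm \<Rightarrow> bool" where
  "is_kernel C f k \<longleftrightarrow> f \<in> Arr C \<and> k \<in> Arr C \<and> Cod C k = Dom C f \<and>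
     f \<cdot>\<^bsub>C\<^esub> k = Zero C (Dom C k) (Cod C f) \<and>
     (\<forall>z. \<forall>h\<in>homs C z (Dom C f). f \<cdot>\<^bsub>C\<^esub> h = Zero C z (Cod C f) \<longrightarrow>
        (\<exists>!t. t \<in> homs C z (Dom C k) \<and> k \<cdot>\<^bsub>C\<^esub> t = h))"

definition is_cokernel :: "('o, 'm, 'e) add_cat_scheme \<Rightarrow> 'm \<Rightarrow> 'm \<Rightarrow> bool" where
  "is_cokernel C f p \<longleftrightarrow> f \<in> Arr C \<and> p \<in> Arr C \<and> Dom C p = Cod C f \<and>
     p \<cdot>\<^bsub>C\<^esub> f = Zero C (Dom C f) (Cod C p) \<and>
     (\<forall>z. \<forall>h\<in>homs C (Cod C f) z. h \<cdot>\<^bsub>C\<^esub> f = Zero C (Dom C f) z \<longrightarrow>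
        (\<exists>!t. t \<in> homs C (Cod C p) z \<and> t \<cdot>\<^bsub>C\<^esub> p = h))"

definition weakly_idempotent_complete :: "('o, 'm, 'e) add_cat_scheme \<Rightarrow> bool" where
  "weakly_idempotent_complete C \<longleftrightarrow>
     (\<forall>f\<in>Arr C. (\<exists>r\<in>homs C (Cod C f) (Dom C f). r \<cdot>\<^bsub>C\<^esub> f = Ide C (Dom C f)) \<longrightarrow>
        (\<exists>p. is_cokernel C f p))"

text \<open>\<open>Conf\<close> is the class of admissible short exact sequences \<open>(i, p)\<close>.\<close>

record ('o, 'm) exact_cat = "('o, 'm) add_cat" +
  Conf :: "('m \<times> 'm) set"

definition adm_mono :: "('o, 'm, 'e) exact_cat_scheme \<Rightarrow> 'm \<Rightarrow> bool" where
  "adm_mono C i \<longleftrightarrow> (\<exists>p. (i, p) \<in> Conf C)"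

definition adm_epi :: "('o, 'm, 'e) exact_cat_scheme \<Rightarrow> 'm \<Rightarrow> bool" where
  "adm_epi C p \<longleftrightarrow> (\<exists>i. (i, p) \<in> Conf C)"

text \<open>Quillen's axioms, in the form given by Keller.\<close>

locale exact_category = additive_category C
  for C :: "('o, 'm, 'e) exact_cat_scheme" (structure) +
  assumes Conf_kernel: "(i, p) \<in> Conf C \<Longrightarrow> is_kernel C p i"
    and Conf_cokernel: "(i, p) \<in> Conf C \<Longrightarrow> is_cokernel C i p"
    and Conf_iso: "\<lbrakk>(i, p) \<in> Conf C; a \<in> isos C (Dom C i) x; b \<in> isos C (Cod C i) y;
                    c \<in> isos C (Cod C p) z; i' \<in> homs C x y; p' \<in> homs C y z;
                    i' \<cdot> a = b \<cdot> i; p' \<cdot> b = c \<cdot> p\<rbrakk> \<Longrightarrow> (i', p') \<in> Conf C"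
    and adm_mono_Ide: "x \<in> Obj C \<Longrightarrow> adm_mono C (Ide C x)"
    and adm_epi_Ide: "x \<in> Obj C \<Longrightarrow> adm_epi C (Ide C x)"
    and adm_mono_Comp: "\<lbrakk>adm_mono C f; adm_mono C g; Cod C f = Dom C g\<rbrakk> \<Longrightarrow> adm_mono C (g \<cdot> f)"
    and adm_epi_Comp: "\<lbrakk>adm_epi C f; adm_epi C g; Cod C f = Dom C g\<rbrakk> \<Longrightarrow> adm_epi C (g \<cdot> f)"
    and adm_mono_pushout: "\<lbrakk>adm_mono C i; f \<in> Arr C; Dom C f = Dom C i\<rbrakk>
                    \<Longrightarrow> \<exists>i' f'. is_pushout C f i i' f' \<and> adm_mono C i'"
    and adm_epi_pullback: "\<lbrakk>adm_epi C p; f \<in> Arr C; Cod C f = Cod C p\<rbrakk>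
                    \<Longrightarrow> \<exists>p' f'. is_pullback C f p p' f' \<and> adm_epi C p'"

definition projective :: "('o, 'm, 'e) exact_cat_scheme \<Rightarrow> 'o \<Rightarrow> bool" where
  "projective C x \<longleftrightarrow> x \<in> Obj C \<and>
     (\<forall>p. adm_epi C p \<longrightarrow> (\<forall>f\<in>homs C x (Cod C p). \<exists>g\<in>homs C x (Dom C p). p \<cdot>\<^bsub>C\<^esub> g = f))"

definition injective :: "('o, 'm, 'e) exact_cat_scheme \<Rightarrow> 'o \<Rightarrow> bool" where
  "injective C x \<longleftrightarrow> x \<in> Obj C \<and>
     (\<forall>i. adm_mono C i \<longrightarrow> (\<forall>f\<in>homs C (Dom C i) x. \<exists>g\<in>homs C (Cod C i) x. g \<cdot>\<^bsub>C\<^esub> i = f))"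

locale frobenius_category = exact_category C
  for C :: "('o, 'm, 'e) exact_cat_scheme" (structure) +
  assumes enough_projectives: "x \<in> Obj C \<Longrightarrow> \<exists>p. adm_epi C p \<and> Cod C p = x \<and> projective C (Dom C p)"
    and enough_injectives: "x \<in> Obj C \<Longrightarrow> \<exists>i. adm_mono C i \<and> Dom C i = x \<and> injective C (Cod C i)"
    and projective_iff_injective: "projective C x \<longleftrightarrow> injective C x"


section \<open>The stable category\<close>

definition factors_projinj :: "('o, 'm, 'e) exact_cat_scheme \<Rightarrow> 'm \<Rightarrow> bool" where
  "factors_projinj C f \<longleftrightarrow> (\<exists>x. projective C x \<and> injective C x \<and>
     (\<exists>a\<in>homs C (Dom C f) x. \<exists>b\<in>homs C x (Cod C f). f = b \<cdot>\<^bsub>C\<^esub> a))"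

definition stable_class :: "('o, 'm, 'e) exact_cat_scheme \<Rightarrow> 'm \<Rightarrow> 'm set" where
  "stable_class C f = {g. \<exists>h\<in>homs C (Dom C f) (Cod C f). factors_projinj C h \<and> g = Plus C f h}"

definition stable_category :: "('o, 'm, 'e) exact_cat_scheme \<Rightarrow> ('o, 'm set) cat" where
  "stable_category C = \<lparr>Obj = Obj C, Arr = stable_class C ` Arr C,
     Dom = (\<lambda>c. the_elem (Dom C ` c)), Cod = (\<lambda>c. the_elem (Cod C ` c)),
     Ide = (\<lambda>x. stable_class C (Ide C x)),
     Comp = (\<lambda>d c. \<Union>g\<in>d. \<Union>f\<in>c. stable_class C (g \<cdot>\<^bsub>C\<^esub> f))\<rparr>"

definition stable_proj :: "('o, 'm, 'e) exact_cat_scheme \<Rightarrow> ('o, 'm, 'o, 'm set) fmap" where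
  "stable_proj C = \<lparr>omap = (\<lambda>x. x), amap = stable_class C\<rparr>"

definition stable_equivalences :: "('o, 'm, 'e) exact_cat_scheme \<Rightarrow> 'm set" where
  "stable_equivalences C = {f \<in> Arr C. is_iso (stable_category C) (stable_class C f)}"


section \<open>Localization\<close>

text \<open>Gabriel--Zisman localization: a morphism of \<open>C[W\<^sup>-\<^sup>1]\<close> is a class of zigzags. A zigzag is read
  from left to right, \<open>Fwd f\<close> being traversed along \<open>f\<close> and \<open>Bwd w\<close> against \<open>w \<in> W\<close>.\<close>

datatype 'm zstep = Fwd 'm | Bwd 'm

fun step_ok :: "('o, 'm, 'e) cat_scheme \<Rightarrow> 'm set \<Rightarrow> 'm zstep \<Rightarrow> bool" where
  "step_ok C W (Fwd f) = (f \<in> Arr C)"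
| "step_ok C W (Bwd w) = (w \<in> W \<and> w \<in> Arr C)"

fun step_src :: "('o, 'm, 'e) cat_scheme \<Rightarrow> 'm zstep \<Rightarrow> 'o" where
  "step_src C (Fwd f) = Dom C f"
| "step_src C (Bwd w) = Cod C w"

fun step_tgt :: "('o, 'm, 'e) cat_scheme \<Rightarrow> 'm zstep \<Rightarrow> 'o" where
  "step_tgt C (Fwd f) = Cod C f"
| "step_tgt C (Bwd w) = Dom C w"

fun zigzag :: "('o, 'm, 'e) cat_scheme \<Rightarrow> 'm set \<Rightarrow> 'o \<Rightarrow> 'o \<Rightarrow> 'm zstep list \<Rightarrow> bool" where
  "zigzag C W x y [] = (x \<in> Obj C \<and> x = y)"
| "zigzag C W x y (s # p) = (step_ok C W s \<and> step_src C s = x \<and> zigzag C W (step_tgt C s) y p)"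

inductive zigzag_eq ::
  "('o, 'm, 'e) cat_scheme \<Rightarrow> 'm set \<Rightarrow> 'o \<Rightarrow> 'o \<Rightarrow> 'm zstep list \<Rightarrow> 'm zstep list \<Rightarrow> bool"
  for C W where
  refl: "zigzag C W x y p \<Longrightarrow> zigzag_eq C W x y p p"
| sym: "zigzag_eq C W x y p q \<Longrightarrow> zigzag_eq C W x y q p"
| trans: "\<lbrakk>zigzag_eq C W x y p q; zigzag_eq C W x y q r\<rbrakk> \<Longrightarrow> zigzag_eq C W x y p r"
| append: "\<lbrakk>zigzag_eq C W x y p p'; zigzag_eq C W y z q q'\<rbrakk> \<Longrightarrow> zigzag_eq C W x z (p @ q) (p' @ q')"
| ide: "x \<in> Obj C \<Longrightarrow> zigzag_eq C W x x [Fwd (Ide C x)] []"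
| comp: "\<lbrakk>f \<in> homs C x y; g \<in> homs C y z\<rbrakk> \<Longrightarrow> zigzag_eq C W x z [Fwd f, Fwd g] [Fwd (g \<cdot>\<^bsub>C\<^esub> f)]"
| fwd_bwd: "\<lbrakk>w \<in> W; w \<in> homs C x y\<rbrakk> \<Longrightarrow> zigzag_eq C W x x [Fwd w, Bwd w] []"
| bwd_fwd: "\<lbrakk>w \<in> W; w \<in> homs C x y\<rbrakk> \<Longrightarrow> zigzag_eq C W y y [Bwd w, Fwd w] []"

type_synonym ('o, 'm) loc_arr = "'o \<times> 'o \<times> 'm zstep list set"

definition loc_class ::
  "('o, 'm, 'e) cat_scheme \<Rightarrow> 'm set \<Rightarrow> 'o \<Rightarrow> 'o \<Rightarrow> 'm zstep list \<Rightarrow> ('o, 'm) loc_arr" where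
  "loc_class C W x y p = (x, y, {q. zigzag_eq C W x y p q})"

definition localization :: "('o, 'm, 'e) cat_scheme \<Rightarrow> 'm set \<Rightarrow> ('o, ('o, 'm) loc_arr) cat" where
  "localization C W = \<lparr>Obj = Obj C,
     Arr = {loc_class C W x y p | x y p. zigzag C W x y p},
     Dom = (\<lambda>(x, y, c). x), Cod = (\<lambda>(x, y, c). y),
     Ide = (\<lambda>x. loc_class C W x x []),
     Comp = (\<lambda>(y', z, d) (x, y, c). (x, z, {r. \<exists>p\<in>c. \<exists>q\<in>d. zigzag_eq C W x z (p @ q) r}))\<rparr>"

definition loc_functor :: "('o, 'm, 'e) cat_scheme \<Rightarrow> 'm set \<Rightarrow> ('o, 'm, 'o, ('o, 'm) loc_arr) fmap" where
  "loc_functor C W =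
     \<lparr>omap = (\<lambda>x. x), amap = (\<lambda>f. loc_class C W (Dom C f) (Cod C f) [Fwd f])\<rparr>"

fun step_eval :: "('p, 'n, 'd) cat_scheme \<Rightarrow> ('o, 'm, 'p, 'n) fmap \<Rightarrow> 'm zstep \<Rightarrow> 'n" where
  "step_eval D G (Fwd f) = amap G f"
| "step_eval D G (Bwd w) = inv_arr D (amap G w)"

fun zigzag_eval ::
  "('o, 'm, 'e) cat_scheme \<Rightarrow> ('p, 'n, 'd) cat_scheme \<Rightarrow> ('o, 'm, 'p, 'n) fmap \<Rightarrow>
   'o \<Rightarrow> 'm zstep list \<Rightarrow> 'n" where
  "zigzag_eval C D G x [] = Ide D (omap G x)"
| "zigzag_eval C D G x (s # p) = zigzag_eval C D G (step_tgt C s) p \<cdot>\<^bsub>D\<^esub> step_eval D G s"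

text \<open>The functor on the localization induced by a functor \<open>G\<close> from \<open>C\<close> to \<open>D\<close> that inverts the
  localized arrows; on other \<open>G\<close> its value is meaningless.\<close>

definition loc_induced ::
  "('o, 'm, 'e) cat_scheme \<Rightarrow> ('p, 'n, 'd) cat_scheme \<Rightarrow> ('o, 'm, 'p, 'n) fmap \<Rightarrow>
   ('o, ('o, 'm) loc_arr, 'p, 'n) fmap" where
  "loc_induced C D G =
     \<lparr>omap = omap G, amap = (\<lambda>(x, y, c). zigzag_eval C D G x (SOME p. p \<in> c))\<rparr>"


section \<open>Model structures, homotopy categories and derived functors\<close>

record 'm model =
  Weq :: "'m set"
  Cofib :: "'m set"
  Fib :: "'m set"

definition Ho :: "('o, 'm, 'e) cat_scheme \<Rightarrow> 'm model \<Rightarrow> ('o, ('o, 'm) loc_arr) cat" where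
  "Ho C M = localization C (Weq M)"

definition Ho_functor :: "('o, 'm, 'e) cat_scheme \<Rightarrow> 'm model \<Rightarrow> ('o, 'm, 'o, ('o, 'm) loc_arr) fmap" where
  "Ho_functor C M = loc_functor C (Weq M)"

definition cofibrant :: "('o, 'm, 'e) cat_scheme \<Rightarrow> 'm model \<Rightarrow> 'o \<Rightarrow> bool" where
  "cofibrant C M x \<longleftrightarrow> x \<in> Obj C \<and> (\<exists>z. initial_object C z \<and> (\<exists>f\<in>homs C z x. f \<in> Cofib M))"

definition fibrant :: "('o, 'm, 'e) cat_scheme \<Rightarrow> 'm model \<Rightarrow> 'o \<Rightarrow> bool" where
  "fibrant C M x \<longleftrightarrow> x \<in> Obj C \<and> (\<exists>z. terminal_object C z \<and> (\<exists>f\<in>homs C x z. f \<in> Fib M))"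

definition cofibrant_replacement ::
  "('o, 'm, 'e) cat_scheme \<Rightarrow> 'm model \<Rightarrow> ('o \<Rightarrow> 'o) \<Rightarrow> ('o \<Rightarrow> 'm) \<Rightarrow> bool" where
  "cofibrant_replacement C M Q q \<longleftrightarrow>
     (\<forall>x\<in>Obj C. cofibrant C M (Q x) \<and> q x \<in> homs C (Q x) x \<and> q x \<in> Weq M \<inter> Fib M)"

definition fibrant_replacement ::
  "('o, 'm, 'e) cat_scheme \<Rightarrow> 'm model \<Rightarrow> ('o \<Rightarrow> 'o) \<Rightarrow> ('o \<Rightarrow> 'm) \<Rightarrow> bool" where
  "fibrant_replacement C M R r \<longleftrightarrow>
     (\<forall>x\<in>Obj C. fibrant C M (R x) \<and> r x \<in> homs C x (R x) \<and> r x \<in> Weq M \<inter> Cofib M)"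

text \<open>The replacements need not be functorial: an arrow \<open>f\<close> is first lifted to an arrow \<open>f'\<close> between
  the replacements, and the image of \<open>f'\<close> in the target homotopy category does not depend on the
  lift. The resulting functor inverts weak equivalences and is extended to the localization.\<close>

definition left_derived ::
  "('o, 'm, 'e) cat_scheme \<Rightarrow> 'm model \<Rightarrow> ('p, 'n, 'd) cat_scheme \<Rightarrow> 'n model \<Rightarrow>
   ('o \<Rightarrow> 'o) \<Rightarrow> ('o \<Rightarrow> 'm) \<Rightarrow> ('o, 'm, 'p, 'n) fmap \<Rightarrow>
   ('o, ('o, 'm) loc_arr, 'p, ('p, 'n) loc_arr) fmap" where
  "left_derived C M D N Q q G = loc_induced C (Ho D N)
     \<lparr>omap = (\<lambda>x. omap G (Q x)),
      amap = (\<lambda>f. THE h. \<exists>f'\<in>homs C (Q (Dom C f)) (Q (Cod C f)).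
                 q (Cod C f) \<cdot>\<^bsub>C\<^esub> f' = f \<cdot>\<^bsub>C\<^esub> q (Dom C f) \<and> h = amap (Ho_functor D N) (amap G f'))\<rparr>"

definition right_derived ::
  "('o, 'm, 'e) cat_scheme \<Rightarrow> 'm model \<Rightarrow> ('p, 'n, 'd) cat_scheme \<Rightarrow> 'n model \<Rightarrow>
   ('o \<Rightarrow> 'o) \<Rightarrow> ('o \<Rightarrow> 'm) \<Rightarrow> ('o, 'm, 'p, 'n) fmap \<Rightarrow>
   ('o, ('o, 'm) loc_arr, 'p, ('p, 'n) loc_arr) fmap" where
  "right_derived C M D N R r G = loc_induced C (Ho D N)
     \<lparr>omap = (\<lambda>x. omap G (R x)),
      amap = (\<lambda>f. THE h. \<exists>f'\<in>homs C (R (Dom C f)) (R (Cod C f)).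
                 f' \<cdot>\<^bsub>C\<^esub> r (Dom C f) = r (Cod C f) \<cdot>\<^bsub>C\<^esub> f \<and> h = amap (Ho_functor D N) (amap G f'))\<rparr>"

definition canonical_model :: "('o, 'm, 'e) exact_cat_scheme \<Rightarrow> 'm model" where
  "canonical_model C =
     \<lparr>Weq = stable_equivalences C, Cofib = {f. adm_mono C f}, Fib = {f. adm_epi C f}\<rparr>"

text \<open>The identification of the stable category with the homotopy category of a Frobenius category:
  two mutually inverse functors, both the identity on objects.\<close>

definition stable_to_Ho :: "('o, 'm, 'e) exact_cat_scheme \<Rightarrow> ('o, 'm set, 'o, ('o, 'm) loc_arr) fmap" where
  "stable_to_Ho C =
     \<lparr>omap = (\<lambda>x. x), amap = (\<lambda>c. amap (Ho_functor C (canonical_model C)) (SOME f. f \<in> c))\<rparr>"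

definition Ho_to_stable :: "('o, 'm, 'e) exact_cat_scheme \<Rightarrow> ('o, ('o, 'm) loc_arr, 'o, 'm set) fmap" where
  "Ho_to_stable C = loc_induced C (stable_category C) (stable_proj C)"


section \<open>Triangle equivalences\<close>

text \<open>A triangle on \<open>(C, S)\<close> is a triple of arrows \<open>x \<rightarrow> y \<rightarrow> z \<rightarrow> S x\<close>.\<close>

definition is_triangle :: "('o, 'm, 'e) cat_scheme \<Rightarrow> ('o, 'm, 'o, 'm) fmap \<Rightarrow> 'm \<times> 'm \<times> 'm \<Rightarrow> bool" where
  "is_triangle C S = (\<lambda>(f, g, h). f \<in> Arr C \<and> g \<in> Arr C \<and> h \<in> Arr C \<and>
     Cod C f = Dom C g \<and> Cod C g = Dom C h \<and> Cod C h = omap S (Dom C f))"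

definition iso_triangles ::
  "('o, 'm, 'e) cat_scheme \<Rightarrow> ('o, 'm, 'o, 'm) fmap \<Rightarrow> 'm \<times> 'm \<times> 'm \<Rightarrow> 'm \<times> 'm \<times> 'm \<Rightarrow> bool" where
  "iso_triangles C S = (\<lambda>(f, g, h) (f', g', h').
     is_triangle C S (f, g, h) \<and> is_triangle C S (f', g', h') \<and>
     (\<exists>a\<in>isos C (Dom C f) (Dom C f'). \<exists>b\<in>isos C (Dom C g) (Dom C g'). \<exists>c\<in>isos C (Dom C h) (Dom C h').
        b \<cdot>\<^bsub>C\<^esub> f = f' \<cdot>\<^bsub>C\<^esub> a \<and> c \<cdot>\<^bsub>C\<^esub> g = g' \<cdot>\<^bsub>C\<^esub> b \<and> amap S a \<cdot>\<^bsub>C\<^esub> h = h' \<cdot>\<^bsub>C\<^esub> c))"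

definition triangle_equivalence ::
  "('o, 'm, 'e) cat_scheme \<Rightarrow> ('o, 'm, 'o, 'm) fmap \<Rightarrow> ('m \<times> 'm \<times> 'm) set \<Rightarrow>
   ('p, 'n, 'd) cat_scheme \<Rightarrow> ('p, 'n, 'p, 'n) fmap \<Rightarrow> ('n \<times> 'n \<times> 'n) set \<Rightarrow>
   ('o, 'm, 'p, 'n) fmap \<Rightarrow> bool" where
  "triangle_equivalence C S T D S' T' G \<longleftrightarrow> equivalence C D G \<and>
     (\<exists>\<eta>. natural_iso C D (G \<circ>\<^sub>F S) (S' \<circ>\<^sub>F G) \<eta> \<and>
        (\<forall>(f, g, h)\<in>T. (amap G f, amap G g, \<eta> (Dom C f) \<cdot>\<^bsub>D\<^esub> amap G h) \<in> T'))"


section \<open>The triangulated structure of the stable category\<close>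

text \<open>The arrows \<open>i x\<close> embed the objects into injectives, and \<open>p x\<close> is the cokernel of \<open>i x\<close>; hence
  the suspension of \<open>x\<close> is \<open>Cod C (p x)\<close>.\<close>

definition suspension_choice ::
  "('o, 'm, 'e) exact_cat_scheme \<Rightarrow> ('o \<Rightarrow> 'm) \<Rightarrow> ('o \<Rightarrow> 'm) \<Rightarrow> bool" where
  "suspension_choice C i p \<longleftrightarrow>
     (\<forall>x\<in>Obj C. Dom C (i x) = x \<and> adm_mono C (i x) \<and> injective C (Cod C (i x)) \<and>
        is_cokernel C (i x) (p x))"

text \<open>\<open>\<sigma>\<close> is a suspension of \<open>s\<close>, obtained from an extension \<open>j\<close> of \<open>s\<close> to the chosen injectives.\<close>

definition suspends ::
  "('o, 'm, 'e) exact_cat_scheme \<Rightarrow> ('o \<Rightarrow> 'm) \<Rightarrow> ('o \<Rightarrow> 'm) \<Rightarrow> 'm \<Rightarrow> 'm \<Rightarrow> bool" where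
  "suspends C i p s \<sigma> \<longleftrightarrow> s \<in> Arr C \<and>
     \<sigma> \<in> homs C (Cod C (p (Dom C s))) (Cod C (p (Cod C s))) \<and>
     (\<exists>j\<in>homs C (Cod C (i (Dom C s))) (Cod C (i (Cod C s))).
        j \<cdot>\<^bsub>C\<^esub> i (Dom C s) = i (Cod C s) \<cdot>\<^bsub>C\<^esub> s \<and> \<sigma> \<cdot>\<^bsub>C\<^esub> p (Dom C s) = p (Cod C s) \<cdot>\<^bsub>C\<^esub> j)"

definition stable_suspension ::
  "('o, 'm, 'e) exact_cat_scheme \<Rightarrow> ('o \<Rightarrow> 'm) \<Rightarrow> ('o \<Rightarrow> 'm) \<Rightarrow> ('o, 'm set, 'o, 'm set) fmap" where
  "stable_suspension C i p =
     \<lparr>omap = (\<lambda>x. Cod C (p x)),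
      amap = (\<lambda>c. THE d. \<exists>s\<in>c. \<exists>\<sigma>. suspends C i p s \<sigma> \<and> d = stable_class C \<sigma>)\<rparr>"

definition standard_sequence ::
  "('o, 'm, 'e) exact_cat_scheme \<Rightarrow> ('o \<Rightarrow> 'm) \<Rightarrow> ('o \<Rightarrow> 'm) \<Rightarrow> 'm \<Rightarrow> 'm \<Rightarrow> 'm \<Rightarrow> bool" where
  "standard_sequence C i p s t w \<longleftrightarrow>
     (\<exists>k. is_pushout C s (i (Dom C s)) t k \<and> w \<in> homs C (Cod C t) (Cod C (p (Dom C s))) \<and>
        w \<cdot>\<^bsub>C\<^esub> k = p (Dom C s) \<and> w \<cdot>\<^bsub>C\<^esub> t = Zero C (Cod C s) (Cod C (p (Dom C s))))"

definition stable_triangles ::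
  "('o, 'm, 'e) exact_cat_scheme \<Rightarrow> ('o \<Rightarrow> 'm) \<Rightarrow> ('o \<Rightarrow> 'm) \<Rightarrow> ('m set \<times> 'm set \<times> 'm set) set" where
  "stable_triangles C i p = {T. \<exists>s t w. standard_sequence C i p s t w \<and>
     iso_triangles (stable_category C) (stable_suspension C i p) T
       (stable_class C s, stable_class C t, stable_class C w)}"


section \<open>The coslice category\<close>

definition coslice :: "('o, 'm, 'e) cat_scheme \<Rightarrow> 'o \<Rightarrow> ('m, 'm \<times> 'm \<times> 'm) cat" where
  "coslice C A = \<lparr>Obj = {f \<in> Arr C. Dom C f = A},
     Arr = {(f, f', \<alpha>). f \<in> Arr C \<and> f' \<in> Arr C \<and> Dom C f = A \<and> Dom C f' = A \<and>
              \<alpha> \<in> homs C (Cod C f) (Cod C f') \<and> f' = \<alpha> \<cdot>\<^bsub>C\<^esub> f},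
     Dom = (\<lambda>(f, f', \<alpha>). f), Cod = (\<lambda>(f, f', \<alpha>). f'),
     Ide = (\<lambda>f. (f, f, Ide C (Cod C f))),
     Comp = (\<lambda>(g, g', \<beta>) (f, f', \<alpha>). (f, g', \<beta> \<cdot>\<^bsub>C\<^esub> \<alpha>))\<rparr>"

definition forgetful :: "('o, 'm, 'e) cat_scheme \<Rightarrow> ('m, 'm \<times> 'm \<times> 'm, 'o, 'm) fmap" where
  "forgetful C = \<lparr>omap = Cod C, amap = (\<lambda>(f, f', \<alpha>). \<alpha>)\<rparr>"

definition coslice_model :: "('o, 'm, 'e) cat_scheme \<Rightarrow> 'o \<Rightarrow> 'm model \<Rightarrow> ('m \<times> 'm \<times> 'm) model" where
  "coslice_model C A M =
     \<lparr>Weq = {a \<in> Arr (coslice C A). amap (forgetful C) a \<in> Weq M},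
      Cofib = {a \<in> Arr (coslice C A). amap (forgetful C) a \<in> Cofib M},
      Fib = {a \<in> Arr (coslice C A). amap (forgetful C) a \<in> Fib M}\<rparr>"

text \<open>\<open>u x\<close> and \<open>v x\<close> are the injections of \<open>A\<close> and \<open>x\<close> into a chosen coproduct \<open>A \<oplus> x\<close>.\<close>

definition coproduct_choice ::
  "('o, 'm, 'e) cat_scheme \<Rightarrow> 'o \<Rightarrow> ('o \<Rightarrow> 'm) \<Rightarrow> ('o \<Rightarrow> 'm) \<Rightarrow> bool" where
  "coproduct_choice C A u v \<longleftrightarrow>
     (\<forall>x\<in>Obj C. Dom C (u x) = A \<and> Dom C (v x) = x \<and> is_coproduct C (u x) (v x))"

definition plus_id :: "('o, 'm, 'e) cat_scheme \<Rightarrow> ('o \<Rightarrow> 'm) \<Rightarrow> ('o \<Rightarrow> 'm) \<Rightarrow> 'm \<Rightarrow> 'm" where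
  "plus_id C u v s = (THE t. t \<in> homs C (Cod C (u (Dom C s))) (Cod C (u (Cod C s))) \<and>
     t \<cdot>\<^bsub>C\<^esub> u (Dom C s) = u (Cod C s) \<and> t \<cdot>\<^bsub>C\<^esub> v (Dom C s) = v (Cod C s) \<cdot>\<^bsub>C\<^esub> s)"

definition zero_shriek ::
  "('o, 'm, 'e) cat_scheme \<Rightarrow> ('o \<Rightarrow> 'm) \<Rightarrow> ('o \<Rightarrow> 'm) \<Rightarrow> ('o, 'm, 'm, 'm \<times> 'm \<times> 'm) fmap" where
  "zero_shriek C u v =
     \<lparr>omap = u, amap = (\<lambda>s. (u (Dom C s), u (Cod C s), plus_id C u v s))\<rparr>"


section \<open>The triangulated structure of the homotopy category of the coslice\<close>

abbreviation coslice_canonical ::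
  "('o, 'm, 'e) exact_cat_scheme \<Rightarrow> 'o \<Rightarrow> ('m \<times> 'm \<times> 'm) model" where
  "coslice_canonical C A \<equiv> coslice_model C A (canonical_model C)"

abbreviation Ho_coslice ::
  "('o, 'm, 'e) exact_cat_scheme \<Rightarrow> 'o \<Rightarrow> ('m, ('m, 'm \<times> 'm \<times> 'm) loc_arr) cat" where
  "Ho_coslice C A \<equiv> Ho (coslice C A) (coslice_canonical C A)"

text \<open>The morphism of the homotopy category from \<open>u x\<close> to \<open>u y\<close> represented by the diagonal matrix
  with entries \<open>1\<close> and \<open>s\<close>.\<close>

definition diag ::
  "('o, 'm, 'e) exact_cat_scheme \<Rightarrow> 'o \<Rightarrow> ('o \<Rightarrow> 'm) \<Rightarrow> ('o \<Rightarrow> 'm) \<Rightarrow> 'm \<Rightarrow> ('m, 'm \<times> 'm \<times> 'm) loc_arr" where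
  "diag C A u v s =
     amap (Ho_functor (coslice C A) (coslice_canonical C A)) (amap (zero_shriek C u v) s)"

text \<open>The suspension is prescribed on the objects \<open>u x\<close> and the morphisms between them:\<close>

definition diag_suspension ::
  "('o, 'm, 'e) exact_cat_scheme \<Rightarrow> 'o \<Rightarrow> ('o \<Rightarrow> 'm) \<Rightarrow> ('o \<Rightarrow> 'm) \<Rightarrow> ('o \<Rightarrow> 'm) \<Rightarrow> ('o \<Rightarrow> 'm) \<Rightarrow>
   'o \<Rightarrow> 'o \<Rightarrow> ('m, 'm \<times> 'm \<times> 'm) loc_arr \<Rightarrow> ('m, 'm \<times> 'm \<times> 'm) loc_arr" where
  "diag_suspension C A u v i p x y g =
     (THE h. \<exists>s\<in>homs C x y. \<exists>\<sigma>. diag C A u v s = g \<and> suspends C i p s \<sigma> \<and> h = diag C A u v \<sigma>)"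

text \<open>It is extended to the whole homotopy category along chosen isomorphisms \<open>\<phi> X\<close> from \<open>X\<close> to
  \<open>u (r X)\<close>.\<close>

definition diag_choice ::
  "('o, 'm, 'e) exact_cat_scheme \<Rightarrow> 'o \<Rightarrow> ('o \<Rightarrow> 'm) \<Rightarrow> ('m \<Rightarrow> 'o) \<Rightarrow>
   ('m \<Rightarrow> ('m, 'm \<times> 'm \<times> 'm) loc_arr) \<Rightarrow> bool" where
  "diag_choice C A u r \<phi> \<longleftrightarrow>
     (\<forall>X\<in>Obj (coslice C A). r X \<in> Obj C \<and> \<phi> X \<in> isos (Ho_coslice C A) X (u (r X)))"

definition coslice_suspension ::
  "('o, 'm, 'e) exact_cat_scheme \<Rightarrow> 'o \<Rightarrow> ('o \<Rightarrow> 'm) \<Rightarrow> ('o \<Rightarrow> 'm) \<Rightarrow> ('o \<Rightarrow> 'm) \<Rightarrow> ('o \<Rightarrow> 'm) \<Rightarrow>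
   ('m \<Rightarrow> 'o) \<Rightarrow> ('m \<Rightarrow> ('m, 'm \<times> 'm \<times> 'm) loc_arr) \<Rightarrow>
   ('m, ('m, 'm \<times> 'm \<times> 'm) loc_arr, 'm, ('m, 'm \<times> 'm \<times> 'm) loc_arr) fmap" where
  "coslice_suspension C A u v i p r \<phi> =
     \<lparr>omap = (\<lambda>X. u (Cod C (p (r X)))),
      amap = (\<lambda>g. let H = Ho_coslice C A; X = Dom H g; Y = Cod H g in
                diag_suspension C A u v i p (r X) (r Y) (\<phi> Y \<cdot>\<^bsub>H\<^esub> g \<cdot>\<^bsub>H\<^esub> inv_arr H (\<phi> X)))\<rparr>"

text \<open>Nothing forces \<open>r (u x) = x\<close> and \<open>\<phi> (u x) = 1\<close> (\<open>u\<close> may even fail to be injective), so that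
  \<open>u (\<Sigma> x)\<close> and the suspension \<open>u (\<Sigma> (r (u x)))\<close> of \<open>u x\<close> agree only up to the canonical isomorphism
  below, the suspension of \<open>\<phi> (u x)\<close>. It is the identity if the choices are normalized.\<close>

definition suspension_comparison ::
  "('o, 'm, 'e) exact_cat_scheme \<Rightarrow> 'o \<Rightarrow> ('o \<Rightarrow> 'm) \<Rightarrow> ('o \<Rightarrow> 'm) \<Rightarrow> ('o \<Rightarrow> 'm) \<Rightarrow> ('o \<Rightarrow> 'm) \<Rightarrow>
   ('m \<Rightarrow> 'o) \<Rightarrow> ('m \<Rightarrow> ('m, 'm \<times> 'm \<times> 'm) loc_arr) \<Rightarrow> 'o \<Rightarrow> ('m, 'm \<times> 'm \<times> 'm) loc_arr" where
  "suspension_comparison C A u v i p r \<phi> x = diag_suspension C A u v i p x (r (u x)) (\<phi> (u x))"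

definition coslice_triangles ::
  "('o, 'm, 'e) exact_cat_scheme \<Rightarrow> 'o \<Rightarrow> ('o \<Rightarrow> 'm) \<Rightarrow> ('o \<Rightarrow> 'm) \<Rightarrow> ('o \<Rightarrow> 'm) \<Rightarrow> ('o \<Rightarrow> 'm) \<Rightarrow>
   ('m \<Rightarrow> 'o) \<Rightarrow> ('m \<Rightarrow> ('m, 'm \<times> 'm \<times> 'm) loc_arr) \<Rightarrow>
   (('m, 'm \<times> 'm \<times> 'm) loc_arr \<times> ('m, 'm \<times> 'm \<times> 'm) loc_arr \<times> ('m, 'm \<times> 'm \<times> 'm) loc_arr) set" where
  "coslice_triangles C A u v i p r \<phi> = {T. \<exists>s t w. standard_sequence C i p s t w \<and>
     iso_triangles (Ho_coslice C A) (coslice_suspension C A u v i p r \<phi>) T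
       (diag C A u v s, diag C A u v t,
        suspension_comparison C A u v i p r \<phi> (Dom C s) \<cdot>\<^bsub>Ho_coslice C A\<^esub> diag C A u v w)}"

end

theory Submission
  imports Defs
begin

text \<open>The unit \<open>x \<rightarrow> A \<oplus> x\<close> and the counit \<open>(X, 1) : A \<oplus> x \<rightarrow> x\<close> of the adjunction \<open>(0\<^sub>!, 0\<^sup>*)\<close> are stable
  equivalences, because their composite is the identity and the complement \<open>A\<close> is injective. Both
  functors preserve weak equivalences, so they descend to mutually quasi-inverse functors on the
  localizations. The replacement maps are split by the lifting properties against injectives
  and projectives, which makes the derived functors conjugate to these induced functors. The suspension
  of the coslice is transported along the resulting fully faithful functor \<open>s \<mapsto> diag(1, s)\<close>, hence
  standard triangles go to standard triangles.\<close>

section \<open>Isomorphisms, functors and natural isomorphisms\<close>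

text \<open>Every choice in the statement is arbitrary: replacements that need not be functorial,
  coproducts, the isomorphisms \<open>\<phi> X\<close>. Therefore the equivalence and the triangles
  are first established for a strict pair, \<open>stable_shriek\<close> and
  \<open>stable_forget\<close>, which involves no replacement. A triangle equivalence includes a
  comparison of suspensions, so this comparison has to be carried along the natural isomorphisms as
  well. The second obstacle is that arrows of a homotopy category are classes of zigzags of
  arbitrary length. They are reached only through the universal property: a functor inverting the
  weak equivalences extends, and naturality is tested on arrows of the original category. That the
  stable category, a quotient, maps to the localization at all rests on one fact: a functor
  inverting stable equivalences cannot distinguish arrows whose difference factors through an
  injective. Fullness and faithfulness of the diagonal functor are read off the equivalence, not
  computed with zigzags; they are what makes the definite descriptions in the suspension of the
  coslice meaningful.\<close>

lemma homsI: "\<lbrakk>f \<in> Arr C; Dom C f = x; Cod C f = y\<rbrakk> \<Longrightarrow> f \<in> homs C x y"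
  by (simp add: homs_def)

lemma homsD: "f \<in> homs C x y \<Longrightarrow> f \<in> Arr C \<and> Dom C f = x \<and> Cod C f = y"
  by (simp add: homs_def)

lemma Arr_homs: "f \<in> Arr C \<Longrightarrow> f \<in> homs C (Dom C f) (Cod C f)"
  by (simp add: homs_def)

context category
begin

lemma homs_Obj: "f \<in> homs C x y \<Longrightarrow> x \<in> Obj C \<and> y \<in> Obj C"
  using Dom_in Cod_in homsD by metis

lemma isos_iff:
  "f \<in> isos C x y \<longleftrightarrow> f \<in> homs C x y \<and> (\<exists>g\<in>homs C y x. g \<cdot> f = Ide C x \<and> f \<cdot> g = Ide C y)"
  by (auto simp: isos_def is_iso_def inverse_arrows_def homs_def)

lemma isosI:
  "\<lbrakk>f \<in> homs C x y; g \<in> homs C y x; g \<cdot> f = Ide C x; f \<cdot> g = Ide C y\<rbrakk> \<Longrightarrow> f \<in> isos C x y"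
  using isos_iff by blast

lemma inverse_unique:
  assumes "f \<in> homs C x y" "g \<in> homs C y x" "h \<in> homs C y x" "g \<cdot> f = Ide C x" "f \<cdot> h = Ide C y"
  shows "g = h"
  using assms Comp_assoc [OF assms(3,1,2)] Comp_Ide [OF assms(2)] Ide_Comp [OF assms(3)] by simp

lemma inv_arr_eqI:
  assumes "f \<in> homs C x y" "g \<in> homs C y x" "g \<cdot> f = Ide C x" "f \<cdot> g = Ide C y"
  shows "inv_arr C f = g"
  unfolding inv_arr_def
proof (rule the_equality)
  show "inverse_arrows C f g"
    using assms by (auto simp: inverse_arrows_def homs_def)
  show "h = g" if "inverse_arrows C f h" for h
    using that assms inverse_unique [of f x y h g] by (auto simp: inverse_arrows_def homs_def)
qed

lemma inv_arr:
  assumes "f \<in> isos C x y"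
  shows "inv_arr C f \<in> homs C y x" "inv_arr C f \<cdot> f = Ide C x" "f \<cdot> inv_arr C f = Ide C y"
  using assms inv_arr_eqI by (metis isos_iff)+

lemma isos_homs: "f \<in> isos C x y \<Longrightarrow> f \<in> homs C x y"
  by (simp add: isos_def)

lemma isos_inv_arr: "f \<in> isos C x y \<Longrightarrow> inv_arr C f \<in> isos C y x"
  using isosI [OF inv_arr(1) isos_homs inv_arr(3,2)] .

lemma isos_Ide: "x \<in> Obj C \<Longrightarrow> Ide C x \<in> isos C x x"
  using isosI [OF Ide_in Ide_in Comp_Ide [OF Ide_in] Comp_Ide [OF Ide_in]] .

lemma Comp_inv_cancel:
  assumes "f \<in> isos C x y"
  shows "g \<in> homs C z x \<Longrightarrow> inv_arr C f \<cdot> f \<cdot> g = g" "g \<in> homs C z y \<Longrightarrow> f \<cdot> inv_arr C f \<cdot> g = g"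
  using Comp_assoc [OF _ isos_homs [OF assms] inv_arr(1) [OF assms]]
    Comp_assoc [OF _ inv_arr(1) [OF assms] isos_homs [OF assms]] Ide_Comp inv_arr(2,3) [OF assms]
  by fastforce+

lemma Comp_inv_cancel_right:
  assumes "f \<in> isos C x y"
  shows "g \<in> homs C y z \<Longrightarrow> (g \<cdot> f) \<cdot> inv_arr C f = g" "g \<in> homs C x z \<Longrightarrow> (g \<cdot> inv_arr C f) \<cdot> f = g"
  using Comp_assoc [OF inv_arr(1) [OF assms] isos_homs [OF assms]]
    Comp_assoc [OF isos_homs [OF assms] inv_arr(1) [OF assms]] Comp_Ide inv_arr(2,3) [OF assms]
  by fastforce+

lemma iso_cancel_left:
  assumes "f \<in> isos C x y" "g \<in> homs C z x" "h \<in> homs C z x" "f \<cdot> g = f \<cdot> h"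
  shows "g = h"
  using assms Comp_inv_cancel(1) by metis

lemma iso_cancel_right:
  assumes "f \<in> isos C x y" "g \<in> homs C y z" "h \<in> homs C y z" "g \<cdot> f = h \<cdot> f"
  shows "g = h"
  using assms Comp_inv_cancel_right(1) by metis

lemma isos_Comp:
  assumes "f \<in> isos C x y" "g \<in> isos C y z"
  shows "g \<cdot> f \<in> isos C x z"
proof (rule isosI)
  have f: "f \<in> homs C x y" "inv_arr C f \<in> homs C y x" and g: "g \<in> homs C y z" "inv_arr C g \<in> homs C z y"
    using assms inv_arr isos_homs by metis+
  show "g \<cdot> f \<in> homs C x z" "inv_arr C f \<cdot> inv_arr C g \<in> homs C z x"
    using f g Comp_in by metis+
  show "(inv_arr C f \<cdot> inv_arr C g) \<cdot> (g \<cdot> f) = Ide C x"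
    using Comp_assoc [OF Comp_in [OF f(1) g(1)] g(2) f(2)] Comp_inv_cancel(1) [OF assms(2) f(1)]
      inv_arr(2) [OF assms(1)] by simp
  show "(g \<cdot> f) \<cdot> (inv_arr C f \<cdot> inv_arr C g) = Ide C z"
    using Comp_assoc [OF Comp_in [OF g(2) f(2)] f(1) g(1)] Comp_inv_cancel(2) [OF assms(1) g(2)]
      inv_arr(3) [OF assms(2)] by simp
qed

text \<open>Two-out-of-three for isomorphisms: here and in the next lemma one factor is recovered by
  composing with the inverse of the other.\<close>

lemma isos_Comp_cancel_left:
  assumes "f \<in> homs C x y" "g \<in> isos C y z" "g \<cdot> f \<in> isos C x z"
  shows "f \<in> isos C x y"
  by (metis assms Comp_inv_cancel(1) isos_Comp isos_inv_arr)

lemma isos_Comp_cancel_right: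
  assumes "f \<in> isos C x y" "g \<in> homs C y z" "g \<cdot> f \<in> isos C x z"
  shows "g \<in> isos C y z"
  by (metis assms Comp_inv_cancel_right(1) isos_Comp isos_inv_arr)

end

lemma functor_homs:
  "\<lbrakk>is_functor C D G; f \<in> homs C x y\<rbrakk> \<Longrightarrow> amap G f \<in> homs D (omap G x) (omap G y)"
  by (auto simp: is_functor_def homs_def)

lemma functor_Obj: "\<lbrakk>is_functor C D G; x \<in> Obj C\<rbrakk> \<Longrightarrow> omap G x \<in> Obj D"
  by (auto simp: is_functor_def)

lemma functor_Ide: "\<lbrakk>is_functor C D G; x \<in> Obj C\<rbrakk> \<Longrightarrow> amap G (Ide C x) = Ide D (omap G x)"
  by (auto simp: is_functor_def)

lemma functor_Comp:
  "\<lbrakk>is_functor C D G; f \<in> homs C x y; g \<in> homs C y z\<rbrakk>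
   \<Longrightarrow> amap G (g \<cdot>\<^bsub>C\<^esub> f) = amap G g \<cdot>\<^bsub>D\<^esub> amap G f"
  by (auto simp: is_functor_def homs_def)

lemma is_functorI:
  assumes "\<And>x. x \<in> Obj C \<Longrightarrow> omap G x \<in> Obj D"
    and "\<And>x. x \<in> Obj C \<Longrightarrow> amap G (Ide C x) = Ide D (omap G x)"
    and "\<And>f x y. f \<in> homs C x y \<Longrightarrow> amap G f \<in> homs D (omap G x) (omap G y)"
    and "\<And>f g x y z. \<lbrakk>f \<in> homs C x y; g \<in> homs C y z\<rbrakk>
           \<Longrightarrow> amap G (g \<cdot>\<^bsub>C\<^esub> f) = amap G g \<cdot>\<^bsub>D\<^esub> amap G f"
  shows "is_functor C D G"
  using assms by (auto simp: is_functor_def homs_def)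

lemma functor_isos:
  assumes "category C" "category D" "is_functor C D G" "f \<in> isos C x y"
  shows "amap G f \<in> isos D (omap G x) (omap G y)"
proof -
  interpret C: category C by fact
  interpret D: category D by fact
  obtain g where g: "f \<in> homs C x y" "g \<in> homs C y x" "g \<cdot>\<^bsub>C\<^esub> f = Ide C x" "f \<cdot>\<^bsub>C\<^esub> g = Ide C y"
    using assms C.isos_iff by blast
  have "x \<in> Obj C" "y \<in> Obj C"
    using g C.homs_Obj by blast+
  then show ?thesis
    using g functor_Comp [OF assms(3) g(1,2)] functor_Comp [OF assms(3) g(2,1)]
    by (intro D.isosI [of _ _ _ "amap G g"]) (simp_all add: functor_homs [OF assms(3)] functor_Ide [OF assms(3)])
qed

lemma functor_fcomp:
  assumes "is_functor C D G" "is_functor D E H"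
  shows "is_functor C E (H \<circ>\<^sub>F G)"
  using assms unfolding is_functor_def fcomp_def homs_def by auto

lemma fcomp_simps [simp]:
  "omap (H \<circ>\<^sub>F G) x = omap H (omap G x)" "amap (H \<circ>\<^sub>F G) f = amap H (amap G f)"
  by (simp_all add: fcomp_def)

lemma fid_simps [simp]: "omap fid x = x" "amap fid f = f"
  by (simp_all add: fid_def)

section \<open>Natural isomorphisms: composition, inversion, whiskering\<close>

lemma natural_isoI:
  assumes "\<And>x. x \<in> Obj C \<Longrightarrow> \<eta> x \<in> isos D (omap G x) (omap H x)"
    and "\<And>f x y. f \<in> homs C x y \<Longrightarrow> \<eta> y \<cdot>\<^bsub>D\<^esub> amap G f = amap H f \<cdot>\<^bsub>D\<^esub> \<eta> x"
  shows "natural_iso C D G H \<eta>"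
  using assms by (auto simp: natural_iso_def homs_def)

lemma natural_iso_isos:
  "\<lbrakk>natural_iso C D G H \<eta>; x \<in> Obj C\<rbrakk> \<Longrightarrow> \<eta> x \<in> isos D (omap G x) (omap H x)"
  by (auto simp: natural_iso_def)

lemma natural_iso_homs:
  "\<lbrakk>natural_iso C D G H \<eta>; x \<in> Obj C\<rbrakk> \<Longrightarrow> \<eta> x \<in> homs D (omap G x) (omap H x)"
  by (auto simp: natural_iso_def isos_def)

lemma natural_iso_natural:
  "\<lbrakk>natural_iso C D G H \<eta>; f \<in> homs C x y\<rbrakk> \<Longrightarrow> \<eta> y \<cdot>\<^bsub>D\<^esub> amap G f = amap H f \<cdot>\<^bsub>D\<^esub> \<eta> x"
  by (auto simp: natural_iso_def homs_def)

lemma natural_iso_trans: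
  assumes "category C" "category D" "is_functor C D G" "is_functor C D H" "is_functor C D K"
    and "natural_iso C D G H \<eta>" "natural_iso C D H K \<kappa>"
  shows "natural_iso C D G K (\<lambda>x. \<kappa> x \<cdot>\<^bsub>D\<^esub> \<eta> x)"
proof -
  interpret C: category C by fact
  interpret D: category D by fact
  show ?thesis
  proof (rule natural_isoI)
    show "\<kappa> x \<cdot>\<^bsub>D\<^esub> \<eta> x \<in> isos D (omap G x) (omap K x)" if "x \<in> Obj C" for x
      using that assms natural_iso_isos D.isos_Comp by metis
  next
    fix f x y assume f: "f \<in> homs C x y"
    then have xy: "x \<in> Obj C" "y \<in> Obj C"
      using C.homs_Obj by blast+
    note h = functor_homs [OF assms(3) f] functor_homs [OF assms(4) f] functor_homs [OF assms(5) f]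
      natural_iso_homs [OF assms(6) xy(1)] natural_iso_homs [OF assms(6) xy(2)]
      natural_iso_homs [OF assms(7) xy(1)] natural_iso_homs [OF assms(7) xy(2)]
    have "(\<kappa> y \<cdot>\<^bsub>D\<^esub> \<eta> y) \<cdot>\<^bsub>D\<^esub> amap G f = \<kappa> y \<cdot>\<^bsub>D\<^esub> amap H f \<cdot>\<^bsub>D\<^esub> \<eta> x"
      using h D.Comp_assoc natural_iso_natural [OF assms(6) f] by metis
    also have "\<dots> = (\<kappa> y \<cdot>\<^bsub>D\<^esub> amap H f) \<cdot>\<^bsub>D\<^esub> \<eta> x"
      using h D.Comp_assoc by metis
    also have "\<dots> = amap K f \<cdot>\<^bsub>D\<^esub> \<kappa> x \<cdot>\<^bsub>D\<^esub> \<eta> x"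
      using h D.Comp_assoc natural_iso_natural [OF assms(7) f] by metis
    finally show "(\<kappa> y \<cdot>\<^bsub>D\<^esub> \<eta> y) \<cdot>\<^bsub>D\<^esub> amap G f = amap K f \<cdot>\<^bsub>D\<^esub> \<kappa> x \<cdot>\<^bsub>D\<^esub> \<eta> x" .
  qed
qed

lemma natural_iso_inv:
  assumes "category C" "category D" "is_functor C D G" "is_functor C D H" "natural_iso C D G H \<eta>"
  shows "natural_iso C D H G (\<lambda>x. inv_arr D (\<eta> x))"
proof -
  interpret C: category C by fact
  interpret D: category D by fact
  show ?thesis
  proof (rule natural_isoI)
    show "inv_arr D (\<eta> x) \<in> isos D (omap H x) (omap G x)" if "x \<in> Obj C" for x
      using that assms natural_iso_isos D.isos_inv_arr by metis
  next
    fix f x y assume f: "f \<in> homs C x y"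
    then have xy: "x \<in> Obj C" "y \<in> Obj C"
      using C.homs_Obj by blast+
    note h = functor_homs [OF assms(3) f] functor_homs [OF assms(4) f]
    note ix = natural_iso_isos [OF assms(5) xy(1)] and iy = natural_iso_isos [OF assms(5) xy(2)]
    have "inv_arr D (\<eta> y) \<cdot>\<^bsub>D\<^esub> amap H f = inv_arr D (\<eta> y) \<cdot>\<^bsub>D\<^esub> (amap H f \<cdot>\<^bsub>D\<^esub> \<eta> x) \<cdot>\<^bsub>D\<^esub> inv_arr D (\<eta> x)"
      using h D.Comp_inv_cancel_right(1) [OF ix h(2)] by simp
    also have "\<dots> = inv_arr D (\<eta> y) \<cdot>\<^bsub>D\<^esub> \<eta> y \<cdot>\<^bsub>D\<^esub> amap G f \<cdot>\<^bsub>D\<^esub> inv_arr D (\<eta> x)"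
      using natural_iso_natural [OF assms(5) f] h iy ix D.Comp_assoc D.isos_homs D.inv_arr(1) by metis
    also have "\<dots> = amap G f \<cdot>\<^bsub>D\<^esub> inv_arr D (\<eta> x)"
      using D.Comp_inv_cancel(1) [OF iy] h D.Comp_in D.inv_arr(1) [OF ix] by metis
    finally show "inv_arr D (\<eta> y) \<cdot>\<^bsub>D\<^esub> amap H f = amap G f \<cdot>\<^bsub>D\<^esub> inv_arr D (\<eta> x)" .
  qed
qed

lemma natural_iso_post:
  assumes "category C" "category D" "category E" "is_functor C D G" "is_functor C D H"
    and "is_functor D E L" "natural_iso C D G H \<eta>"
  shows "natural_iso C E (L \<circ>\<^sub>F G) (L \<circ>\<^sub>F H) (\<lambda>x. amap L (\<eta> x))"
proof -
  interpret C: category C by fact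
  show ?thesis
  proof (rule natural_isoI)
    show "amap L (\<eta> x) \<in> isos E (omap (L \<circ>\<^sub>F G) x) (omap (L \<circ>\<^sub>F H) x)" if "x \<in> Obj C" for x
      using that assms natural_iso_isos functor_isos by (metis fcomp_simps(1))
  next
    fix f x y assume f: "f \<in> homs C x y"
    then have xy: "x \<in> Obj C" "y \<in> Obj C"
      using C.homs_Obj by blast+
    then show "amap L (\<eta> y) \<cdot>\<^bsub>E\<^esub> amap (L \<circ>\<^sub>F G) f = amap (L \<circ>\<^sub>F H) f \<cdot>\<^bsub>E\<^esub> amap L (\<eta> x)"
      using functor_Comp [OF assms(6) functor_homs [OF assms(4) f] natural_iso_homs [OF assms(7) xy(2)]]
        functor_Comp [OF assms(6) natural_iso_homs [OF assms(7) xy(1)] functor_homs [OF assms(5) f]]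
        natural_iso_natural [OF assms(7) f] by simp
  qed
qed

lemma natural_iso_pre:
  assumes "is_functor B C K" "natural_iso C D G H \<eta>"
  shows "natural_iso B D (G \<circ>\<^sub>F K) (H \<circ>\<^sub>F K) (\<lambda>x. \<eta> (omap K x))"
  using assms functor_homs natural_iso_natural natural_iso_isos functor_Obj
  by (fastforce intro!: natural_isoI)

text \<open>\<open>K\<close> is only an assignment on objects and arrows, which is all that is known
  of a derived functor at the outset. It respects identities and composites because the square
  determines \<open>amap K f\<close> once the isomorphism at its end is cancelled.\<close>

lemma functor_conjugate:
  assumes "category C" "category D" "is_functor C D G"
    and \<theta>: "\<And>x. x \<in> Obj C \<Longrightarrow> \<theta> x \<in> isos D (omap K x) (omap G x)"
    and K: "\<And>f x y. f \<in> homs C x y \<Longrightarrow> amap K f \<in> homs D (omap K x) (omap K y)"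
    and nat: "\<And>f x y. f \<in> homs C x y \<Longrightarrow> \<theta> y \<cdot>\<^bsub>D\<^esub> amap K f = amap G f \<cdot>\<^bsub>D\<^esub> \<theta> x"
  shows "is_functor C D K" "natural_iso C D K G \<theta>"
proof -
  interpret C: category C by fact
  interpret D: category D by fact
  show "natural_iso C D K G \<theta>"
    using \<theta> nat by (rule natural_isoI)
  show "is_functor C D K"
  proof (rule is_functorI)
    fix x assume x: "x \<in> Obj C"
    note t = D.isos_homs [OF \<theta> [OF x]]
    then show "omap K x \<in> Obj D"
      using D.homs_Obj by blast
    then show "amap K (Ide C x) = Ide D (omap K x)"
      using \<theta> [OF x] x nat [OF C.Ide_in [OF x]] t K D.Ide_in C.Ide_in functor_Ide [OF assms(3) x]
        D.Ide_Comp D.Comp_Ide by (metis D.iso_cancel_left)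
  next
    fix f g x y z assume f: "f \<in> homs C x y" and g: "g \<in> homs C y z"
    then have o: "x \<in> Obj C" "y \<in> Obj C" "z \<in> Obj C"
      using C.homs_Obj by blast+
    note t = D.isos_homs [OF \<theta> [OF o(1)]] D.isos_homs [OF \<theta> [OF o(2)]] D.isos_homs [OF \<theta> [OF o(3)]]
    note gf = C.Comp_in [OF f g]
    have "\<theta> z \<cdot>\<^bsub>D\<^esub> amap K g \<cdot>\<^bsub>D\<^esub> amap K f = (amap G g \<cdot>\<^bsub>D\<^esub> \<theta> y) \<cdot>\<^bsub>D\<^esub> amap K f"
      using nat [OF g] K [OF f] K [OF g] t D.Comp_assoc by metis
    also have "\<dots> = amap G g \<cdot>\<^bsub>D\<^esub> amap G f \<cdot>\<^bsub>D\<^esub> \<theta> x"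
      using nat [OF f] K [OF f] functor_homs [OF assms(3) g] t D.Comp_assoc by metis
    also have "\<dots> = amap G (g \<cdot>\<^bsub>C\<^esub> f) \<cdot>\<^bsub>D\<^esub> \<theta> x"
      using functor_Comp [OF assms(3) f g] functor_homs [OF assms(3) g] functor_homs [OF assms(3) f] t
        D.Comp_assoc by metis
    also have "\<dots> = \<theta> z \<cdot>\<^bsub>D\<^esub> amap K (g \<cdot>\<^bsub>C\<^esub> f)"
      using nat [OF gf] by simp
    finally show "amap K (g \<cdot>\<^bsub>C\<^esub> f) = amap K g \<cdot>\<^bsub>D\<^esub> amap K f"
      using D.iso_cancel_left [OF \<theta> [OF o(3)] D.Comp_in [OF K [OF f] K [OF g]] K [OF gf]] by simp
  qed (rule K)
qed

text \<open>Three sides of the naturality square are isomorphisms, hence so is the fourth.\<close>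

lemma natural_iso_preserves_isos:
  assumes "category C" "category D" "is_functor C D G" "is_functor C D K" "natural_iso C D K G \<theta>"
    and "f \<in> homs C x y" "amap G f \<in> isos D (omap G x) (omap G y)"
  shows "amap K f \<in> isos D (omap K x) (omap K y)"
proof -
  interpret C: category C by fact
  interpret D: category D by fact
  have o: "x \<in> Obj C" "y \<in> Obj C"
    using assms C.homs_Obj by blast+
  have "\<theta> y \<cdot>\<^bsub>D\<^esub> amap K f \<in> isos D (omap K x) (omap G y)"
    using natural_iso_natural [OF assms(5,6)] D.isos_Comp assms(7) natural_iso_isos [OF assms(5)] o
    by metis
  then show ?thesis
    using D.isos_Comp_cancel_left natural_iso_isos [OF assms(5)] o functor_homs [OF assms(4,6)] by metis
qed

text \<open>The new unit is the old one followed by \<open>\<kappa>\<close> inverse at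
  \<open>G\<close> and by \<open>H'\<close> applied to \<open>\<theta>\<close> inverse; the new
  counit is the old one preceded by \<open>\<theta>\<close> at \<open>H'\<close> and by
  \<open>G\<close> applied to \<open>\<kappa>\<close>. This passes from the strict pair to the
  derived functors.\<close>

lemma quasi_inverse_transport:
  assumes "category C" "category D" "quasi_inverse C D G H"
    and "is_functor C D G'" "natural_iso C D G' G \<theta>" "is_functor D C H'" "natural_iso D C H' H \<kappa>"
  shows "quasi_inverse C D G' H'"
proof -
  have G: "is_functor C D G" "is_functor D C H"
    using assms(3) by (auto simp: quasi_inverse_def)
  obtain \<eta> \<epsilon> where e: "natural_iso C C fid (H \<circ>\<^sub>F G) \<eta>" "natural_iso D D (G \<circ>\<^sub>F H) fid \<epsilon>"
    using assms(3) by (auto simp: quasi_inverse_def)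
  have fid: "is_functor C C fid" "is_functor D D fid"
    using category.Ide_in [OF assms(1)] category.Ide_in [OF assms(2)]
    by (auto simp: is_functor_def homs_def)
  note fc = functor_fcomp [OF G] functor_fcomp [OF G(2,1)] functor_fcomp [OF G(1) assms(6)]
    functor_fcomp [OF assms(4,6)] functor_fcomp [OF assms(6) G(1)] functor_fcomp [OF assms(6,4)]
  note k = natural_iso_pre [OF G(1) natural_iso_inv [OF assms(2,1,6) G(2) assms(7)]]
  note t = natural_iso_post [OF assms(1,2,1) G(1) assms(4,6)
      natural_iso_inv [OF assms(1,2,4) G(1) assms(5)]]
  note t' = natural_iso_pre [OF assms(6,5)]
  note k' = natural_iso_post [OF assms(2,1,2,6) G(2) G(1) assms(7)]
  show ?thesis
    unfolding quasi_inverse_def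
    using natural_iso_trans [OF assms(1,1) fid(1) fc(3,4)
        natural_iso_trans [OF assms(1,1) fid(1) fc(1,3) e(1) k] t]
      natural_iso_trans [OF assms(2,2) fc(6,5) fid(2) t'
        natural_iso_trans [OF assms(2,2) fc(5,2) fid(2) k' e(2)]] assms(4,6) by blast
qed

text \<open>Naturality of the unit expresses \<open>\<eta> y \<cdot> f\<close> through
  \<open>amap G f\<close>, and \<open>\<eta> y\<close> cancels.\<close>

lemma quasi_inverse_faithful:
  assumes "category C" "quasi_inverse C D G H"
    and "f \<in> homs C x y" "g \<in> homs C x y" "amap G f = amap G g"
  shows "f = g"
proof -
  interpret C: category C by fact
  obtain \<eta> where e: "natural_iso C C fid (H \<circ>\<^sub>F G) \<eta>"
    using assms(2) by (auto simp: quasi_inverse_def)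
  have "\<eta> y \<cdot>\<^bsub>C\<^esub> f = \<eta> y \<cdot>\<^bsub>C\<^esub> g"
    using natural_iso_natural [OF e assms(3)] natural_iso_natural [OF e assms(4)] assms(5) by simp
  then show ?thesis
    using C.iso_cancel_left natural_iso_isos [OF e] assms(3,4) C.homs_Obj by (metis fid_simps(1))
qed

lemma quasi_inverse_sym:
  assumes "category C" "category D" "quasi_inverse C D G H"
  shows "quasi_inverse D C H G"
proof -
  have G: "is_functor C D G" "is_functor D C H"
    using assms(3) by (auto simp: quasi_inverse_def)
  have fid: "is_functor C C fid" "is_functor D D fid"
    using category.Ide_in [OF assms(1)] category.Ide_in [OF assms(2)]
    by (auto simp: is_functor_def homs_def)
  show ?thesis
    using assms G natural_iso_inv [OF assms(1,1) fid(1) functor_fcomp [OF G]]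
      natural_iso_inv [OF assms(2,2) functor_fcomp [OF G(2,1)] fid(2)]
    unfolding quasi_inverse_def by blast
qed

text \<open>The preimage is \<open>amap H h\<close> conjugated by the unit. Its image is seen to be
  \<open>h\<close> only after applying \<open>H\<close>, so the faithfulness of \<open>H\<close>,
  obtained from the symmetric quasi-inverse, has to finish.\<close>

lemma quasi_inverse_full:
  assumes "category C" "category D" "quasi_inverse C D G H"
    and "x \<in> Obj C" "y \<in> Obj C" "h \<in> homs D (omap G x) (omap G y)"
  shows "\<exists>f\<in>homs C x y. amap G f = h"
proof -
  interpret C: category C by fact
  have G: "is_functor C D G" and H: "is_functor D C H"
    using assms(3) by (auto simp: quasi_inverse_def)
  obtain \<eta> where e: "natural_iso C C fid (H \<circ>\<^sub>F G) \<eta>"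
    using assms(3) by (auto simp: quasi_inverse_def)
  note ix = natural_iso_isos [OF e assms(4), simplified] and iy = natural_iso_isos [OF e assms(5), simplified]
  note hh = functor_homs [OF H assms(6)]
  define k where "k = amap H h \<cdot>\<^bsub>C\<^esub> \<eta> x"
  have k: "k \<in> homs C x (omap H (omap G y))"
    unfolding k_def using hh C.isos_homs [OF ix] C.Comp_in by blast
  define f where "f = inv_arr C (\<eta> y) \<cdot>\<^bsub>C\<^esub> k"
  have f: "f \<in> homs C x y"
    unfolding f_def using k C.inv_arr(1) [OF iy] C.Comp_in by blast
  have "amap H (amap G f) \<cdot>\<^bsub>C\<^esub> \<eta> x = \<eta> y \<cdot>\<^bsub>C\<^esub> f"
    using natural_iso_natural [OF e f] by simp
  also have "\<dots> = amap H h \<cdot>\<^bsub>C\<^esub> \<eta> x"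
    unfolding f_def using C.Comp_inv_cancel(2) [OF iy k] k_def by simp
  finally have "amap H (amap G f) = amap H h"
    using C.iso_cancel_right [OF ix] hh functor_homs [OF functor_fcomp [OF G H] f] by simp
  then have "amap G f = h"
    using quasi_inverse_faithful [OF assms(2) quasi_inverse_sym [OF assms(1-3)]] assms(6)
      functor_homs [OF G f] by blast
  then show ?thesis
    using f by blast
qed

section \<open>Transport of suspensions and triangles along a natural isomorphism\<close>

lemma suspension_transport:
  assumes "category C" "category D" "is_functor C D G" "is_functor C D G'"
    and S: "is_functor C C S" and S': "is_functor D D S'"
    and \<theta>: "natural_iso C D G G' \<theta>" and \<eta>: "natural_iso C D (G' \<circ>\<^sub>F S) (S' \<circ>\<^sub>F G') \<eta>"
  shows "natural_iso C D (G \<circ>\<^sub>F S) (S' \<circ>\<^sub>F G)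
           (\<lambda>x. inv_arr D (amap S' (\<theta> x)) \<cdot>\<^bsub>D\<^esub> \<eta> x \<cdot>\<^bsub>D\<^esub> \<theta> (omap S x))"
proof -
  note f = functor_fcomp [OF S assms(3)] functor_fcomp [OF S assms(4)]
    functor_fcomp [OF assms(3) S'] functor_fcomp [OF assms(4) S']
  \<comment> \<open>The composite \<open>G S \<rightarrow> G' S \<rightarrow> S' G' \<rightarrow> S'
    G\<close>, whose last arrow is the inverse of \<open>S'\<close> applied to
    \<open>\<theta>\<close>.\<close>
  show ?thesis
    using natural_iso_trans [OF assms(1,2) f(1,4,3) natural_iso_trans [OF assms(1,2) f(1,2,4)
          natural_iso_pre [OF S \<theta>] \<eta>]
        natural_iso_inv [OF assms(1,2) f(3,4) natural_iso_post [OF assms(1,2,2,3,4) S' \<theta>]]] .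
qed

text \<open>The isomorphism of triangles has the components
  \<open>amap G' a \<cdot> \<theta> x\<close>, and likewise for \<open>b\<close> and
  \<open>c\<close>. Its first two squares need only the naturality of \<open>\<theta>\<close>; the
  third also compares the two ways of commuting with the suspensions.\<close>

lemma triangle_transport:
  assumes "category C" "category D" "is_functor C D G" "is_functor C D G'"
    and S: "is_functor C C S" and S': "is_functor D D S'"
    and \<theta>: "natural_iso C D G G' \<theta>" and \<eta>: "natural_iso C D (G' \<circ>\<^sub>F S) (S' \<circ>\<^sub>F G') \<eta>"
    and T: "iso_triangles C S (f, g, h) (s, t, w)"
  shows "iso_triangles D S'
    (amap G f, amap G g,
      (inv_arr D (amap S' (\<theta> (Dom C f))) \<cdot>\<^bsub>D\<^esub> \<eta> (Dom C f) \<cdot>\<^bsub>D\<^esub> \<theta> (omap S (Dom C f))) \<cdot>\<^bsub>D\<^esub> amap G h)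
    (amap G' s, amap G' t, \<eta> (Dom C s) \<cdot>\<^bsub>D\<^esub> amap G' w)"
proof -
  interpret C: category C by fact
  interpret D: category D by fact
  define x y z where "x = Dom C f" and "y = Dom C g" and "z = Dom C h"
  define x' y' z' where "x' = Dom C s" and "y' = Dom C t" and "z' = Dom C w"
  have f: "f \<in> homs C x y" and g: "g \<in> homs C y z" and h: "h \<in> homs C z (omap S x)"
    and s: "s \<in> homs C x' y'" and t: "t \<in> homs C y' z'" and w: "w \<in> homs C z' (omap S x')"
    using T by (auto simp: iso_triangles_def is_triangle_def homs_def x_def y_def z_def
        x'_def y'_def z'_def)
  obtain a b c where a: "a \<in> isos C x x'" and b: "b \<in> isos C y y'" and c: "c \<in> isos C z z'"
    and e1: "b \<cdot>\<^bsub>C\<^esub> f = s \<cdot>\<^bsub>C\<^esub> a" and e2: "c \<cdot>\<^bsub>C\<^esub> g = t \<cdot>\<^bsub>C\<^esub> b"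
    and e3: "amap S a \<cdot>\<^bsub>C\<^esub> h = w \<cdot>\<^bsub>C\<^esub> c"
    using T unfolding iso_triangles_def x_def y_def z_def x'_def y'_def z'_def by auto
  note a' = C.isos_homs [OF a] and b' = C.isos_homs [OF b] and c' = C.isos_homs [OF c]
  have ob: "x \<in> Obj C" "y \<in> Obj C" "z \<in> Obj C" "x' \<in> Obj C" "y' \<in> Obj C" "z' \<in> Obj C"
    "omap S x \<in> Obj C" "omap S x' \<in> Obj C"
    using f g h s t w C.homs_Obj by blast+
  note \<eta>' = suspension_transport [OF assms(1-4) S S' \<theta> \<eta>]
  define \<zeta> where "\<zeta> = inv_arr D (amap S' (\<theta> x)) \<cdot>\<^bsub>D\<^esub> \<eta> x \<cdot>\<^bsub>D\<^esub> \<theta> (omap S x)"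
  have \<zeta>: "\<zeta> \<in> homs D (omap G (omap S x)) (omap S' (omap G x))"
    unfolding \<zeta>_def using natural_iso_homs [OF \<eta>' ob(1)] by simp
  note th = natural_iso_homs [OF \<theta>]
  note eh = natural_iso_homs [OF \<eta>, simplified]
  note Gh = functor_homs [OF assms(3)] and G'h = functor_homs [OF assms(4)]
  \<comment> \<open>Naturality of \<open>\<theta>\<close> pasted with the image under
    \<open>G'\<close> of a commuting square; all three squares use it.\<close>
  have sq: "(amap G' \<beta> \<cdot>\<^bsub>D\<^esub> \<theta> y0) \<cdot>\<^bsub>D\<^esub> amap G k = amap G' k' \<cdot>\<^bsub>D\<^esub> amap G' \<alpha> \<cdot>\<^bsub>D\<^esub> \<theta> x0"
    if k: "k \<in> homs C x0 y0" "k' \<in> homs C x1 y1" "\<alpha> \<in> homs C x0 x1" "\<beta> \<in> homs C y0 y1"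
      and e: "\<beta> \<cdot>\<^bsub>C\<^esub> k = k' \<cdot>\<^bsub>C\<^esub> \<alpha>" for k k' \<alpha> \<beta> x0 x1 y0 y1
  proof -
    have o: "x0 \<in> Obj C" "y0 \<in> Obj C"
      using k C.homs_Obj by blast+
    have "(amap G' \<beta> \<cdot>\<^bsub>D\<^esub> \<theta> y0) \<cdot>\<^bsub>D\<^esub> amap G k = amap G' \<beta> \<cdot>\<^bsub>D\<^esub> amap G' k \<cdot>\<^bsub>D\<^esub> \<theta> x0"
      using D.Comp_assoc [OF Gh [OF k(1)] th [OF o(2)] G'h [OF k(4)]]
        natural_iso_natural [OF \<theta> k(1)] by simp
    also have "\<dots> = amap G' (\<beta> \<cdot>\<^bsub>C\<^esub> k) \<cdot>\<^bsub>D\<^esub> \<theta> x0"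
      using D.Comp_assoc [OF th [OF o(1)] G'h [OF k(1)] G'h [OF k(4)]]
        functor_Comp [OF assms(4) k(1,4)] by simp
    also have "\<dots> = amap G' k' \<cdot>\<^bsub>D\<^esub> amap G' \<alpha> \<cdot>\<^bsub>D\<^esub> \<theta> x0"
      using D.Comp_assoc [OF th [OF o(1)] G'h [OF k(3)] G'h [OF k(2)]]
        functor_Comp [OF assms(4) k(3,2)] e by simp
    finally show ?thesis .
  qed
  have St: "amap S' (\<theta> x) \<in> isos D (omap S' (omap G x)) (omap S' (omap G' x))"
    using natural_iso_isos [OF \<theta> ob(1)] functor_isos [OF assms(2,2) S'] by blast
  define m where "m = \<eta> x \<cdot>\<^bsub>D\<^esub> \<theta> (omap S x)"
  have m: "m \<in> homs D (omap G (omap S x)) (omap S' (omap G' x))"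
    unfolding m_def using D.Comp_in [OF th [OF ob(7)] eh [OF ob(1)]] .
  \<comment> \<open>\<open>S'\<close> applied to \<open>\<theta> x\<close> cancels the inverse built
    into \<open>\<zeta>\<close>; what is left is naturality of \<open>\<eta>\<close> at
    \<open>a\<close>.\<close>
  have "amap S' (amap G' a \<cdot>\<^bsub>D\<^esub> \<theta> x) \<cdot>\<^bsub>D\<^esub> \<zeta> = amap S' (amap G' a) \<cdot>\<^bsub>D\<^esub> amap S' (\<theta> x) \<cdot>\<^bsub>D\<^esub> \<zeta>"
    using functor_Comp [OF S' th [OF ob(1)] G'h [OF a']]
      D.Comp_assoc [OF \<zeta> functor_homs [OF S' th [OF ob(1)]] functor_homs [OF S' G'h [OF a']]] by simp
  also have "\<dots> = amap S' (amap G' a) \<cdot>\<^bsub>D\<^esub> \<eta> x \<cdot>\<^bsub>D\<^esub> \<theta> (omap S x)"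
    using D.Comp_inv_cancel(2) [OF St m] by (simp add: \<zeta>_def m_def)
  also have "\<dots> = (\<eta> x' \<cdot>\<^bsub>D\<^esub> amap G' (amap S a)) \<cdot>\<^bsub>D\<^esub> \<theta> (omap S x)"
    using natural_iso_natural [OF \<eta> a'] 
      D.Comp_assoc [OF th [OF ob(7)] eh [OF ob(1)] functor_homs [OF S' G'h [OF a']]] by simp
  also have "\<dots> = \<eta> x' \<cdot>\<^bsub>D\<^esub> amap G' (amap S a) \<cdot>\<^bsub>D\<^esub> \<theta> (omap S x)"
    using D.Comp_assoc [OF th [OF ob(7)] G'h [OF functor_homs [OF S a']] eh [OF ob(4)]] .
  finally have e4: "amap S' (amap G' a \<cdot>\<^bsub>D\<^esub> \<theta> x) \<cdot>\<^bsub>D\<^esub> \<zeta>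
      = \<eta> x' \<cdot>\<^bsub>D\<^esub> amap G' (amap S a) \<cdot>\<^bsub>D\<^esub> \<theta> (omap S x)" .
  have GSt: "amap G' (amap S a) \<cdot>\<^bsub>D\<^esub> \<theta> (omap S x) \<in> homs D (omap G (omap S x)) (omap G' (omap S x'))"
    using D.Comp_in [OF th [OF ob(7)] G'h [OF functor_homs [OF S a']]] .
  have Gct: "amap G' c \<cdot>\<^bsub>D\<^esub> \<theta> z \<in> homs D (omap G z) (omap G' z')"
    using D.Comp_in [OF th [OF ob(3)] G'h [OF c']] .
  have S'at: "amap S' (amap G' a \<cdot>\<^bsub>D\<^esub> \<theta> x) \<in> homs D (omap S' (omap G x)) (omap S' (omap G' x'))"
    using functor_homs [OF S' D.Comp_in [OF th [OF ob(1)] G'h [OF a']]] .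
  have "amap S' (amap G' a \<cdot>\<^bsub>D\<^esub> \<theta> x) \<cdot>\<^bsub>D\<^esub> \<zeta> \<cdot>\<^bsub>D\<^esub> amap G h
      = (\<eta> x' \<cdot>\<^bsub>D\<^esub> amap G' (amap S a) \<cdot>\<^bsub>D\<^esub> \<theta> (omap S x)) \<cdot>\<^bsub>D\<^esub> amap G h"
    using D.Comp_assoc [OF Gh [OF h] \<zeta> S'at] e4 by simp
  also have "\<dots> = \<eta> x' \<cdot>\<^bsub>D\<^esub> (amap G' (amap S a) \<cdot>\<^bsub>D\<^esub> \<theta> (omap S x)) \<cdot>\<^bsub>D\<^esub> amap G h"
    using D.Comp_assoc [OF Gh [OF h] GSt eh [OF ob(4)]] .
  also have "\<dots> = \<eta> x' \<cdot>\<^bsub>D\<^esub> amap G' w \<cdot>\<^bsub>D\<^esub> amap G' c \<cdot>\<^bsub>D\<^esub> \<theta> z"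
    using sq [OF h w c' functor_homs [OF S a'] e3] by simp
  also have "\<dots> = (\<eta> x' \<cdot>\<^bsub>D\<^esub> amap G' w) \<cdot>\<^bsub>D\<^esub> amap G' c \<cdot>\<^bsub>D\<^esub> \<theta> z"
    using D.Comp_assoc [OF Gct G'h [OF w] eh [OF ob(4)]] by simp
  finally have e5: "amap S' (amap G' a \<cdot>\<^bsub>D\<^esub> \<theta> x) \<cdot>\<^bsub>D\<^esub> \<zeta> \<cdot>\<^bsub>D\<^esub> amap G h
      = (\<eta> x' \<cdot>\<^bsub>D\<^esub> amap G' w) \<cdot>\<^bsub>D\<^esub> amap G' c \<cdot>\<^bsub>D\<^esub> \<theta> z" .
  have i: "amap G' k \<cdot>\<^bsub>D\<^esub> \<theta> x0 \<in> isos D (omap G x0) (omap G' x1)" if "k \<in> isos C x0 x1" for k x0 x1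
    using that D.isos_Comp natural_iso_isos [OF \<theta>] functor_isos [OF assms(1,2,4)]
      C.homs_Obj [OF C.isos_homs] by metis
  note hs = homsD [OF Gh [OF f]] homsD [OF Gh [OF g]] homsD [OF D.Comp_in [OF Gh [OF h] \<zeta>]]
    homsD [OF G'h [OF s]] homsD [OF G'h [OF t]] homsD [OF D.Comp_in [OF G'h [OF w] eh [OF ob(4)]]]
  have d: "Dom C f = x" "Dom C s = x'"
    by (simp_all add: x_def x'_def)
  show ?thesis
    unfolding d \<zeta>_def [symmetric]
    unfolding iso_triangles_def is_triangle_def
    using hs i [OF a] i [OF b] i [OF c] sq [OF f s a' b' e1] sq [OF g t b' c' e2] e5 by auto
qed


section \<open>The universal property of the localization\<close>

lemma zigzag_append: "\<lbrakk>zigzag C W x y p; zigzag C W y z q\<rbrakk> \<Longrightarrow> zigzag C W x z (p @ q)"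
  by (induction p arbitrary: x) auto

context category
begin

lemma zigzag_Obj: "zigzag C W x y p \<Longrightarrow> x \<in> Obj C \<and> y \<in> Obj C"
proof (induction p arbitrary: x)
  case (Cons s p)
  then show ?case
    using Dom_in Cod_in by (cases s) auto
qed auto

lemma zigzag_Fwd: "f \<in> homs C x y \<Longrightarrow> zigzag C W x y [Fwd f]"
  using homs_Obj by (auto simp: homs_def)

lemma zigzag_Bwd: "\<lbrakk>w \<in> W; w \<in> homs C x y\<rbrakk> \<Longrightarrow> zigzag C W y x [Bwd w]"
  using homs_Obj by (auto simp: homs_def)

lemma zigzag_eq_zigzag: "zigzag_eq C W x y p q \<Longrightarrow> zigzag C W x y p \<and> zigzag C W x y q"
proof (induction rule: zigzag_eq.induct)
  case (append x y p p' z q q')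
  then show ?case
    using zigzag_append by metis
next
  case (ide x)
  then show ?case
    using zigzag_Fwd [OF Ide_in] by auto
next
  case (comp f x y g z)
  then show ?case
    using zigzag_append [OF zigzag_Fwd zigzag_Fwd] zigzag_Fwd [OF Comp_in] by fastforce
next
  case (fwd_bwd w x y)
  then show ?case
    using zigzag_append [OF zigzag_Fwd zigzag_Bwd] homs_Obj by fastforce
next
  case (bwd_fwd w x y)
  then show ?case
    using zigzag_append [OF zigzag_Bwd zigzag_Fwd] homs_Obj by fastforce
qed auto

lemma loc_class_eqI: "zigzag_eq C W x y p q \<Longrightarrow> loc_class C W x y p = loc_class C W x y q"
  by (auto simp: loc_class_def intro: zigzag_eq.sym zigzag_eq.trans)

text \<open>\<open>Comp\<close> collects whatever is equivalent to a concatenation of some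
  representatives; since \<open>zigzag_eq\<close> is a congruence for concatenation, this is a
  single class.\<close>

lemma loc_Comp:
  assumes "zigzag C W x y p" "zigzag C W y z q"
  shows "loc_class C W y z q \<cdot>\<^bsub>localization C W\<^esub> loc_class C W x y p = loc_class C W x z (p @ q)"
proof -
  have "(\<exists>p'. zigzag_eq C W x y p p' \<and> (\<exists>q'. zigzag_eq C W y z q q' \<and> zigzag_eq C W x z (p' @ q') r))
      \<longleftrightarrow> zigzag_eq C W x z (p @ q) r" for r
    by (meson zigzag_eq.refl assms zigzag_eq.append zigzag_eq.trans)
  then show ?thesis
    by (simp add: loc_class_def localization_def)
qed

lemma loc_class_homs: "zigzag C W x y p \<Longrightarrow> loc_class C W x y p \<in> homs (localization C W) x y"
  by (auto simp: homs_def localization_def loc_class_def)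

lemma loc_homsE:
  assumes "c \<in> homs (localization C W) x y"
  obtains p where "zigzag C W x y p" "c = loc_class C W x y p"
  using assms by (auto simp: homs_def localization_def loc_class_def)

lemma loc_Obj [simp]: "Obj (localization C W) = Obj C"
  by (simp add: localization_def)

lemma loc_Ide: "Ide (localization C W) x = loc_class C W x x []"
  by (simp add: localization_def)

lemma category_localization: "category (localization C W)"
proof
  let ?L = "localization C W"
  show "Dom ?L f \<in> Obj ?L" "Cod ?L f \<in> Obj ?L" if "f \<in> Arr ?L" for f
    using that zigzag_Obj by (auto simp: localization_def loc_class_def)
  show "Ide ?L x \<in> homs ?L x x" if "x \<in> Obj ?L" for x
    using that by (auto simp: loc_Ide intro: loc_class_homs)
  show "g \<cdot>\<^bsub>?L\<^esub> f \<in> homs ?L x z" if "f \<in> homs ?L x y" "g \<in> homs ?L y z" for f g x y z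
    using that by (elim loc_homsE) (simp add: loc_Comp loc_class_homs zigzag_append)
  show "f \<cdot>\<^bsub>?L\<^esub> Ide ?L x = f" if "f \<in> homs ?L x y" for f x y
  proof -
    obtain p where p: "zigzag C W x y p" "f = loc_class C W x y p"
      using \<open>f \<in> homs ?L x y\<close> by (rule loc_homsE)
    then show ?thesis
      using zigzag_Obj [OF p(1)] loc_Comp [of W x x "[]"] by (simp add: loc_Ide)
  qed
  show "Ide ?L y \<cdot>\<^bsub>?L\<^esub> f = f" if "f \<in> homs ?L x y" for f x y
  proof -
    obtain p where p: "zigzag C W x y p" "f = loc_class C W x y p"
      using \<open>f \<in> homs ?L x y\<close> by (rule loc_homsE)
    then show ?thesis
      using zigzag_Obj [OF p(1)] loc_Comp [of W x y p y "[]"] by (simp add: loc_Ide)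
  qed
  show "(h \<cdot>\<^bsub>?L\<^esub> g) \<cdot>\<^bsub>?L\<^esub> f = h \<cdot>\<^bsub>?L\<^esub> g \<cdot>\<^bsub>?L\<^esub> f"
    if "f \<in> homs ?L x y" "g \<in> homs ?L y z" "h \<in> homs ?L z t" for f g h x y z t
    using that by (elim loc_homsE) (simp add: loc_Comp zigzag_append)
qed

lemma loc_functor_omap [simp]: "omap (loc_functor C W) x = x"
  by (simp add: loc_functor_def)

lemma loc_functor_Fwd: "f \<in> homs C x y \<Longrightarrow> amap (loc_functor C W) f = loc_class C W x y [Fwd f]"
  by (simp add: loc_functor_def homs_def)

lemma functor_loc_functor: "is_functor C (localization C W) (loc_functor C W)"
proof (rule is_functorI)
  show "amap (loc_functor C W) (Ide C x) = Ide (localization C W) (omap (loc_functor C W) x)"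
    if "x \<in> Obj C" for x
    using loc_functor_Fwd [OF Ide_in [OF that]] loc_class_eqI [OF zigzag_eq.ide [of x C W, OF that]]
    by (simp add: loc_Ide)
  show "amap (loc_functor C W) f \<in> homs (localization C W) (omap (loc_functor C W) x) (omap (loc_functor C W) y)"
    if "f \<in> homs C x y" for f x y
    using that loc_class_homs [OF zigzag_Fwd] by (simp add: loc_functor_Fwd)
  show "amap (loc_functor C W) (g \<cdot> f)
      = amap (loc_functor C W) g \<cdot>\<^bsub>localization C W\<^esub> amap (loc_functor C W) f"
    if "f \<in> homs C x y" "g \<in> homs C y z" for f g x y z
    using loc_functor_Fwd [OF that(1)] loc_functor_Fwd [OF that(2)] loc_functor_Fwd [OF Comp_in [OF that]]
      loc_Comp [OF zigzag_Fwd [OF that(1)] zigzag_Fwd [OF that(2)]]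
      loc_class_eqI [OF zigzag_eq.comp [OF that]] by simp
qed simp

text \<open>The inverse is identified explicitly, so that a backward step of a zigzag can be traded
  for \<open>inv_arr\<close> under any functor.\<close>

lemma loc_Bwd:
  assumes "w \<in> W" "w \<in> homs C x y"
  shows "amap (loc_functor C W) w \<in> isos (localization C W) x y"
    and "inv_arr (localization C W) (amap (loc_functor C W) w) = loc_class C W y x [Bwd w]"
proof -
  interpret L: category "localization C W"
    by (rule category_localization)
  note z = zigzag_Fwd [of w x y W, OF assms(2)] zigzag_Bwd [of w W x y, OF assms]
  have f: "amap (loc_functor C W) w \<in> homs (localization C W) x y"
    "loc_class C W y x [Bwd w] \<in> homs (localization C W) y x"
    using loc_class_homs [OF z(1)] loc_class_homs [OF z(2)] by (simp_all add: loc_functor_Fwd [OF assms(2)])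
  have e: "loc_class C W y x [Bwd w] \<cdot>\<^bsub>localization C W\<^esub> amap (loc_functor C W) w = Ide (localization C W) x"
    "amap (loc_functor C W) w \<cdot>\<^bsub>localization C W\<^esub> loc_class C W y x [Bwd w] = Ide (localization C W) y"
    using loc_Comp [OF z] loc_Comp [OF z(2,1)] loc_class_eqI [OF zigzag_eq.fwd_bwd [OF assms]]
      loc_class_eqI [OF zigzag_eq.bwd_fwd [OF assms]]
    by (simp_all add: loc_functor_Fwd [OF assms(2)] loc_Ide)
  show "amap (loc_functor C W) w \<in> isos (localization C W) x y"
    using f e by (rule L.isosI)
  show "inv_arr (localization C W) (amap (loc_functor C W) w) = loc_class C W y x [Bwd w]"
    using f e by (rule L.inv_arr_eqI)
qed

end

section \<open>Functors that invert a class of arrows, and their extension to the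
  localization\<close>

definition inverts :: "('o, 'm, 'e) cat_scheme \<Rightarrow> 'm set \<Rightarrow> ('p, 'n, 'd) cat_scheme \<Rightarrow>
    ('o, 'm, 'p, 'n) fmap \<Rightarrow> bool" where
  "inverts C W D G \<longleftrightarrow>
     (\<forall>x y. \<forall>w\<in>W \<inter> homs C x y. amap G w \<in> isos D (omap G x) (omap G y))"

lemma invertsD:
  "\<lbrakk>inverts C W D G; w \<in> W; w \<in> homs C x y\<rbrakk> \<Longrightarrow> amap G w \<in> isos D (omap G x) (omap G y)"
  by (auto simp: inverts_def)

lemma invertsI:
  "(\<And>w x y. \<lbrakk>w \<in> W; w \<in> homs C x y\<rbrakk> \<Longrightarrow> amap G w \<in> isos D (omap G x) (omap G y))
   \<Longrightarrow> inverts C W D G"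
  by (auto simp: inverts_def)

locale inverting_functor = C: category C + D: category D
  for C :: "('o, 'm, 'e) cat_scheme" and D :: "('p, 'n, 'd) cat_scheme" +
  fixes G :: "('o, 'm, 'p, 'n) fmap" and W :: "'m set"
  assumes fun_G: "is_functor C D G" and inv_G: "inverts C W D G"
begin

lemma step_eval_homs:
  assumes "step_ok C W s"
  shows "step_eval D G s \<in> homs D (omap G (step_src C s)) (omap G (step_tgt C s))"
proof (cases s)
  case (Bwd w)
  then show ?thesis
    using assms D.inv_arr(1) [OF invertsD [OF inv_G]] by (simp add: Arr_homs)
qed (use assms functor_homs [OF fun_G] Arr_homs in force)

lemma zigzag_eval_homs:
  "zigzag C W x y p \<Longrightarrow> zigzag_eval C D G x p \<in> homs D (omap G x) (omap G y)"
proof (induction p arbitrary: x)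
  case Nil
  then show ?case
    using functor_Obj [OF fun_G] D.Ide_in by auto
next
  case (Cons s p)
  then show ?case
    using D.Comp_in [OF step_eval_homs [of s]] by auto
qed

lemma zigzag_eval_append:
  "\<lbrakk>zigzag C W x y p; zigzag C W y z q\<rbrakk>
   \<Longrightarrow> zigzag_eval C D G x (p @ q) = zigzag_eval C D G y q \<cdot>\<^bsub>D\<^esub> zigzag_eval C D G x p"
proof (induction p arbitrary: x)
  case Nil
  then show ?case
    using D.Comp_Ide [OF zigzag_eval_homs] by auto
next
  case (Cons s p)
  then show ?case
    using D.Comp_assoc [OF step_eval_homs zigzag_eval_homs zigzag_eval_homs] by auto
qed

lemma zigzag_eval_Fwd:
  "f \<in> homs C x y \<Longrightarrow> zigzag_eval C D G x [Fwd f] = amap G f"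
  using D.Ide_Comp [OF functor_homs [OF fun_G]] by (auto simp: homs_def)

lemma zigzag_eval_Bwd:
  "\<lbrakk>w \<in> W; w \<in> homs C x y\<rbrakk> \<Longrightarrow> zigzag_eval C D G y [Bwd w] = inv_arr D (amap G w)"
  using D.Ide_Comp [OF D.inv_arr(1) [OF invertsD [OF inv_G]]] by (auto simp: homs_def)

text \<open>Each generating relation becomes an equation in \<open>D\<close>: functoriality gives
  those for identities and composites, invertibility of the images of \<open>W\<close> the last
  two.\<close>

lemma zigzag_eval_eq:
  "zigzag_eq C W x y p q \<Longrightarrow> zigzag_eval C D G x p = zigzag_eval C D G x q"
proof (induction rule: zigzag_eq.induct)
  case (append x y p p' z q q')
  then show ?case
    using C.zigzag_eq_zigzag zigzag_eval_append by metis
next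
  case (ide x)
  then show ?case
    using zigzag_eval_Fwd [OF C.Ide_in] functor_Ide [OF fun_G] by simp
next
  case (comp f x y g z)
  then show ?case
    using zigzag_eval_append [OF C.zigzag_Fwd C.zigzag_Fwd, of f x y g z] zigzag_eval_Fwd [of f x y]
      zigzag_eval_Fwd [of g y z] zigzag_eval_Fwd [OF C.Comp_in, of f x y g z]
      functor_Comp [OF fun_G, of f x y g z] by simp
next
  case (fwd_bwd w x y)
  then show ?case
    using zigzag_eval_append [OF C.zigzag_Fwd C.zigzag_Bwd, of w x y w x] zigzag_eval_Fwd [of w x y]
      zigzag_eval_Bwd [of w x y] D.inv_arr(2) [OF invertsD [OF inv_G]] by simp
next
  case (bwd_fwd w x y)
  then show ?case
    using zigzag_eval_append [OF C.zigzag_Bwd C.zigzag_Fwd, of w x y w y] zigzag_eval_Fwd [of w x y]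
      zigzag_eval_Bwd [of w x y] D.inv_arr(3) [OF invertsD [OF inv_G]] by simp
qed simp_all

lemma loc_induced_omap [simp]: "omap (loc_induced C D G) x = omap G x"
  by (simp add: loc_induced_def)

text \<open>\<open>loc_induced\<close> evaluates a representative picked by \<open>SOME\<close>; as
  evaluation is constant on the class, any representative will do.\<close>

lemma loc_induced_class:
  assumes "zigzag C W x y p"
  shows "amap (loc_induced C D G) (loc_class C W x y p) = zigzag_eval C D G x p"
proof -
  have "zigzag_eq C W x y p (SOME q. q \<in> {q. zigzag_eq C W x y p q})"
    using someI [of "\<lambda>q. q \<in> {q. zigzag_eq C W x y p q}" p] zigzag_eq.refl [OF assms] by simp
  then show ?thesis
    by (simp add: loc_induced_def loc_class_def zigzag_eval_eq)
qed

lemma loc_induced_loc_functor: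
  "f \<in> homs C x y \<Longrightarrow> amap (loc_induced C D G) (amap (loc_functor C W) f) = amap G f"
  by (simp add: C.loc_functor_Fwd loc_induced_class [OF C.zigzag_Fwd] zigzag_eval_Fwd
      del: zigzag_eval.simps)

lemma functor_loc_induced: "is_functor (localization C W) D (loc_induced C D G)"
proof (rule is_functorI)
  show "amap (loc_induced C D G) (Ide (localization C W) x) = Ide D (omap (loc_induced C D G) x)"
    if "x \<in> Obj (localization C W)" for x
    using that loc_induced_class [of x x "[]"] by (simp add: C.loc_Ide)
  show "amap (loc_induced C D G) f \<in> homs D (omap (loc_induced C D G) x) (omap (loc_induced C D G) y)"
    if "f \<in> homs (localization C W) x y" for f x y
    using that by (elim C.loc_homsE) (simp add: loc_induced_class zigzag_eval_homs)
  show "amap (loc_induced C D G) (g \<cdot>\<^bsub>localization C W\<^esub> f)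
      = amap (loc_induced C D G) g \<cdot>\<^bsub>D\<^esub> amap (loc_induced C D G) f"
    if "f \<in> homs (localization C W) x y" "g \<in> homs (localization C W) y z" for f g x y z
    using that by (elim C.loc_homsE)
      (simp add: loc_induced_class zigzag_eval_append C.loc_Comp zigzag_append)
qed (use functor_Obj [OF fun_G] in simp)

end

section \<open>Natural isomorphisms between functors on a localization\<close>

lemma natural_inverse_arrow:
  assumes "category D" "f \<in> isos D x y" "g \<in> isos D x' y'" "a \<in> homs D x x'" "b \<in> homs D y y'"
    and "b \<cdot>\<^bsub>D\<^esub> f = g \<cdot>\<^bsub>D\<^esub> a"
  shows "a \<cdot>\<^bsub>D\<^esub> inv_arr D f = inv_arr D g \<cdot>\<^bsub>D\<^esub> b"
proof -
  interpret D: category D by fact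
  note f = D.isos_homs [OF assms(2)] D.inv_arr(1) [OF assms(2)]
  note g = D.isos_homs [OF assms(3)] D.inv_arr(1) [OF assms(3)]
  have "g \<cdot>\<^bsub>D\<^esub> a \<cdot>\<^bsub>D\<^esub> inv_arr D f = g \<cdot>\<^bsub>D\<^esub> inv_arr D g \<cdot>\<^bsub>D\<^esub> b"
    using D.Comp_assoc [OF f(2) assms(4) g(1)] assms(6) D.Comp_inv_cancel(2) [OF assms(3,5)]
      D.Comp_inv_cancel_right(1) [OF assms(2,5)] by simp
  then show ?thesis
    using D.iso_cancel_left [OF assms(3) D.Comp_in [OF f(2) assms(4)] D.Comp_in [OF assms(5) g(2)]]
    by blast
qed

lemma functor_inv_arr:
  assumes "category C" "category D" "is_functor C D G" "f \<in> isos C x y"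
  shows "amap G (inv_arr C f) = inv_arr D (amap G f)"
proof -
  interpret C: category C by fact
  interpret D: category D by fact
  note f = C.isos_homs [OF assms(4)] C.inv_arr [OF assms(4)]
  have "x \<in> Obj C" "y \<in> Obj C"
    using f C.homs_Obj by blast+
  then show ?thesis
    using D.inv_arr_eqI [OF functor_homs [OF assms(3) f(1)] functor_homs [OF assms(3) f(2)]]
      functor_Comp [OF assms(3) f(1,2)] functor_Comp [OF assms(3) f(2,1)] f functor_Ide [OF assms(3)]
    by simp
qed

text \<open>A zigzag is a composite of images of arrows of \<open>C\<close> and of inverses of such
  images. Naturality passes to inverses by reversing the square,
  \<open>natural_inverse_arrow\<close>, and to composites by induction on the length.\<close>

lemma natural_iso_localization:
  assumes "category C" "category D"
    and G: "is_functor (localization C W) D G" and H: "is_functor (localization C W) D H"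
    and \<eta>: "\<And>x. x \<in> Obj C \<Longrightarrow> \<eta> x \<in> isos D (omap G x) (omap H x)"
    and nat: "\<And>f x y. f \<in> homs C x y \<Longrightarrow>
      \<eta> y \<cdot>\<^bsub>D\<^esub> amap G (amap (loc_functor C W) f) = amap H (amap (loc_functor C W) f) \<cdot>\<^bsub>D\<^esub> \<eta> x"
  shows "natural_iso (localization C W) D G H \<eta>"
proof -
  interpret C: category C by fact
  interpret D: category D by fact
  let ?L = "localization C W"
  note L = C.category_localization [of W]
  have step: "\<eta> (step_tgt C s) \<cdot>\<^bsub>D\<^esub> amap G (loc_class C W (step_src C s) (step_tgt C s) [s])
      = amap H (loc_class C W (step_src C s) (step_tgt C s) [s]) \<cdot>\<^bsub>D\<^esub> \<eta> (step_src C s)"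
    if "step_ok C W s" for s
  proof (cases s)
    case (Fwd f)
    then show ?thesis
      using that nat [OF Arr_homs] C.loc_functor_Fwd [OF Arr_homs] by simp
  next
    case (Bwd w)
    then have w: "w \<in> W" "w \<in> homs C (Dom C w) (Cod C w)"
      using that by (simp_all add: Arr_homs)
    note ob = C.homs_Obj [OF w(2), THEN conjunct1] C.homs_Obj [OF w(2), THEN conjunct2]
    note i = C.loc_Bwd(1) [OF w]
    show ?thesis
      using natural_inverse_arrow [OF assms(2) functor_isos [OF L assms(2) G i]
          functor_isos [OF L assms(2) H i] D.isos_homs [OF \<eta> [OF ob(1)]] D.isos_homs [OF \<eta> [OF ob(2)]]
          nat [OF w(2)]]
        functor_inv_arr [OF L assms(2) G i] functor_inv_arr [OF L assms(2) H i] C.loc_Bwd(2) [OF w] Bwd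
      by simp
  qed
  have "\<eta> y \<cdot>\<^bsub>D\<^esub> amap G (loc_class C W x y p) = amap H (loc_class C W x y p) \<cdot>\<^bsub>D\<^esub> \<eta> x"
    if "zigzag C W x y p" for x y p
    using that
  proof (induction p arbitrary: x)
    case Nil
    then have x: "x \<in> Obj C" "x = y"
      by auto
    then show ?case
      using functor_Ide [OF G, of x] functor_Ide [OF H, of x] D.Comp_Ide [OF D.isos_homs [OF \<eta>]]
        D.Ide_Comp [OF D.isos_homs [OF \<eta>]] by (simp add: C.loc_Ide)
  next
    case (Cons s p)
    define z where "z = step_tgt C s"
    have s: "step_ok C W s" "step_src C s = x" and p: "zigzag C W z y p"
      using Cons.prems by (auto simp: z_def)
    have o: "x \<in> Obj C" "y \<in> Obj C" "z \<in> Obj C"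
      using C.zigzag_Obj [OF Cons.prems] C.zigzag_Obj [OF p] by auto
    have s': "zigzag C W x z [s]"
      using s o by (simp add: z_def)
    note cs = C.loc_class_homs [OF s'] and cp = C.loc_class_homs [OF p]
    note \<eta>h = D.isos_homs [OF \<eta> [OF o(1)]] D.isos_homs [OF \<eta> [OF o(2)]] D.isos_homs [OF \<eta> [OF o(3)]]
    note Gs = functor_homs [OF G cs] functor_homs [OF G cp] functor_homs [OF H cs] functor_homs [OF H cp]
    have e: "loc_class C W x y (s # p) = loc_class C W z y p \<cdot>\<^bsub>?L\<^esub> loc_class C W x z [s]"
      using C.loc_Comp [OF s' p] by simp
    show ?case
      using D.Comp_assoc [OF Gs(1,2) \<eta>h(2)] D.Comp_assoc [OF Gs(1) \<eta>h(3) Gs(4)]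
        D.Comp_assoc [OF \<eta>h(1) Gs(3,4)] step [OF s(1)] Cons.IH [OF p] s(2)
        functor_Comp [OF G cs cp] functor_Comp [OF H cs cp] by (simp add: e z_def)
  qed
  then show ?thesis
    using \<eta> by (intro natural_isoI) (auto elim: C.loc_homsE)
qed

text \<open>Localizing leaves the objects alone, so the same components serve.\<close>

lemma natural_iso_loc_induced:
  assumes "inverting_functor C D G W" "inverting_functor C D H W" "natural_iso C D G H \<eta>"
  shows "natural_iso (localization C W) D (loc_induced C D G) (loc_induced C D H) \<eta>"
proof -
  interpret G: inverting_functor C D G W by fact
  interpret H: inverting_functor C D H W by fact
  show ?thesis
    using natural_iso_isos [OF assms(3)] natural_iso_natural [OF assms(3)]
    by (intro natural_iso_localization [OF G.C.category_axioms G.D.category_axioms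
          G.functor_loc_induced H.functor_loc_induced])
      (simp_all add: G.loc_induced_loc_functor H.loc_induced_loc_functor)
qed


section \<open>Additive categories\<close>

definition Neg :: "('o, 'm, 'e) add_cat_scheme \<Rightarrow> 'm \<Rightarrow> 'm" where
  "Neg C f = inv\<^bsub>hom_group C (Dom C f) (Cod C f)\<^esub> f"

context additive_category
begin

lemma hom_group_simps [simp]:
  "carrier (hom_group C x y) = homs C x y" "mult (hom_group C x y) = Plus C"
  "one (hom_group C x y) = Zero C x y"
  by (simp_all add: hom_group_def)

lemma hom_comm_group': "f \<in> homs C x y \<Longrightarrow> comm_group (hom_group C x y)"
  using hom_comm_group homs_Obj by blast

lemma Plus_homs: "\<lbrakk>f \<in> homs C x y; g \<in> homs C x y\<rbrakk> \<Longrightarrow> Plus C f g \<in> homs C x y"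
  using comm_groupE(1) [OF hom_comm_group'] by fastforce

lemma Zero_homs: "\<lbrakk>x \<in> Obj C; y \<in> Obj C\<rbrakk> \<Longrightarrow> Zero C x y \<in> homs C x y"
  using comm_groupE(2) [OF hom_comm_group] by fastforce

lemma Plus_assoc:
  "\<lbrakk>f \<in> homs C x y; g \<in> homs C x y; h \<in> homs C x y\<rbrakk>
   \<Longrightarrow> Plus C (Plus C f g) h = Plus C f (Plus C g h)"
  using comm_groupE(3) [OF hom_comm_group'] by fastforce

lemma Plus_comm: "\<lbrakk>f \<in> homs C x y; g \<in> homs C x y\<rbrakk> \<Longrightarrow> Plus C f g = Plus C g f"
  using comm_groupE(4) [OF hom_comm_group'] by fastforce

lemma Zero_Plus: "f \<in> homs C x y \<Longrightarrow> Plus C (Zero C x y) f = f"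
  using comm_groupE(5) [OF hom_comm_group'] by fastforce

lemma Plus_Zero: "f \<in> homs C x y \<Longrightarrow> Plus C f (Zero C x y) = f"
  using Zero_Plus Plus_comm Zero_homs homs_Obj by metis

lemma Neg_homs: "f \<in> homs C x y \<Longrightarrow> Neg C f \<in> homs C x y"
  using group.inv_closed [OF comm_group.axioms(2) [OF hom_comm_group']] homsD
  by (fastforce simp: Neg_def)

lemma Plus_Neg: "f \<in> homs C x y \<Longrightarrow> Plus C f (Neg C f) = Zero C x y"
  using group.r_inv [OF comm_group.axioms(2) [OF hom_comm_group']] homsD
  by (fastforce simp: Neg_def)

lemma Neg_Plus: "f \<in> homs C x y \<Longrightarrow> Plus C (Neg C f) f = Zero C x y"
  using Plus_Neg Plus_comm Neg_homs by metis

lemma Plus_eq_self: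
  assumes "f \<in> homs C x y" "Plus C f f = f"
  shows "f = Zero C x y"
  using assms Plus_assoc [OF Neg_homs [OF assms(1)] assms(1,1)] Neg_Plus [OF assms(1)]
    Zero_Plus [OF assms(1)] by simp

text \<open>By distributivity the composite is idempotent for addition, and the only idempotent of a
  group is its unit.\<close>

lemma Zero_Comp:
  assumes "f \<in> homs C x y" "z \<in> Obj C"
  shows "Zero C y z \<cdot> f = Zero C x z"
proof -
  have z: "Zero C y z \<in> homs C y z"
    using assms homs_Obj Zero_homs by blast
  show ?thesis
    using Plus_eq_self [OF Comp_in [OF assms(1) z]] Plus_Comp [OF z z assms(1)] Plus_Zero [OF z] by simp
qed

lemma Comp_Zero:
  assumes "f \<in> homs C y z" "x \<in> Obj C"
  shows "f \<cdot> Zero C x y = Zero C x z"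
proof -
  have z: "Zero C x y \<in> homs C x y"
    using assms homs_Obj Zero_homs by blast
  show ?thesis
    using Plus_eq_self [OF Comp_in [OF z assms(1)]] Comp_Plus [OF z z assms(1)] Plus_Zero [OF z] by simp
qed

lemma Neg_Comp:
  assumes "f \<in> homs C x y" "g \<in> homs C y z"
  shows "Neg C g \<cdot> f = Neg C (g \<cdot> f)"
proof -
  note h = Comp_in [OF assms] Comp_in [OF assms(1) Neg_homs [OF assms(2)]] Neg_homs [OF Comp_in [OF assms]]
  have "z \<in> Obj C"
    using assms homs_Obj by blast
  then have "Plus C (g \<cdot> f) (Neg C g \<cdot> f) = Zero C x z"
    using Plus_Comp [OF assms(2) Neg_homs [OF assms(2)] assms(1)] Plus_Neg [OF assms(2)]
      Zero_Comp [OF assms(1)] by simp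
  then show ?thesis
    using Plus_assoc [OF h(3,1,2)] Neg_Plus [OF h(1)] Zero_Plus [OF h(2)] Plus_Zero [OF h(3)] by simp
qed

text \<open>The bracketing suits \<open>suspends_cong\<close>, where one extension is written as
  another plus their difference.\<close>

lemma Plus_Minus_cancel:
  assumes "f \<in> homs C x y" "g \<in> homs C x y"
  shows "Plus C g (Plus C f (Neg C g)) = f"
proof -
  note n = Neg_homs [OF assms(2)]
  show ?thesis
    using Plus_comm [OF assms(1) n] Plus_assoc [OF assms(2) n assms(1)] Plus_Neg [OF assms(2)]
      Zero_Plus [OF assms(1)] by simp
qed

lemma coproduct_ex1:
  assumes "is_coproduct C a b" "a \<in> homs C x w" "b \<in> homs C y w" "f \<in> homs C x z" "g \<in> homs C y z"
  shows "\<exists>!t. t \<in> homs C w z \<and> t \<cdot> a = f \<and> t \<cdot> b = g"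
proof -
  have "Dom C a = x" "Dom C b = y" "Cod C a = w"
    using assms homsD by metis+
  then show ?thesis
    using assms(1,4,5) unfolding is_coproduct_def by blast
qed

lemma coproductE:
  assumes "is_coproduct C a b" "a \<in> homs C x w" "b \<in> homs C y w" "f \<in> homs C x z" "g \<in> homs C y z"
  obtains t where "t \<in> homs C w z" "t \<cdot> a = f" "t \<cdot> b = g"
  using coproduct_ex1 [OF assms] by blast

lemma coproduct_unique:
  assumes "is_coproduct C a b" "a \<in> homs C x w" "b \<in> homs C y w" "s \<in> homs C w z" "t \<in> homs C w z"
    and "s \<cdot> a = t \<cdot> a" "s \<cdot> b = t \<cdot> b"
  shows "s = t"
  using coproduct_ex1 [OF assms(1-3) Comp_in [OF assms(2,5)] Comp_in [OF assms(3,5)]] assms(4-7) by blast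

end


section \<open>The stable category\<close>

text \<open>With source and target fixed, the null maps are a subgroup of the hom group, and the
  stable classes are its cosets.\<close>

definition null_homs :: "('o, 'm, 'e) exact_cat_scheme \<Rightarrow> 'o \<Rightarrow> 'o \<Rightarrow> 'm set" where
  "null_homs C x y = {f \<in> homs C x y. factors_projinj C f}"

lemma null_homs_homs: "f \<in> null_homs C x y \<Longrightarrow> f \<in> homs C x y"
  by (simp add: null_homs_def)

lemma stable_class_eq:
  "f \<in> homs C x y \<Longrightarrow> stable_class C f = {g. \<exists>h\<in>null_homs C x y. g = Plus C f h}"
  by (auto simp: stable_class_def null_homs_def homs_def)

context frobenius_category
begin

text \<open>Only \<open>Conf\<close> is primitive; that \<open>i\<close> is an arrow comes from its
  being a kernel.\<close>

lemma adm_mono_homs: "adm_mono C i \<Longrightarrow> i \<in> homs C (Dom C i) (Cod C i)"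
  using Conf_kernel is_kernel_def Arr_homs unfolding adm_mono_def by metis

lemma null_homsI:
  "\<lbrakk>injective C w; a \<in> homs C x w; b \<in> homs C w y\<rbrakk> \<Longrightarrow> b \<cdot> a \<in> null_homs C x y"
  using Comp_in projective_iff_injective by (auto simp: null_homs_def factors_projinj_def homs_def)

lemma null_homsE:
  assumes "f \<in> null_homs C x y"
  obtains w a b where "injective C w" "projective C w" "a \<in> homs C x w" "b \<in> homs C w y" "f = b \<cdot> a"
  using assms by (auto simp: null_homs_def factors_projinj_def homs_def)

text \<open>The first factor ends at an injective and can be extended. Hence all null maps out of
  \<open>x\<close> factor through any one injective envelope of \<open>x\<close>, whichever object
  each of them was given with.\<close>

lemma null_homs_extend:
  assumes "f \<in> null_homs C x y" "adm_mono C i" "i \<in> homs C x z"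
  obtains b where "b \<in> homs C z y" "f = b \<cdot> i"
proof -
  obtain w a b where w: "injective C w" "a \<in> homs C x w" "b \<in> homs C w y" "f = b \<cdot> a"
    using assms(1) by (rule null_homsE)
  then obtain a' where a': "a' \<in> homs C z w" "a' \<cdot> i = a"
    using assms homsD unfolding injective_def by metis
  have "f = (b \<cdot> a') \<cdot> i"
    using Comp_assoc [OF assms(3) a'(1) w(3)] w a' by simp
  then show ?thesis
    using that Comp_in [OF a'(1) w(3)] by blast
qed

text \<open>Dual to \<open>null_homs_extend\<close>: the intermediate object is projective too, so
  the second factor lifts.\<close>

lemma null_homs_lift:
  assumes "f \<in> null_homs C x y" "adm_epi C p" "p \<in> homs C z y"
  obtains b where "b \<in> homs C x z" "f = p \<cdot> b"
proof -
  obtain w a b where w: "projective C w" "a \<in> homs C x w" "b \<in> homs C w y" "f = b \<cdot> a"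
    using assms(1) by (rule null_homsE)
  then obtain b' where b': "b' \<in> homs C w z" "p \<cdot> b' = b"
    using assms homsD unfolding projective_def by metis
  have "f = p \<cdot> (b' \<cdot> a)"
    using Comp_assoc [OF w(2) b'(1) assms(3)] w b' by simp
  then show ?thesis
    using that Comp_in [OF w(2) b'(1)] by blast
qed

lemma null_homs_Comp_left:
  assumes "f \<in> null_homs C x y" "g \<in> homs C y z"
  shows "g \<cdot> f \<in> null_homs C x z"
proof -
  obtain w a b where w: "injective C w" "a \<in> homs C x w" "b \<in> homs C w y" "f = b \<cdot> a"
    using assms(1) by (rule null_homsE)
  show ?thesis
    using null_homsI [OF w(1,2) Comp_in [OF w(3) assms(2)]] Comp_assoc [OF w(2,3) assms(2)] w(4) by simp
qed

lemma null_homs_Comp_right: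
  assumes "f \<in> null_homs C y z" "g \<in> homs C x y"
  shows "f \<cdot> g \<in> null_homs C x z"
proof -
  obtain w a b where w: "injective C w" "a \<in> homs C y w" "b \<in> homs C w z" "f = b \<cdot> a"
    using assms(1) by (rule null_homsE)
  show ?thesis
    using null_homsI [OF w(1) Comp_in [OF assms(2) w(2)] w(3)] Comp_assoc [OF assms(2) w(2,3)] w(4) by simp
qed

lemma injective_envelope:
  assumes "x \<in> Obj C"
  obtains i z where "adm_mono C i" "i \<in> homs C x z" "injective C z"
  using enough_injectives [OF assms] adm_mono_homs by metis

text \<open>Both maps are rewritten over one injective envelope of \<open>x\<close>, where only the
  second factors have to be added; no direct sum of the two intermediate objects is formed.\<close>

lemma null_homs_Plus:
  assumes "f \<in> null_homs C x y" "g \<in> null_homs C x y"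
  shows "Plus C f g \<in> null_homs C x y"
proof -
  have "x \<in> Obj C"
    using homs_Obj [OF null_homs_homs [OF assms(1)]] by blast
  then obtain i z where i: "adm_mono C i" "i \<in> homs C x z" "injective C z"
    by (rule injective_envelope)
  obtain a where a: "a \<in> homs C z y" "f = a \<cdot> i"
    using assms(1) i(1,2) by (rule null_homs_extend)
  obtain b where b: "b \<in> homs C z y" "g = b \<cdot> i"
    using assms(2) i(1,2) by (rule null_homs_extend)
  show ?thesis
    using null_homsI [OF i(3,2) Plus_homs [OF a(1) b(1)]] Plus_Comp [OF a(1) b(1) i(2)] a(2) b(2) by simp
qed

lemma null_homs_Neg:
  assumes "f \<in> null_homs C x y"
  shows "Neg C f \<in> null_homs C x y"
proof -
  obtain w a b where w: "injective C w" "a \<in> homs C x w" "b \<in> homs C w y" "f = b \<cdot> a"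
    using assms(1) by (rule null_homsE)
  show ?thesis
    using null_homsI [OF w(1,2) Neg_homs [OF w(3)]] Neg_Comp [OF w(2,3)] w(4) by simp
qed

lemma null_homs_Zero:
  assumes "x \<in> Obj C" "y \<in> Obj C"
  shows "Zero C x y \<in> null_homs C x y"
proof -
  obtain i z where i: "adm_mono C i" "i \<in> homs C x z" "injective C z"
    using assms(1) by (rule injective_envelope)
  have "z \<in> Obj C"
    using i homs_Obj by blast
  then show ?thesis
    using null_homsI [OF i(3,2) Zero_homs [OF _ assms(2)]] Zero_Comp [OF i(2) assms(2)] by simp
qed

lemma stable_class_eqI:
  assumes "f \<in> homs C x y" "h \<in> null_homs C x y"
  shows "stable_class C (Plus C f h) = stable_class C f"
proof -
  note h = null_homs_homs [OF assms(2)]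
  note n = null_homs_Neg [OF assms(2)]
  have "(\<exists>k\<in>null_homs C x y. g = Plus C (Plus C f h) k) \<longleftrightarrow> (\<exists>k\<in>null_homs C x y. g = Plus C f k)" for g
  proof
    assume "\<exists>k\<in>null_homs C x y. g = Plus C (Plus C f h) k"
    then show "\<exists>k\<in>null_homs C x y. g = Plus C f k"
      using Plus_assoc [OF assms(1) h] null_homs_Plus [OF assms(2)] null_homs_homs by metis
  next
    assume "\<exists>k\<in>null_homs C x y. g = Plus C f k"
    then obtain k where k: "k \<in> null_homs C x y" "g = Plus C f k"
      by blast
    note k' = null_homs_homs [OF k(1)]
    have "Plus C h (Plus C (Neg C h) k) = k"
      using Plus_assoc [OF h null_homs_homs [OF n] k'] Plus_Neg [OF h] Zero_Plus [OF k'] by simp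
    then have "g = Plus C (Plus C f h) (Plus C (Neg C h) k)"
      using Plus_assoc [OF assms(1) h null_homs_homs [OF null_homs_Plus [OF n k(1)]]] k(2) by simp
    then show "\<exists>k\<in>null_homs C x y. g = Plus C (Plus C f h) k"
      using null_homs_Plus [OF n k(1)] by blast
  qed
  then show ?thesis
    by (simp add: stable_class_eq [OF assms(1)] stable_class_eq [OF Plus_homs [OF assms(1) h]])
qed

lemma stable_class_self:
  assumes "f \<in> homs C x y"
  shows "f \<in> stable_class C f"
proof -
  have "Zero C x y \<in> null_homs C x y"
    using homs_Obj [OF assms] null_homs_Zero by blast
  moreover have "f = Plus C f (Zero C x y)"
    using Plus_Zero [OF assms] by simp
  ultimately show ?thesis
    using stable_class_eq [OF assms] by blast
qed

lemma stable_class_eq_iff: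
  assumes "f \<in> homs C x y" "g \<in> homs C x y"
  shows "stable_class C f = stable_class C g \<longleftrightarrow> (\<exists>h\<in>null_homs C x y. g = Plus C f h)"
proof
  assume "stable_class C f = stable_class C g"
  then have "g \<in> stable_class C f"
    using stable_class_self [OF assms(2)] by simp
  then show "\<exists>h\<in>null_homs C x y. g = Plus C f h"
    by (simp add: stable_class_eq [OF assms(1)])
qed (use stable_class_eqI [OF assms(1)] in auto)

lemma stable_class_mem:
  assumes "f \<in> homs C x y" "g \<in> stable_class C f"
  shows "g \<in> homs C x y" "stable_class C g = stable_class C f"
proof -
  obtain h where h: "h \<in> null_homs C x y" "g = Plus C f h"
    using assms(2) by (auto simp: stable_class_eq [OF assms(1)])
  show "g \<in> homs C x y"
    using h Plus_homs [OF assms(1) null_homs_homs] by simp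
  show "stable_class C g = stable_class C f"
    using h stable_class_eqI [OF assms(1)] by simp
qed

text \<open>The null maps form a two-sided ideal, so the two arguments may be changed one after the
  other.\<close>

lemma stable_class_Comp_cong:
  assumes "f \<in> homs C x y" "f' \<in> homs C x y" "g \<in> homs C y z" "g' \<in> homs C y z"
    and "stable_class C f = stable_class C f'" "stable_class C g = stable_class C g'"
  shows "stable_class C (g \<cdot> f) = stable_class C (g' \<cdot> f')"
proof -
  obtain h where h: "h \<in> null_homs C x y" "f' = Plus C f h"
    using assms stable_class_eq_iff by blast
  obtain k where k: "k \<in> null_homs C y z" "g' = Plus C g k"
    using assms stable_class_eq_iff by blast
  have "stable_class C (g \<cdot> f) = stable_class C (g \<cdot> f')"
    using stable_class_eqI [OF Comp_in [OF assms(1,3)] null_homs_Comp_left [OF h(1) assms(3)]]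
      Comp_Plus [OF assms(1) null_homs_homs [OF h(1)] assms(3)] h(2) by simp
  also have "\<dots> = stable_class C (g' \<cdot> f')"
    using stable_class_eqI [OF Comp_in [OF assms(2,3)] null_homs_Comp_right [OF k(1) assms(2)]]
      Plus_Comp [OF assms(3) null_homs_homs [OF k(1)] assms(2)] k(2) by simp
  finally show ?thesis .
qed

lemma stable_Obj [simp]: "Obj (stable_category C) = Obj C"
  by (simp add: stable_category_def)

lemma stable_Ide: "Ide (stable_category C) x = stable_class C (Ide C x)"
  by (simp add: stable_category_def)

lemma stable_Comp:
  assumes "f \<in> homs C x y" "g \<in> homs C y z"
  shows "stable_class C g \<cdot>\<^bsub>stable_category C\<^esub> stable_class C f = stable_class C (g \<cdot> f)"
proof -
  have *: "stable_class C (g' \<cdot> f') = stable_class C (g \<cdot> f)"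
    if "g' \<in> stable_class C g" "f' \<in> stable_class C f" for g' f'
    using stable_class_Comp_cong [OF _ assms(1) _ assms(2)] stable_class_mem [OF assms(1) that(2)]
      stable_class_mem [OF assms(2) that(1)] by simp
  \<comment> \<open>\<open>Comp\<close> is a union over all pairs of representatives. All members
    coincide, but the union equals that member only if there is at least one pair.\<close>
  have "stable_class C f \<noteq> {}" "stable_class C g \<noteq> {}"
    using stable_class_self [OF assms(1)] stable_class_self [OF assms(2)] by blast+
  then have "(\<Union>g'\<in>stable_class C g. \<Union>f'\<in>stable_class C f. stable_class C (g' \<cdot> f'))
      = stable_class C (g \<cdot> f)"
    by (simp add: * cong: SUP_cong_simp)
  then show ?thesis
    by (simp add: stable_category_def)
qed

lemma stable_class_homs:
  assumes "f \<in> homs C x y"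
  shows "stable_class C f \<in> homs (stable_category C) x y"
proof -
  have "Dom C ` stable_class C f = {x}" "Cod C ` stable_class C f = {y}"
    using stable_class_self [OF assms] stable_class_mem(1) [OF assms] by (auto simp: homs_def)
  then show ?thesis
    using assms by (auto simp: homs_def stable_category_def)
qed

lemma stable_homsE:
  assumes "c \<in> homs (stable_category C) x y"
  obtains f where "f \<in> homs C x y" "c = stable_class C f"
proof -
  obtain f where f: "f \<in> Arr C" "c = stable_class C f"
    using assms by (auto simp: homs_def stable_category_def)
  then show ?thesis
    using that stable_class_homs [OF Arr_homs [OF f(1)]] assms by (auto simp: homs_def)
qed

lemma category_stable: "category (stable_category C)"
proof
  let ?S = "stable_category C"
  have *: "Dom ?S f \<in> Obj C \<and> Cod ?S f \<in> Obj C" if "f \<in> Arr ?S" for f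
    using stable_homsE [OF Arr_homs [OF that]] homs_Obj by metis
  show "Dom ?S f \<in> Obj ?S" "Cod ?S f \<in> Obj ?S" if "f \<in> Arr ?S" for f
    using * [OF that] by auto
  show "Ide ?S x \<in> homs ?S x x" if "x \<in> Obj ?S" for x
    using that stable_class_homs [OF Ide_in] by (simp add: stable_Ide)
  show "g \<cdot>\<^bsub>?S\<^esub> f \<in> homs ?S x z" if "f \<in> homs ?S x y" "g \<in> homs ?S y z" for f g x y z
    using that by (elim stable_homsE) (simp add: stable_Comp stable_class_homs [OF Comp_in])
  show "f \<cdot>\<^bsub>?S\<^esub> Ide ?S x = f" if "f \<in> homs ?S x y" for f x y
    using that homs_Obj
    by (elim stable_homsE) (auto simp: stable_Ide stable_Comp [OF Ide_in] Comp_Ide)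
  show "Ide ?S y \<cdot>\<^bsub>?S\<^esub> f = f" if "f \<in> homs ?S x y" for f x y
    using that homs_Obj
    by (elim stable_homsE) (auto simp: stable_Ide stable_Comp [OF _ Ide_in] Ide_Comp)
  show "(h \<cdot>\<^bsub>?S\<^esub> g) \<cdot>\<^bsub>?S\<^esub> f = h \<cdot>\<^bsub>?S\<^esub> g \<cdot>\<^bsub>?S\<^esub> f"
    if c: "f \<in> homs ?S x y" "g \<in> homs ?S y z" "h \<in> homs ?S z t" for f g h x y z t
  proof -
    obtain f' g' h' where f: "f' \<in> homs C x y" "f = stable_class C f'"
      and g: "g' \<in> homs C y z" "g = stable_class C g'" and h: "h' \<in> homs C z t" "h = stable_class C h'"
      using stable_homsE [OF c(1)] stable_homsE [OF c(2)] stable_homsE [OF c(3)] by metis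
    show ?thesis
      using stable_Comp [OF f(1) g(1)] stable_Comp [OF g(1) h(1)] Comp_assoc [OF f(1) g(1) h(1)]
        stable_Comp [OF f(1) Comp_in [OF g(1) h(1)]] stable_Comp [OF Comp_in [OF f(1) g(1)] h(1)]
        f(2) g(2) h(2) by simp
  qed
qed

lemma stable_proj_simps [simp]:
  "omap (stable_proj C) x = x" "amap (stable_proj C) f = stable_class C f"
  by (simp_all add: stable_proj_def)

lemma functor_stable_proj: "is_functor C (stable_category C) (stable_proj C)"
  by (rule is_functorI) (simp_all add: stable_Ide stable_class_homs stable_Comp)

end


section \<open>Stable equivalences\<close>

context frobenius_category
begin

lemma stable_equivalences_iff:
  assumes "f \<in> homs C x y"
  shows "f \<in> stable_equivalences C \<longleftrightarrow> stable_class C f \<in> isos (stable_category C) x y"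
  using assms stable_class_homs [OF assms] by (auto simp: stable_equivalences_def isos_def homs_def)

lemma inverting_stable_proj:
  "inverting_functor C (stable_category C) (stable_proj C) (stable_equivalences C)"
proof -
  interpret S: category "stable_category C"
    by (rule category_stable)
  show ?thesis
    by unfold_locales (auto simp: functor_stable_proj stable_equivalences_iff intro: invertsI)
qed

text \<open>An arrow \<open>g\<close> representing the stable inverse turns the two inverse laws
  into equations of arrows with null error terms.\<close>

lemma stable_equivalenceE:
  assumes "f \<in> stable_equivalences C" "f \<in> homs C x y"
  obtains g h k where "g \<in> homs C y x" "h \<in> null_homs C x x" "k \<in> null_homs C y y"
    "Ide C x = Plus C (g \<cdot> f) h" "Ide C y = Plus C (f \<cdot> g) k"
proof -
  interpret S: category "stable_category C"
    by (rule category_stable)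
  have "stable_class C f \<in> isos (stable_category C) x y"
    using assms stable_equivalences_iff by blast
  then obtain c where "c \<in> homs (stable_category C) y x"
      "c \<cdot>\<^bsub>stable_category C\<^esub> stable_class C f = Ide (stable_category C) x"
      "stable_class C f \<cdot>\<^bsub>stable_category C\<^esub> c = Ide (stable_category C) y"
    using S.isos_iff by blast
  then obtain g where g: "g \<in> homs C y x" "stable_class C (g \<cdot> f) = stable_class C (Ide C x)"
      "stable_class C (f \<cdot> g) = stable_class C (Ide C y)"
    using assms(2) by (elim stable_homsE) (auto simp: stable_Comp stable_Ide)
  have xy: "x \<in> Obj C" "y \<in> Obj C"
    using assms homs_Obj by blast+
  show ?thesis
    using that [OF g(1)] stable_class_eq_iff [OF Comp_in [OF assms(2) g(1)] Ide_in [OF xy(1)]]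
      stable_class_eq_iff [OF Comp_in [OF g(1) assms(2)] Ide_in [OF xy(2)]] g(2,3) by blast
qed

text \<open>A stable inverse \<open>g\<close> is a section up to a null map \<open>k\<close>. As
  \<open>q\<close> is an admissible epimorphism, \<open>k\<close> lifts to \<open>b\<close>, and the
  corrected arrow \<open>g + b\<close> is a strict section.\<close>

lemma split_epi_of_stable_equivalence:
  assumes "q \<in> stable_equivalences C" "adm_epi C q" "q \<in> homs C x y"
  obtains s where "s \<in> homs C y x" "q \<cdot> s = Ide C y"
proof -
  obtain g k where g: "g \<in> homs C y x" "k \<in> null_homs C y y" "Ide C y = Plus C (q \<cdot> g) k"
    using assms by (elim stable_equivalenceE)
  obtain b where b: "b \<in> homs C y x" "k = q \<cdot> b"
    using g(2) assms(2,3) by (rule null_homs_lift)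
  show ?thesis
    using that [OF Plus_homs [OF g(1) b(1)]] Comp_Plus [OF g(1) b(1) assms(3)] g(3) b(2) by simp
qed

text \<open>Dual: the error term extends along the admissible monomorphism and corrects
  \<open>g\<close> to a strict retraction.\<close>

lemma split_mono_of_stable_equivalence:
  assumes "q \<in> stable_equivalences C" "adm_mono C q" "q \<in> homs C x y"
  obtains s where "s \<in> homs C y x" "s \<cdot> q = Ide C x"
proof -
  obtain g k where g: "g \<in> homs C y x" "k \<in> null_homs C x x" "Ide C x = Plus C (g \<cdot> q) k"
    using assms by (elim stable_equivalenceE)
  obtain b where b: "b \<in> homs C y x" "k = b \<cdot> q"
    using g(2) assms(2,3) by (rule null_homs_extend)
  show ?thesis
    using that [OF Plus_homs [OF g(1) b(1)]] Plus_Comp [OF g(1) b(1) assms(3)] g(3) b(2) by simp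
qed

text \<open>The projection \<open>r\<close> onto \<open>y\<close> is the stable inverse: a strict
  left inverse of \<open>b\<close>, and a right inverse up to a map through the injective
  summand.\<close>

lemma coproduct_injective:
  assumes c: "is_coproduct C a b" "a \<in> homs C x w" "b \<in> homs C y w" and inj: "injective C x"
  shows "b \<in> stable_equivalences C"
proof -
  interpret S: category "stable_category C"
    by (rule category_stable)
  have ob: "x \<in> Obj C" "y \<in> Obj C" "w \<in> Obj C"
    using c homs_Obj by blast+
  obtain r where r: "r \<in> homs C w y" "r \<cdot> a = Zero C x y" "r \<cdot> b = Ide C y"
    using coproductE [OF c Zero_homs [OF ob(1,2)] Ide_in [OF ob(2)]] .
  obtain s where s: "s \<in> homs C w x" "s \<cdot> a = Ide C x" "s \<cdot> b = Zero C y x"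
    using coproductE [OF c Ide_in [OF ob(1)] Zero_homs [OF ob(2,1)]] .
  note br = Comp_in [OF r(1) c(3)] and as = Comp_in [OF s(1) c(2)]
  \<comment> \<open>The biproduct identity, verified on the two injections. The summand
    \<open>a \<cdot> s\<close> factors through \<open>x\<close>, hence vanishes stably.\<close>
  have "Plus C (b \<cdot> r) (a \<cdot> s) = Ide C w"
  proof (rule coproduct_unique [OF c Plus_homs [OF br as] Ide_in [OF ob(3)]])
    show "Plus C (b \<cdot> r) (a \<cdot> s) \<cdot> a = Ide C w \<cdot> a"
      using Plus_Comp [OF br as c(2)] Comp_assoc [OF c(2) r(1) c(3)] Comp_assoc [OF c(2) s(1) c(2)]
        r(2) s(2) Comp_Zero [OF c(3) ob(1)] Comp_Ide [OF c(2)] Ide_Comp [OF c(2)] Zero_Plus [OF c(2)]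
      by simp
    show "Plus C (b \<cdot> r) (a \<cdot> s) \<cdot> b = Ide C w \<cdot> b"
      using Plus_Comp [OF br as c(3)] Comp_assoc [OF c(3) r(1) c(3)] Comp_assoc [OF c(3) s(1) c(2)]
        r(3) s(3) Comp_Zero [OF c(2) ob(2)] Comp_Ide [OF c(3)] Ide_Comp [OF c(3)] Plus_Zero [OF c(3)]
      by simp
  qed
  then have "stable_class C (b \<cdot> r) = stable_class C (Ide C w)"
    using stable_class_eqI [OF br null_homsI [OF inj s(1) c(2)]] by simp
  then have "stable_class C b \<in> isos (stable_category C) y w"
    using S.isosI [OF stable_class_homs [OF c(3)] stable_class_homs [OF r(1)]]
      stable_Comp [OF c(3) r(1)] stable_Comp [OF r(1) c(3)] r(3) stable_Ide by simp
  then show ?thesis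
    using stable_equivalences_iff [OF c(3)] by blast
qed

text \<open>Two-out-of-three in the stable category, where \<open>f\<close> and the identity are
  invertible.\<close>

lemma stable_equivalence_retraction:
  assumes "f \<in> homs C x y" "f \<in> stable_equivalences C" "g \<in> homs C y x" "g \<cdot> f = Ide C x"
  shows "g \<in> stable_equivalences C"
proof -
  interpret S: category "stable_category C"
    by (rule category_stable)
  have "x \<in> Obj C"
    using assms homs_Obj by blast
  then have "stable_class C g \<in> isos (stable_category C) y x"
    using S.isos_Comp_cancel_right [OF _ stable_class_homs [OF assms(3)]] assms(2,4)
      stable_equivalences_iff [OF assms(1)] stable_Comp [OF assms(1,3)] S.isos_Ide
    by (metis stable_Ide stable_Obj)
  then show ?thesis
    using stable_equivalences_iff [OF assms(3)] by blast
qed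

text \<open>If \<open>g = f + ba\<close> with \<open>a : x \<rightarrow> w\<close> and \<open>w\<close> injective, then \<open>f\<close> and \<open>g\<close> are the composites of
  \<open>(b, f) : w \<oplus> x \<rightarrow> y\<close> with two sections of the stable equivalence \<open>w \<oplus> x \<rightarrow> x\<close>.\<close>

lemma inverting_functor_stable_class:
  assumes "inverting_functor C D G (stable_equivalences C)"
    and "f \<in> homs C x y" "g \<in> homs C x y" "stable_class C f = stable_class C g"
  shows "amap G f = amap G g"
proof -
  interpret G: inverting_functor C D G "stable_equivalences C" by fact
  obtain h where h: "h \<in> null_homs C x y" "g = Plus C f h"
    using assms(2-4) stable_class_eq_iff by blast
  obtain w a b where w: "injective C w" "a \<in> homs C x w" "b \<in> homs C w y" "h = b \<cdot> a"
    using h(1) by (rule null_homsE)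
  have ob: "x \<in> Obj C" "y \<in> Obj C" "w \<in> Obj C"
    using w assms(2) homs_Obj by blast+
  then obtain j k where "Dom C j = w" "Dom C k = x" and c: "is_coproduct C j k"
    using has_coproducts by blast
  then obtain z where j: "j \<in> homs C w z" and k: "k \<in> homs C x z"
    by (auto simp: is_coproduct_def homs_def)
  obtain r where r: "r \<in> homs C z x" "r \<cdot> j = Zero C w x" "r \<cdot> k = Ide C x"
    using coproductE [OF c j k Zero_homs [OF ob(3,1)] Ide_in [OF ob(1)]] .
  obtain t where t: "t \<in> homs C z y" "t \<cdot> j = b" "t \<cdot> k = f"
    using coproductE [OF c j k w(3) assms(2)] .
  note ja = Comp_in [OF w(2) j]
  \<comment> \<open>The second section of \<open>r\<close>, beside \<open>k\<close>. The added
    \<open>j \<cdot> a\<close> is killed by \<open>r\<close>, whereas \<open>t\<close> turns it into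
    \<open>b \<cdot> a = h\<close>.\<close>
  define m where "m = Plus C k (j \<cdot> a)"
  have m: "m \<in> homs C x z"
    unfolding m_def using k ja by (rule Plus_homs)
  have "r \<cdot> m = r \<cdot> k"
    unfolding m_def using Comp_Plus [OF k ja r(1)] Comp_assoc [OF w(2) j r(1)] r(2,3)
      Zero_Comp [OF w(2) ob(1)] Plus_Zero [OF Ide_in [OF ob(1)]] by simp
  then have "amap G r \<cdot>\<^bsub>D\<^esub> amap G m = amap G r \<cdot>\<^bsub>D\<^esub> amap G k"
    using functor_Comp [OF G.fun_G m r(1)] functor_Comp [OF G.fun_G k r(1)] by simp
  then have "amap G m = amap G k"
    using G.D.iso_cancel_left [OF invertsD [OF G.inv_G stable_equivalence_retraction
          [OF k coproduct_injective [OF c j k w(1)] r(1,3)] r(1)]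
        functor_homs [OF G.fun_G m] functor_homs [OF G.fun_G k]] by blast
  moreover have "g = t \<cdot> m"
    unfolding m_def using Comp_Plus [OF k ja t(1)] Comp_assoc [OF w(2) j t(1)] t(2,3) w(4) h(2) by simp
  ultimately show ?thesis
    using functor_Comp [OF G.fun_G m t(1)] functor_Comp [OF G.fun_G k t(1)] t(3) by simp
qed

text \<open>The universal property of the stable category for functors inverting stable
  equivalences. \<open>K\<close> is described by its values at arbitrarily picked representatives
  because that is how \<open>stable_to_Ho\<close> is given.\<close>

lemma functor_stable_some:
  assumes G: "inverting_functor C D G (stable_equivalences C)"
    and K: "\<And>x. omap K x = omap G x" "\<And>c. amap K c = amap G (SOME f. f \<in> c)"
  shows "f \<in> homs C x y \<Longrightarrow> amap K (stable_class C f) = amap G f"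
    and "is_functor (stable_category C) D K"
proof -
  interpret G: inverting_functor C D G "stable_equivalences C" by fact
  show *: "amap K (stable_class C f) = amap G f" if f: "f \<in> homs C x y" for f x y
  proof -
    have "(SOME g. g \<in> stable_class C f) \<in> stable_class C f"
      using stable_class_self [OF f] by (rule someI)
    then show ?thesis
      using stable_class_mem [OF f] inverting_functor_stable_class [OF G _ f] K(2) by metis
  qed
  show "is_functor (stable_category C) D K"
  proof (rule is_functorI)
    show "amap K (Ide (stable_category C) x) = Ide D (omap K x)" if "x \<in> Obj (stable_category C)" for x
      using that * [OF Ide_in] functor_Ide [OF G.fun_G] K(1) by (simp add: stable_Ide)
    show "amap K f \<in> homs D (omap K x) (omap K y)" if "f \<in> homs (stable_category C) x y" for f x y
      using that functor_homs [OF G.fun_G] by (elim stable_homsE) (simp add: * K(1))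
    show "amap K (g \<cdot>\<^bsub>stable_category C\<^esub> f) = amap K g \<cdot>\<^bsub>D\<^esub> amap K f"
      if "f \<in> homs (stable_category C) x y" "g \<in> homs (stable_category C) y z" for f g x y z
      using that by (elim stable_homsE)
        (simp add: stable_Comp * [OF Comp_in] * functor_Comp [OF G.fun_G])
  qed (use functor_Obj [OF G.fun_G] K(1) in simp)
qed

section \<open>The identification of the stable category with the homotopy category\<close>

lemma Weq_canonical [simp]: "Weq (canonical_model C) = stable_equivalences C"
  by (simp add: canonical_model_def)

lemma inverting_loc_functor: "inverting_functor C (localization C W) (loc_functor C W) W"
proof -
  interpret L: category "localization C W"
    by (rule category_localization)
  show ?thesis
    by unfold_locales (simp_all add: functor_loc_functor invertsI loc_Bwd(1))
qed

lemma functor_stable_to_Ho: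
  shows stable_to_Ho_class: "f \<in> homs C x y \<Longrightarrow>
      amap (stable_to_Ho C) (stable_class C f) = amap (loc_functor C (stable_equivalences C)) f"
    and "is_functor (stable_category C) (localization C (stable_equivalences C)) (stable_to_Ho C)"
  using functor_stable_some [OF inverting_loc_functor, of "stable_to_Ho C"]
  by (simp_all add: stable_to_Ho_def Ho_functor_def)

lemma stable_to_Ho_omap [simp]: "omap (stable_to_Ho C) x = x"
  by (simp add: stable_to_Ho_def)

lemma functor_Ho_to_stable:
  shows Ho_to_stable_loc_functor: "f \<in> homs C x y \<Longrightarrow>
      amap (Ho_to_stable C) (amap (loc_functor C (stable_equivalences C)) f) = stable_class C f"
    and "is_functor (localization C (stable_equivalences C)) (stable_category C) (Ho_to_stable C)"
  using inverting_functor.loc_induced_loc_functor [OF inverting_stable_proj]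
    inverting_functor.functor_loc_induced [OF inverting_stable_proj]
  by (simp_all add: Ho_to_stable_def)

lemma Ho_to_stable_omap [simp]: "omap (Ho_to_stable C) x = x"
  by (simp add: Ho_to_stable_def loc_induced_def)

end


section \<open>Derived functors along split replacements\<close>

lemma inverting_functor_conjugate:
  assumes "inverting_functor C D G W" "is_functor C D K" "natural_iso C D K G \<theta>"
  shows "inverting_functor C D K W"
proof -
  interpret G: inverting_functor C D G W by fact
  show ?thesis
    using natural_iso_preserves_isos [OF G.C.category_axioms G.D.category_axioms G.fun_G assms(2,3) _
        invertsD [OF G.inv_G]] assms(2)
    by unfold_locales (auto intro: invertsI)
qed

text \<open>A section of the replacement map provides a lift of each arrow, and the image of a lift
  is forced because the image of \<open>q y\<close> is invertible. So the definite description is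
  meaningful, and the derived functor is the strict one conjugated by the images of the replacement
  maps.\<close>

lemma left_derived_natural_iso:
  assumes \<Gamma>: "inverting_functor C (Ho D N) (Ho_functor D N \<circ>\<^sub>F G) (Weq M)"
    and q: "\<And>x. x \<in> Obj C \<Longrightarrow> q x \<in> homs C (Q x) x" "\<And>x. x \<in> Obj C \<Longrightarrow> q x \<in> Weq M"
    and split: "\<And>x. x \<in> Obj C \<Longrightarrow> \<exists>s\<in>homs C x (Q x). q x \<cdot>\<^bsub>C\<^esub> s = Ide C x"
  shows "is_functor (Ho C M) (Ho D N) (left_derived C M D N Q q G)"
    and "natural_iso (Ho C M) (Ho D N) (left_derived C M D N Q q G)
           (loc_induced C (Ho D N) (Ho_functor D N \<circ>\<^sub>F G)) (\<lambda>x. amap (Ho_functor D N \<circ>\<^sub>F G) (q x))"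
proof -
  let ?\<Gamma> = "Ho_functor D N \<circ>\<^sub>F G"
  interpret \<Gamma>: inverting_functor C "Ho D N" ?\<Gamma> "Weq M" by fact
  define K where "K = \<lparr>omap = \<lambda>x. omap G (Q x),
      amap = (\<lambda>f. THE h. \<exists>f'\<in>homs C (Q (Dom C f)) (Q (Cod C f)).
                 q (Cod C f) \<cdot>\<^bsub>C\<^esub> f' = f \<cdot>\<^bsub>C\<^esub> q (Dom C f) \<and> h = amap (Ho_functor D N) (amap G f'))\<rparr>"
  have L: "left_derived C M D N Q q G = loc_induced C (Ho D N) K"
    by (simp add: left_derived_def K_def)
  have iso: "amap ?\<Gamma> (q x) \<in> isos (Ho D N) (omap K x) (omap ?\<Gamma> x)" if "x \<in> Obj C" for x
    using invertsD [OF \<Gamma>.inv_G q(2,1)] that by (simp add: K_def Ho_functor_def loc_functor_def)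
  have K: "amap K f \<in> homs (Ho D N) (omap K x) (omap K y) \<and>
      amap ?\<Gamma> (q y) \<cdot>\<^bsub>Ho D N\<^esub> amap K f = amap ?\<Gamma> f \<cdot>\<^bsub>Ho D N\<^esub> amap ?\<Gamma> (q x)"
    if f: "f \<in> homs C x y" for f x y
  proof -
    have xy: "x \<in> Obj C" "y \<in> Obj C"
      using \<Gamma>.C.homs_Obj [OF f] by blast+
    note qx = q(1) [OF xy(1)] and qy = q(1) [OF xy(2)]
    obtain s where s: "s \<in> homs C y (Q y)" "q y \<cdot>\<^bsub>C\<^esub> s = Ide C y"
      using split xy by blast
    note fq = \<Gamma>.C.Comp_in [OF qx f]
    \<comment> \<open>A lift of \<open>f\<close>, since \<open>s\<close> is a section of
      \<open>q y\<close>.\<close>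
    define g where "g = s \<cdot>\<^bsub>C\<^esub> f \<cdot>\<^bsub>C\<^esub> q x"
    have g: "g \<in> homs C (Q x) (Q y)" "q y \<cdot>\<^bsub>C\<^esub> g = f \<cdot>\<^bsub>C\<^esub> q x"
      unfolding g_def using \<Gamma>.C.Comp_in [OF fq s(1)] \<Gamma>.C.Comp_assoc [OF fq s(1) qy] s(2)
        \<Gamma>.C.Ide_Comp [OF fq] by simp_all
    have lift: "amap ?\<Gamma> (q y) \<cdot>\<^bsub>Ho D N\<^esub> amap ?\<Gamma> h = amap ?\<Gamma> f \<cdot>\<^bsub>Ho D N\<^esub> amap ?\<Gamma> (q x)"
      if "h \<in> homs C (Q x) (Q y)" "q y \<cdot>\<^bsub>C\<^esub> h = f \<cdot>\<^bsub>C\<^esub> q x" for h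
      using functor_Comp [OF \<Gamma>.fun_G that(1) qy] functor_Comp [OF \<Gamma>.fun_G qx f] that(2) by simp
    have "amap K f = (THE h. \<exists>f'\<in>homs C (Q x) (Q y). q y \<cdot>\<^bsub>C\<^esub> f' = f \<cdot>\<^bsub>C\<^esub> q x \<and> h = amap ?\<Gamma> f')"
      using homsD [OF f] by (simp add: K_def)
    also have "\<dots> = amap ?\<Gamma> g"
    \<comment> \<open>The images of two lifts agree after composition with the isomorphism
      \<open>amap ?\<Gamma> (q y)\<close>, hence they agree.\<close>
    proof (rule the_equality)
      fix h assume "\<exists>f'\<in>homs C (Q x) (Q y). q y \<cdot>\<^bsub>C\<^esub> f' = f \<cdot>\<^bsub>C\<^esub> q x \<and> h = amap ?\<Gamma> f'"
      then obtain f' where f': "f' \<in> homs C (Q x) (Q y)" "q y \<cdot>\<^bsub>C\<^esub> f' = f \<cdot>\<^bsub>C\<^esub> q x" "h = amap ?\<Gamma> f'"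
        by blast
      then show "h = amap ?\<Gamma> g"
        using \<Gamma>.D.iso_cancel_left [OF invertsD [OF \<Gamma>.inv_G q(2) [OF xy(2)] qy]
            functor_homs [OF \<Gamma>.fun_G f'(1)] functor_homs [OF \<Gamma>.fun_G g(1)]]
          lift [OF f'(1,2)] lift [OF g] by simp
    qed (use g in blast)
    finally show ?thesis
      using functor_homs [OF \<Gamma>.fun_G g(1)] lift [OF g] by (simp add: K_def Ho_functor_def loc_functor_def)
  qed
  have KG: "is_functor C (Ho D N) K" "natural_iso C (Ho D N) K ?\<Gamma> (\<lambda>x. amap ?\<Gamma> (q x))"
    using functor_conjugate [OF \<Gamma>.C.category_axioms \<Gamma>.D.category_axioms \<Gamma>.fun_G iso
        conjunct1 [OF K] conjunct2 [OF K]] by blast+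
  have "inverting_functor C (Ho D N) K (Weq M)"
    using \<Gamma> KG by (rule inverting_functor_conjugate)
  then show "is_functor (Ho C M) (Ho D N) (left_derived C M D N Q q G)"
    "natural_iso (Ho C M) (Ho D N) (left_derived C M D N Q q G)
      (loc_induced C (Ho D N) ?\<Gamma>) (\<lambda>x. amap ?\<Gamma> (q x))"
    unfolding L Ho_def [of C M]
    using inverting_functor.functor_loc_induced natural_iso_loc_induced [OF _ \<Gamma> KG(2)] by blast+
qed

text \<open>Dual, with a retraction of \<open>r x\<close> in place of a section of
  \<open>q y\<close>. The replacement maps now start at the object itself, so the comparison towards
  the strict functor consists of the inverses of their images.\<close>

lemma right_derived_natural_iso:
  assumes \<Gamma>: "inverting_functor C (Ho D N) (Ho_functor D N \<circ>\<^sub>F G) (Weq M)"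
    and r: "\<And>x. x \<in> Obj C \<Longrightarrow> r x \<in> homs C x (R x)" "\<And>x. x \<in> Obj C \<Longrightarrow> r x \<in> Weq M"
    and split: "\<And>x. x \<in> Obj C \<Longrightarrow> \<exists>s\<in>homs C (R x) x. s \<cdot>\<^bsub>C\<^esub> r x = Ide C x"
  shows "is_functor (Ho C M) (Ho D N) (right_derived C M D N R r G)"
    and "natural_iso (Ho C M) (Ho D N) (right_derived C M D N R r G)
           (loc_induced C (Ho D N) (Ho_functor D N \<circ>\<^sub>F G))
           (\<lambda>x. inv_arr (Ho D N) (amap (Ho_functor D N \<circ>\<^sub>F G) (r x)))"
proof -
  let ?\<Gamma> = "Ho_functor D N \<circ>\<^sub>F G"
  interpret \<Gamma>: inverting_functor C "Ho D N" ?\<Gamma> "Weq M" by fact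
  define K where "K = \<lparr>omap = \<lambda>x. omap G (R x),
      amap = (\<lambda>f. THE h. \<exists>f'\<in>homs C (R (Dom C f)) (R (Cod C f)).
                 f' \<cdot>\<^bsub>C\<^esub> r (Dom C f) = r (Cod C f) \<cdot>\<^bsub>C\<^esub> f \<and> h = amap (Ho_functor D N) (amap G f'))\<rparr>"
  have R: "right_derived C M D N R r G = loc_induced C (Ho D N) K"
    by (simp add: right_derived_def K_def)
  have iso: "amap ?\<Gamma> (r x) \<in> isos (Ho D N) (omap ?\<Gamma> x) (omap K x)" if "x \<in> Obj C" for x
    using invertsD [OF \<Gamma>.inv_G r(2,1)] that by (simp add: K_def Ho_functor_def loc_functor_def)
  have K: "amap K f \<in> homs (Ho D N) (omap K x) (omap K y) \<and>
      amap K f \<cdot>\<^bsub>Ho D N\<^esub> amap ?\<Gamma> (r x) = amap ?\<Gamma> (r y) \<cdot>\<^bsub>Ho D N\<^esub> amap ?\<Gamma> f"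
    if f: "f \<in> homs C x y" for f x y
  proof -
    have xy: "x \<in> Obj C" "y \<in> Obj C"
      using \<Gamma>.C.homs_Obj [OF f] by blast+
    note rx = r(1) [OF xy(1)] and ry = r(1) [OF xy(2)]
    obtain s where s: "s \<in> homs C (R x) x" "s \<cdot>\<^bsub>C\<^esub> r x = Ide C x"
      using split xy by blast
    note rf = \<Gamma>.C.Comp_in [OF f ry]
    define g where "g = (r y \<cdot>\<^bsub>C\<^esub> f) \<cdot>\<^bsub>C\<^esub> s"
    have g: "g \<in> homs C (R x) (R y)" "g \<cdot>\<^bsub>C\<^esub> r x = r y \<cdot>\<^bsub>C\<^esub> f"
      unfolding g_def using \<Gamma>.C.Comp_in [OF s(1) rf] \<Gamma>.C.Comp_assoc [OF rx s(1) rf] s(2)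
        \<Gamma>.C.Comp_Ide [OF rf] by simp_all
    have lift: "amap ?\<Gamma> h \<cdot>\<^bsub>Ho D N\<^esub> amap ?\<Gamma> (r x) = amap ?\<Gamma> (r y) \<cdot>\<^bsub>Ho D N\<^esub> amap ?\<Gamma> f"
      if "h \<in> homs C (R x) (R y)" "h \<cdot>\<^bsub>C\<^esub> r x = r y \<cdot>\<^bsub>C\<^esub> f" for h
      using functor_Comp [OF \<Gamma>.fun_G rx that(1)] functor_Comp [OF \<Gamma>.fun_G f ry] that(2) by simp
    have "amap K f = (THE h. \<exists>f'\<in>homs C (R x) (R y). f' \<cdot>\<^bsub>C\<^esub> r x = r y \<cdot>\<^bsub>C\<^esub> f \<and> h = amap ?\<Gamma> f')"
      using homsD [OF f] by (simp add: K_def)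
    also have "\<dots> = amap ?\<Gamma> g"
    proof (rule the_equality)
      fix h assume "\<exists>f'\<in>homs C (R x) (R y). f' \<cdot>\<^bsub>C\<^esub> r x = r y \<cdot>\<^bsub>C\<^esub> f \<and> h = amap ?\<Gamma> f'"
      then obtain f' where f': "f' \<in> homs C (R x) (R y)" "f' \<cdot>\<^bsub>C\<^esub> r x = r y \<cdot>\<^bsub>C\<^esub> f" "h = amap ?\<Gamma> f'"
        by blast
      then show "h = amap ?\<Gamma> g"
        using \<Gamma>.D.iso_cancel_right [OF invertsD [OF \<Gamma>.inv_G r(2) [OF xy(1)] rx]
            functor_homs [OF \<Gamma>.fun_G f'(1)] functor_homs [OF \<Gamma>.fun_G g(1)]]
          lift [OF f'(1,2)] lift [OF g] by simp
    qed (use g in blast)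
    finally show ?thesis
      using functor_homs [OF \<Gamma>.fun_G g(1)] lift [OF g] by (simp add: K_def Ho_functor_def loc_functor_def)
  qed
  have nat: "inv_arr (Ho D N) (amap ?\<Gamma> (r y)) \<cdot>\<^bsub>Ho D N\<^esub> amap K f
      = amap ?\<Gamma> f \<cdot>\<^bsub>Ho D N\<^esub> inv_arr (Ho D N) (amap ?\<Gamma> (r x))" if f: "f \<in> homs C x y" for f x y
    using natural_inverse_arrow [OF \<Gamma>.D.category_axioms iso iso functor_homs [OF \<Gamma>.fun_G f]
        conjunct1 [OF K [OF f]] conjunct2 [OF K [OF f]]] \<Gamma>.C.homs_Obj [OF f] by simp
  have KG: "is_functor C (Ho D N) K"
      "natural_iso C (Ho D N) K ?\<Gamma> (\<lambda>x. inv_arr (Ho D N) (amap ?\<Gamma> (r x)))"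
    using functor_conjugate [OF \<Gamma>.C.category_axioms \<Gamma>.D.category_axioms \<Gamma>.fun_G
        \<Gamma>.D.isos_inv_arr [OF iso] conjunct1 [OF K] nat] by blast+
  have "inverting_functor C (Ho D N) K (Weq M)"
    using \<Gamma> KG by (rule inverting_functor_conjugate)
  then show "is_functor (Ho C M) (Ho D N) (right_derived C M D N R r G)"
    "natural_iso (Ho C M) (Ho D N) (right_derived C M D N R r G)
      (loc_induced C (Ho D N) ?\<Gamma>) (\<lambda>x. inv_arr (Ho D N) (amap ?\<Gamma> (r x)))"
    unfolding R Ho_def [of C M]
    using inverting_functor.functor_loc_induced natural_iso_loc_induced [OF _ \<Gamma> KG(2)] by blast+
qed


section \<open>The coslice category\<close>

context category
begin

lemma coslice_homsI:
  assumes "f \<in> homs C A x" "\<alpha> \<in> homs C x y"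
  shows "(f, \<alpha> \<cdot> f, \<alpha>) \<in> homs (coslice C A) f (\<alpha> \<cdot> f)"
  using assms Comp_in [OF assms] by (auto simp: homs_def coslice_def)

lemma coslice_homsE:
  assumes "c \<in> homs (coslice C A) f f'"
  obtains x y \<alpha> where "f \<in> homs C A x" "f' \<in> homs C A y" "\<alpha> \<in> homs C x y" "\<alpha> \<cdot> f = f'" "c = (f, f', \<alpha>)"
  using assms by (auto simp: homs_def coslice_def)

lemma coslice_Obj: "X \<in> Obj (coslice C A) \<longleftrightarrow> X \<in> homs C A (Cod C X)"
  by (auto simp: homs_def coslice_def)

lemma coslice_Comp: "(g, g', \<beta>) \<cdot>\<^bsub>coslice C A\<^esub> (f, f', \<alpha>) = (f, g', \<beta> \<cdot> \<alpha>)"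
  by (simp add: coslice_def)

lemma coslice_Ide: "Ide (coslice C A) X = (X, X, Ide C (Cod C X))"
  by (simp add: coslice_def)

lemma category_coslice: "category (coslice C A)"
proof
  let ?S = "coslice C A"
  show "Dom ?S f \<in> Obj ?S" "Cod ?S f \<in> Obj ?S" if "f \<in> Arr ?S" for f
    using that by (auto simp: coslice_def)
  show "Ide ?S X \<in> homs ?S X X" if "X \<in> Obj ?S" for X
  proof -
    have "X \<in> homs C A (Cod C X)"
      using that coslice_Obj by blast
    then show ?thesis
      using coslice_homsI [OF _ Ide_in, of X A "Cod C X"] homs_Obj Ide_Comp by (simp add: coslice_Ide)
  qed
  show "g \<cdot>\<^bsub>?S\<^esub> f \<in> homs ?S x z" if f: "f \<in> homs ?S x y" and g: "g \<in> homs ?S y z" for f g x y z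
  proof -
    obtain a b \<alpha> where fa: "x \<in> homs C A a" "y \<in> homs C A b" "\<alpha> \<in> homs C a b" "\<alpha> \<cdot> x = y" "f = (x, y, \<alpha>)"
      using f by (rule coslice_homsE)
    obtain b' c \<beta> where gb: "y \<in> homs C A b'" "z \<in> homs C A c" "\<beta> \<in> homs C b' c" "\<beta> \<cdot> y = z" "g = (y, z, \<beta>)"
      using g by (rule coslice_homsE)
    have b: "\<beta> \<in> homs C b c"
      using gb fa by (simp add: homs_def)
    show ?thesis
      using coslice_homsI [OF fa(1) Comp_in [OF fa(3) b]] Comp_assoc [OF fa(1,3) b] fa(4,5) gb(4,5)
      by (simp add: coslice_Comp)
  qed
  show "f \<cdot>\<^bsub>?S\<^esub> Ide ?S x = f" if "f \<in> homs ?S x y" for f x y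
    using that
  proof (rule coslice_homsE)
    fix a b \<alpha> assume x: "x \<in> homs C A a" and \<alpha>: "\<alpha> \<in> homs C a b" and f: "f = (x, y, \<alpha>)"
    show ?thesis
      using homsD [OF x] Comp_Ide [OF \<alpha>] f by (simp add: coslice_Comp coslice_Ide)
  qed
  show "Ide ?S y \<cdot>\<^bsub>?S\<^esub> f = f" if "f \<in> homs ?S x y" for f x y
    using that
  proof (rule coslice_homsE)
    fix a b \<alpha> assume y: "y \<in> homs C A b" and \<alpha>: "\<alpha> \<in> homs C a b" and f: "f = (x, y, \<alpha>)"
    show ?thesis
      using homsD [OF y] Ide_Comp [OF \<alpha>] f by (simp add: coslice_Comp coslice_Ide)
  qed
  show "(h \<cdot>\<^bsub>?S\<^esub> g) \<cdot>\<^bsub>?S\<^esub> f = h \<cdot>\<^bsub>?S\<^esub> g \<cdot>\<^bsub>?S\<^esub> f"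
    if f: "f \<in> homs ?S x y" and g: "g \<in> homs ?S y z" and h: "h \<in> homs ?S z t" for f g h x y z t
  proof -
    obtain a b \<alpha> where fa: "y \<in> homs C A b" "\<alpha> \<in> homs C a b" "f = (x, y, \<alpha>)"
      using f by (rule coslice_homsE)
    obtain b' c \<beta> where gb: "y \<in> homs C A b'" "z \<in> homs C A c" "\<beta> \<in> homs C b' c" "g = (y, z, \<beta>)"
      using g by (rule coslice_homsE)
    obtain c' d \<gamma> where hc: "z \<in> homs C A c'" "\<gamma> \<in> homs C c' d" "h = (z, t, \<gamma>)"
      using h by (rule coslice_homsE)
    have "\<beta> \<in> homs C b c" "\<gamma> \<in> homs C c d"
      using fa gb hc by (simp_all add: homs_def)
    then show ?thesis
      using Comp_assoc [OF fa(2)] fa(3) gb(4) hc(3) by (simp add: coslice_Comp)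
  qed
qed

lemma forgetful_simps [simp]:
  "omap (forgetful C) X = Cod C X" "amap (forgetful C) (f, f', \<alpha>) = \<alpha>"
  by (simp_all add: forgetful_def)

lemma functor_forgetful: "is_functor (coslice C A) C (forgetful C)"
proof (rule is_functorI)
  show "amap (forgetful C) f \<in> homs C (omap (forgetful C) x) (omap (forgetful C) y)"
    if "f \<in> homs (coslice C A) x y" for f x y
    using that by (elim coslice_homsE) (auto simp: homs_def)
  show "amap (forgetful C) (g \<cdot>\<^bsub>coslice C A\<^esub> f) = amap (forgetful C) g \<cdot> amap (forgetful C) f"
    if "f \<in> homs (coslice C A) x y" "g \<in> homs (coslice C A) y z" for f g x y z
    using that by (elim coslice_homsE) (auto simp: coslice_Comp)
qed (auto simp: coslice_Obj coslice_Ide homs_Obj)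

end

lemma Weq_coslice: "c \<in> homs (coslice C A) X Y \<Longrightarrow>
    c \<in> Weq (coslice_model C A M) \<longleftrightarrow> amap (forgetful C) c \<in> Weq M"
  by (auto simp: coslice_model_def homs_def)


section \<open>The adjunction between the stable category and the homotopy category of the coslice\<close>

locale frobenius_coslice = frobenius_category C
  for C :: "('o, 'm, 'e) exact_cat_scheme" (structure) +
  fixes A :: 'o and u v :: "'o \<Rightarrow> 'm"
  assumes inj_A: "injective C A" and uv: "coproduct_choice C A u v"
begin

abbreviation "W \<equiv> stable_equivalences C"
abbreviation "WA \<equiv> Weq (coslice_canonical C A)"
abbreviation "St \<equiv> stable_category C"
abbreviation "H \<equiv> localization (coslice C A) WA"
abbreviation "\<Gamma> \<equiv> loc_functor (coslice C A) WA \<circ>\<^sub>F zero_shriek C u v"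
abbreviation "\<Delta> \<equiv> loc_functor C W \<circ>\<^sub>F forgetful C"

lemma H_eq: "Ho_coslice C A = H"
  by (simp add: Ho_def)

sublocale S: category St
  by (rule category_stable)

sublocale K: category "coslice C A"
  by (rule category_coslice)

sublocale H: category H
  by (rule K.category_localization)

section \<open>The functor \<open>zero_shriek\<close> on arrows\<close>

lemma coproduct:
  assumes "x \<in> Obj C"
  shows "is_coproduct C (u x) (v x)" "u x \<in> homs C A (Cod C (u x))" "v x \<in> homs C x (Cod C (u x))"
proof -
  have c: "Dom C (u x) = A" "Dom C (v x) = x" "is_coproduct C (u x) (v x)"
    using assms uv by (simp_all add: coproduct_choice_def)
  moreover have "u x \<in> Arr C" "v x \<in> Arr C" "Cod C (v x) = Cod C (u x)"
    using c(3) by (simp_all add: is_coproduct_def)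
  ultimately show "is_coproduct C (u x) (v x)" "u x \<in> homs C A (Cod C (u x))" "v x \<in> homs C x (Cod C (u x))"
    by (simp_all add: homsI)
qed

text \<open>The complement of \<open>x\<close> in the coproduct is \<open>A\<close>; this is the
  point at which the injectivity of \<open>A\<close> enters.\<close>

lemma v_stable_equivalence: "x \<in> Obj C \<Longrightarrow> v x \<in> W"
  using coproduct_injective [OF coproduct inj_A] .

lemma plus_id:
  assumes "s \<in> homs C x y"
  shows "plus_id C u v s \<in> homs C (Cod C (u x)) (Cod C (u y))"
    "plus_id C u v s \<cdot> u x = u y" "plus_id C u v s \<cdot> v x = v y \<cdot> s"
proof -
  have xy: "x \<in> Obj C" "y \<in> Obj C"
    using homs_Obj [OF assms] by blast+
  have "\<exists>!t. t \<in> homs C (Cod C (u x)) (Cod C (u y)) \<and> t \<cdot> u x = u y \<and> t \<cdot> v x = v y \<cdot> s"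
    using coproduct_ex1 [OF coproduct [OF xy(1)] coproduct(2) [OF xy(2)]
        Comp_in [OF assms coproduct(3) [OF xy(2)]]] .
  from theI' [OF this] show "plus_id C u v s \<in> homs C (Cod C (u x)) (Cod C (u y))"
    "plus_id C u v s \<cdot> u x = u y" "plus_id C u v s \<cdot> v x = v y \<cdot> s"
    using homsD [OF assms] by (simp_all add: plus_id_def)
qed

lemma plus_id_eqI:
  assumes "s \<in> homs C x y" "t \<in> homs C (Cod C (u x)) (Cod C (u y))" "t \<cdot> u x = u y" "t \<cdot> v x = v y \<cdot> s"
  shows "plus_id C u v s = t"
proof -
  have "x \<in> Obj C"
    using homs_Obj [OF assms(1)] by blast
  then show ?thesis
    using coproduct_unique [OF coproduct plus_id(1) [OF assms(1)] assms(2)] plus_id [OF assms(1)] assms(3,4)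
    by simp
qed

lemma zero_shriek_omap [simp]: "omap (zero_shriek C u v) x = u x"
  by (simp add: zero_shriek_def)

lemma zero_shriek_amap:
  "s \<in> homs C x y \<Longrightarrow> amap (zero_shriek C u v) s = (u x, u y, plus_id C u v s)"
  by (simp add: zero_shriek_def homs_def)

lemma functor_zero_shriek: "is_functor C (coslice C A) (zero_shriek C u v)"
proof (rule is_functorI)
  show "omap (zero_shriek C u v) x \<in> Obj (coslice C A)" if "x \<in> Obj C" for x
    using coproduct [OF that] by (simp add: coslice_Obj)
  show "amap (zero_shriek C u v) (Ide C x) = Ide (coslice C A) (omap (zero_shriek C u v) x)"
    if x: "x \<in> Obj C" for x
  proof -
    note c = coproduct [OF x]
    have "Cod C (u x) \<in> Obj C"
      using homs_Obj [OF c(2)] by blast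
    then have "plus_id C u v (Ide C x) = Ide C (Cod C (u x))"
      using plus_id_eqI [OF Ide_in [OF x] Ide_in] Ide_Comp [OF c(2)] Ide_Comp [OF c(3)] Comp_Ide [OF c(3)]
      by simp
    then show ?thesis
      using zero_shriek_amap [OF Ide_in [OF x]] by (simp add: coslice_Ide)
  qed
  show "amap (zero_shriek C u v) f \<in> homs (coslice C A) (omap (zero_shriek C u v) x) (omap (zero_shriek C u v) y)"
    if f: "f \<in> homs C x y" for f x y
  proof -
    have "x \<in> Obj C"
      using homs_Obj [OF f] by blast
    then show ?thesis
      using coslice_homsI [OF coproduct(2) plus_id(1) [OF f]] plus_id(2) [OF f]
      by (simp add: zero_shriek_amap [OF f])
  qed
  show "amap (zero_shriek C u v) (g \<cdot> f)
      = amap (zero_shriek C u v) g \<cdot>\<^bsub>coslice C A\<^esub> amap (zero_shriek C u v) f"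
    if f: "f \<in> homs C x y" and g: "g \<in> homs C y z" for f g x y z
  proof -
    have ob: "x \<in> Obj C" "y \<in> Obj C" "z \<in> Obj C"
      using homs_Obj [OF f] homs_Obj [OF g] by blast+
    note pf = plus_id [OF f] and pg = plus_id [OF g]
    have "plus_id C u v (g \<cdot> f) = plus_id C u v g \<cdot> plus_id C u v f"
      using plus_id_eqI [OF Comp_in [OF f g] Comp_in [OF pf(1) pg(1)]]
        Comp_assoc [OF coproduct(2) [OF ob(1)] pf(1) pg(1)]
        Comp_assoc [OF coproduct(3) [OF ob(1)] pf(1) pg(1)]
        Comp_assoc [OF f coproduct(3) [OF ob(2)] pg(1)] Comp_assoc [OF f g coproduct(3) [OF ob(3)]]
        pf(2,3) pg(2,3) by simp
    then show ?thesis
      by (simp add: zero_shriek_amap [OF f] zero_shriek_amap [OF g] zero_shriek_amap [OF Comp_in [OF f g]]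
          coslice_Comp)
  qed
qed

text \<open>Two-out-of-three in the square
  \<open>plus_id C u v s \<cdot> v x = v y \<cdot> s\<close>.\<close>

lemma plus_id_stable_equivalence:
  assumes "s \<in> homs C x y" "s \<in> W"
  shows "plus_id C u v s \<in> W"
proof -
  note p = plus_id [OF assms(1)]
  have ob: "x \<in> Obj C" "y \<in> Obj C"
    using homs_Obj [OF assms(1)] by blast+
  note c = coproduct(3) [OF ob(1)] coproduct(3) [OF ob(2)]
  have v: "stable_class C (v x) \<in> isos St x (Cod C (u x))" "stable_class C (v y) \<in> isos St y (Cod C (u y))"
    using v_stable_equivalence ob stable_equivalences_iff c by blast+
  have s: "stable_class C s \<in> isos St x y"
    using assms stable_equivalences_iff by blast
  have "stable_class C (plus_id C u v s) \<in> isos St (Cod C (u x)) (Cod C (u y))"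
    using S.isos_Comp_cancel_right [OF v(1) stable_class_homs [OF p(1)]] S.isos_Comp [OF s v(2)]
      stable_Comp [OF c(1) p(1)] stable_Comp [OF assms(1) c(2)] p(3) by simp
  then show ?thesis
    using stable_equivalences_iff [OF p(1)] by blast
qed

section \<open>The strict functors between the stable category and the homotopy category of the
  coslice\<close>

lemma inverting_\<Gamma>: "inverting_functor C H \<Gamma> W"
proof unfold_locales
  show "is_functor C H \<Gamma>"
    using functor_fcomp [OF functor_zero_shriek K.functor_loc_functor] .
  show "inverts C W H \<Gamma>"
  proof (rule invertsI)
    fix w x y assume w: "w \<in> W" "w \<in> homs C x y"
    note z = functor_homs [OF functor_zero_shriek w(2)]
    have "amap (zero_shriek C u v) w \<in> WA"
      using Weq_coslice [OF z] plus_id_stable_equivalence [OF w(2,1)] zero_shriek_amap [OF w(2)] by simp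
    then show "amap \<Gamma> w \<in> isos H (omap \<Gamma> x) (omap \<Gamma> y)"
      using K.loc_Bwd(1) [OF _ z] by simp
  qed
qed

lemma inverting_\<Delta>: "inverting_functor (coslice C A) (localization C W) \<Delta> WA"
proof -
  interpret L: category "localization C W"
    by (rule category_localization)
  show ?thesis
  proof unfold_locales
    show "is_functor (coslice C A) (localization C W) \<Delta>"
      using functor_fcomp [OF functor_forgetful functor_loc_functor] .
    show "inverts (coslice C A) WA (localization C W) \<Delta>"
    proof (rule invertsI)
      fix w x y assume w: "w \<in> WA" "w \<in> homs (coslice C A) x y"
      then have "amap (forgetful C) w \<in> W"
        using Weq_coslice [OF w(2)] by simp
      then show "amap \<Delta> w \<in> isos (localization C W) (omap \<Delta> x) (omap \<Delta> y)"
        using loc_Bwd(1) [OF _ functor_homs [OF functor_forgetful w(2)]] by simp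
    qed
  qed
qed

text \<open>The strict models of the two derived functors. They need no replacements, since
  \<open>\<Gamma>\<close> and \<open>\<Delta>\<close> invert weak equivalences as they stand;
  composing with the identification of stable and homotopy category leaves cosets, not zigzags, on
  the side of \<open>C\<close>.\<close>

definition "stable_shriek = loc_induced C H \<Gamma> \<circ>\<^sub>F stable_to_Ho C"
definition "stable_forget = Ho_to_stable C \<circ>\<^sub>F loc_induced (coslice C A) (localization C W) \<Delta>"

lemma functor_stable_shriek: "is_functor St H stable_shriek"
  unfolding stable_shriek_def
  using functor_fcomp [OF functor_stable_to_Ho(2) inverting_functor.functor_loc_induced [OF inverting_\<Gamma>]] .

lemma functor_stable_forget: "is_functor H St stable_forget"
  unfolding stable_forget_def
  using functor_fcomp [OF inverting_functor.functor_loc_induced [OF inverting_\<Delta>] functor_Ho_to_stable(2)] .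

lemma stable_shriek_omap [simp]: "omap stable_shriek x = u x"
  by (simp add: stable_shriek_def loc_induced_def)

lemma stable_shriek_class: "f \<in> homs C x y \<Longrightarrow> amap stable_shriek (stable_class C f) = diag C A u v f"
  by (simp add: stable_shriek_def stable_to_Ho_class inverting_functor.loc_induced_loc_functor [OF inverting_\<Gamma>]
      diag_def Ho_functor_def)

lemma stable_forget_omap [simp]: "omap stable_forget X = Cod C X"
  by (simp add: stable_forget_def loc_induced_def)

lemma stable_forget_loc_functor:
  assumes "c \<in> homs (coslice C A) X Y"
  shows "amap stable_forget (amap (loc_functor (coslice C A) WA) c) = stable_class C (amap (forgetful C) c)"
  using Ho_to_stable_loc_functor [OF functor_homs [OF functor_forgetful assms]]
  by (simp add: stable_forget_def inverting_functor.loc_induced_loc_functor [OF inverting_\<Delta> assms])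

lemma diag_homs: "s \<in> homs C x y \<Longrightarrow> diag C A u v s \<in> homs H (u x) (u y)"
  using functor_homs [OF functor_stable_shriek stable_class_homs] by (simp add: stable_shriek_class)

text \<open>Naturality is the defining equation of \<open>plus_id\<close> on the second
  summand.\<close>

lemma stable_unit: "natural_iso St St fid (stable_forget \<circ>\<^sub>F stable_shriek) (\<lambda>x. stable_class C (v x))"
proof (rule natural_isoI)
  show "stable_class C (v x) \<in> isos St (omap fid x) (omap (stable_forget \<circ>\<^sub>F stable_shriek) x)"
    if "x \<in> Obj St" for x
    using that stable_equivalences_iff [OF coproduct(3)] v_stable_equivalence by simp
next
  fix f x y assume "f \<in> homs St x y"
  then obtain s where s: "s \<in> homs C x y" "f = stable_class C s"
    by (rule stable_homsE)
  have ob: "x \<in> Obj C" "y \<in> Obj C"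
    using homs_Obj [OF s(1)] by blast+
  have "amap (stable_forget \<circ>\<^sub>F stable_shriek) f = stable_class C (plus_id C u v s)"
    using stable_forget_loc_functor [OF functor_homs [OF functor_zero_shriek s(1)]] s(2)
    by (simp add: stable_shriek_class [OF s(1)] diag_def Ho_functor_def zero_shriek_amap [OF s(1)])
  then show "stable_class C (v y) \<cdot>\<^bsub>St\<^esub> amap fid f
      = amap (stable_forget \<circ>\<^sub>F stable_shriek) f \<cdot>\<^bsub>St\<^esub> stable_class C (v x)"
    using stable_Comp [OF s(1) coproduct(3) [OF ob(2)]] stable_Comp [OF coproduct(3) [OF ob(1)] plus_id(1) [OF s(1)]]
      plus_id(3) [OF s(1)] s(2) by simp
qed

text \<open>The counit \<open>(X, 1) : A \<oplus> x \<rightarrow> x\<close> at \<open>X : A \<rightarrow> x\<close> is a stable equivalence, since it retracts \<open>v x\<close>.\<close>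

definition counit :: "'m \<Rightarrow> 'm" where
  "counit X = (THE t. t \<in> homs C (Cod C (u (Cod C X))) (Cod C X) \<and> t \<cdot> u (Cod C X) = X \<and>
     t \<cdot> v (Cod C X) = Ide C (Cod C X))"

lemma counit:
  assumes "X \<in> homs C A x"
  shows "counit X \<in> homs C (Cod C (u x)) x" "counit X \<cdot> u x = X" "counit X \<cdot> v x = Ide C x"
    "(u x, X, counit X) \<in> homs (coslice C A) (u x) X" "(u x, X, counit X) \<in> WA"
proof -
  have x: "x \<in> Obj C" "Cod C X = x"
    using homs_Obj [OF assms] homsD [OF assms] by blast+
  note c = coproduct [OF x(1)]
  have "\<exists>!t. t \<in> homs C (Cod C (u x)) x \<and> t \<cdot> u x = X \<and> t \<cdot> v x = Ide C x"
    using coproduct_ex1 [OF c assms Ide_in [OF x(1)]] .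
  from theI' [OF this]
  show 1: "counit X \<in> homs C (Cod C (u x)) x" "counit X \<cdot> u x = X" "counit X \<cdot> v x = Ide C x"
    by (simp_all add: counit_def x(2))
  show 2: "(u x, X, counit X) \<in> homs (coslice C A) (u x) X"
    using coslice_homsI [OF c(2) 1(1)] 1(2) by simp
  show "(u x, X, counit X) \<in> WA"
    using Weq_coslice [OF 2] stable_equivalence_retraction [OF c(3) v_stable_equivalence [OF x(1)] 1(1,3)]
    by simp
qed

text \<open>\<open>natural_iso_localization\<close> reduces naturality to honest arrows under
  \<open>A\<close>, where it is an equation between maps out of a coproduct.\<close>

lemma stable_counit:
  "natural_iso H H (stable_shriek \<circ>\<^sub>F stable_forget) fid
     (\<lambda>X. amap (loc_functor (coslice C A) WA) (u (Cod C X), X, counit X))"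
proof (rule natural_iso_localization [OF K.category_axioms H.category_axioms
      functor_fcomp [OF functor_stable_forget functor_stable_shriek]])
  let ?L = "loc_functor (coslice C A) WA"
  show "is_functor H H fid"
    using H.Ide_in by (auto simp: is_functor_def homs_def)
  show "amap ?L (u (Cod C X), X, counit X) \<in> isos H (omap (stable_shriek \<circ>\<^sub>F stable_forget) X) (omap fid X)"
    if "X \<in> Obj (coslice C A)" for X
    using K.loc_Bwd(1) [OF counit(5,4)] that by (simp add: coslice_Obj)
  fix c X Y assume c: "c \<in> homs (coslice C A) X Y"
  then obtain x y \<alpha> where X: "X \<in> homs C A x" and Y: "Y \<in> homs C A y"
    and \<alpha>: "\<alpha> \<in> homs C x y" "\<alpha> \<cdot> X = Y" "c = (X, Y, \<alpha>)"
    by (rule coslice_homsE)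
  have ob: "x \<in> Obj C" "y \<in> Obj C" and cod: "Cod C X = x" "Cod C Y = y"
    using homs_Obj [OF \<alpha>(1)] homsD [OF X] homsD [OF Y] by blast+
  note z = functor_homs [OF functor_zero_shriek \<alpha>(1), simplified]
  note p = plus_id [OF \<alpha>(1)] and cx = coproduct [OF ob(1)] and cy = coproduct [OF ob(2)]
  note eX = counit [OF X] and eY = counit [OF Y]
  \<comment> \<open>Both composites restrict to \<open>Y\<close> along \<open>u x\<close> and to
    \<open>\<alpha>\<close> along \<open>v x\<close>.\<close>
  have "counit Y \<cdot> plus_id C u v \<alpha> = \<alpha> \<cdot> counit X"
    using coproduct_unique [OF cx Comp_in [OF p(1) eY(1)] Comp_in [OF eX(1) \<alpha>(1)]]
      Comp_assoc [OF cx(2) p(1) eY(1)] Comp_assoc [OF cx(3) p(1) eY(1)]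
      Comp_assoc [OF cx(2) eX(1) \<alpha>(1)] Comp_assoc [OF cx(3) eX(1) \<alpha>(1)]
      Comp_assoc [OF \<alpha>(1) cy(3) eY(1)] Ide_Comp [OF \<alpha>(1)] Comp_Ide [OF \<alpha>(1)] p(2,3) eX(2,3) eY(2,3) \<alpha>(2)
    by simp
  then have "(u y, Y, counit Y) \<cdot>\<^bsub>coslice C A\<^esub> amap (zero_shriek C u v) \<alpha>
      = c \<cdot>\<^bsub>coslice C A\<^esub> (u x, X, counit X)"
    by (simp add: \<alpha>(3) coslice_Comp zero_shriek_amap [OF \<alpha>(1)])
  then have "amap ?L (u y, Y, counit Y) \<cdot>\<^bsub>H\<^esub> amap ?L (amap (zero_shriek C u v) \<alpha>)
      = amap ?L c \<cdot>\<^bsub>H\<^esub> amap ?L (u x, X, counit X)"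
    using functor_Comp [OF K.functor_loc_functor z eY(4)] functor_Comp [OF K.functor_loc_functor eX(4) c]
    by simp
  moreover have "amap (stable_shriek \<circ>\<^sub>F stable_forget) (amap ?L c) = amap ?L (amap (zero_shriek C u v) \<alpha>)"
    using stable_forget_loc_functor [OF c] stable_shriek_class [OF \<alpha>(1)] \<alpha>(3) by (simp add: diag_def Ho_functor_def)
  ultimately show "amap ?L (u (Cod C Y), Y, counit Y) \<cdot>\<^bsub>H\<^esub> amap (stable_shriek \<circ>\<^sub>F stable_forget) (amap ?L c)
      = amap fid (amap ?L c) \<cdot>\<^bsub>H\<^esub> amap ?L (u (Cod C X), X, counit X)"
    by (simp add: cod)
qed

lemma quasi_inverse_stable_shriek: "quasi_inverse St H stable_shriek stable_forget"
  unfolding quasi_inverse_def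
  using functor_stable_shriek functor_stable_forget stable_unit stable_counit by blast

section \<open>The derived functors compared with the strict ones\<close>

lemma left_derived_zero_shriek:
  assumes "cofibrant_replacement C (canonical_model C) Q q"
  shows "is_functor St H (left_derived C (canonical_model C) (coslice C A) (coslice_canonical C A) Q q
            (zero_shriek C u v) \<circ>\<^sub>F stable_to_Ho C)"
    and "natural_iso St H (left_derived C (canonical_model C) (coslice C A) (coslice_canonical C A) Q q
            (zero_shriek C u v) \<circ>\<^sub>F stable_to_Ho C) stable_shriek (\<lambda>x. diag C A u v (q x))"
proof -
  have q: "q x \<in> homs C (Q x) x" "q x \<in> W" "adm_epi C (q x)" if "x \<in> Obj C" for x
    using that assms by (auto simp: cofibrant_replacement_def canonical_model_def)
  \<comment> \<open>\<open>q x\<close> is an admissible epimorphism and a stable equivalence, so the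
    error of its stable inverse can be lifted away.\<close>
  have "\<exists>s\<in>homs C x (Q x). q x \<cdot> s = Ide C x" if "x \<in> Obj C" for x
    using split_epi_of_stable_equivalence [OF q(2,3,1)] that by metis
  note L = left_derived_natural_iso [of C "coslice C A" "coslice_canonical C A" "zero_shriek C u v"
      "canonical_model C" q Q, unfolded Ho_def Ho_functor_def Weq_canonical,
      OF inverting_\<Gamma> q(1,2) this]
  note st = functor_stable_to_Ho(2)
  show "is_functor St H (left_derived C (canonical_model C) (coslice C A) (coslice_canonical C A) Q q
            (zero_shriek C u v) \<circ>\<^sub>F stable_to_Ho C)"
    using functor_fcomp [OF st L(1)] .
  show "natural_iso St H (left_derived C (canonical_model C) (coslice C A) (coslice_canonical C A) Q q
            (zero_shriek C u v) \<circ>\<^sub>F stable_to_Ho C) stable_shriek (\<lambda>x. diag C A u v (q x))"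
    using natural_iso_pre [OF st L(2)] by (simp add: stable_shriek_def diag_def Ho_functor_def)
qed

lemma right_derived_forgetful:
  assumes "fibrant_replacement (coslice C A) (coslice_canonical C A) R \<rho>"
  shows "is_functor H St (Ho_to_stable C \<circ>\<^sub>F
            right_derived (coslice C A) (coslice_canonical C A) C (canonical_model C) R \<rho> (forgetful C))"
    and "\<exists>\<kappa>. natural_iso H St (Ho_to_stable C \<circ>\<^sub>F
            right_derived (coslice C A) (coslice_canonical C A) C (canonical_model C) R \<rho> (forgetful C))
          stable_forget \<kappa>"
proof -
  have \<rho>: "\<rho> X \<in> homs (coslice C A) X (R X)" "\<rho> X \<in> WA" "\<rho> X \<in> Cofib (coslice_canonical C A)"
    if "X \<in> Obj (coslice C A)" for X
    using that assms by (auto simp: fibrant_replacement_def)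
  have split: "\<exists>s\<in>homs (coslice C A) (R X) X. s \<cdot>\<^bsub>coslice C A\<^esub> \<rho> X = Ide (coslice C A) X"
    if X: "X \<in> Obj (coslice C A)" for X
  proof -
    obtain x y \<alpha> where \<alpha>: "X \<in> homs C A x" "R X \<in> homs C A y" "\<alpha> \<in> homs C x y" "\<alpha> \<cdot> X = R X"
      "\<rho> X = (X, R X, \<alpha>)"
      using \<rho>(1) [OF X] by (rule coslice_homsE)
    have "\<alpha> \<in> W" "adm_mono C \<alpha>"
      using \<rho> [OF X] Weq_coslice [OF \<rho>(1) [OF X]] \<alpha>(5)
      by (auto simp: coslice_model_def canonical_model_def)
    then obtain s where s: "s \<in> homs C y x" "s \<cdot> \<alpha> = Ide C x"
      using split_mono_of_stable_equivalence \<alpha>(3) by metis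
    \<comment> \<open>The retraction found in \<open>C\<close> is automatically a map under
      \<open>A\<close>, because \<open>R X\<close> is \<open>\<alpha> \<cdot> X\<close>.\<close>
    have "s \<cdot> R X = X"
      using Comp_assoc [OF \<alpha>(1,3) s(1)] s(2) \<alpha>(4) Ide_Comp [OF \<alpha>(1)] by simp
    then have "(R X, X, s) \<in> homs (coslice C A) (R X) X"
      using coslice_homsI [OF \<alpha>(2) s(1)] by simp
    moreover have "(R X, X, s) \<cdot>\<^bsub>coslice C A\<^esub> \<rho> X = Ide (coslice C A) X"
      using s(2) homsD [OF \<alpha>(1)] by (simp add: \<alpha>(5) coslice_Comp coslice_Ide)
    ultimately show ?thesis
      by blast
  qed
  note R = right_derived_natural_iso [of "coslice C A" C "canonical_model C" "forgetful C"
      "coslice_canonical C A" \<rho> R, unfolded Ho_def Ho_functor_def Weq_canonical,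
      OF inverting_\<Delta> \<rho>(1,2) split]
  note st = functor_Ho_to_stable(2)
  show "is_functor H St (Ho_to_stable C \<circ>\<^sub>F
            right_derived (coslice C A) (coslice_canonical C A) C (canonical_model C) R \<rho> (forgetful C))"
    using functor_fcomp [OF R(1) st] .
  show "\<exists>\<kappa>. natural_iso H St (Ho_to_stable C \<circ>\<^sub>F
            right_derived (coslice C A) (coslice_canonical C A) C (canonical_model C) R \<rho> (forgetful C))
          stable_forget \<kappa>"
    using natural_iso_post [OF H.category_axioms category_localization S.category_axioms R(1)
        inverting_functor.functor_loc_induced [OF inverting_\<Delta>] st R(2)]
    unfolding stable_forget_def by blast
qed

end

section \<open>The suspension\<close>

locale frobenius_suspension = frobenius_category C
  for C :: "('o, 'm, 'e) exact_cat_scheme" (structure) +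
  fixes i p :: "'o \<Rightarrow> 'm"
  assumes ip: "suspension_choice C i p"
begin

abbreviation "I x \<equiv> Cod C (i x)"
abbreviation "\<Sigma> x \<equiv> Cod C (p x)"

lemma suspension_sequence:
  assumes "x \<in> Obj C"
  shows "adm_mono C (i x)" "i x \<in> homs C x (I x)" "injective C (I x)" "is_cokernel C (i x) (p x)"
    "p x \<in> homs C (I x) (\<Sigma> x)" "p x \<cdot> i x = Zero C x (\<Sigma> x)"
proof -
  have *: "Dom C (i x) = x" "adm_mono C (i x)" "injective C (I x)" "is_cokernel C (i x) (p x)"
    using assms ip by (simp_all add: suspension_choice_def)
  then show "adm_mono C (i x)" "i x \<in> homs C x (I x)" "injective C (I x)" "is_cokernel C (i x) (p x)"
    "p x \<in> homs C (I x) (\<Sigma> x)" "p x \<cdot> i x = Zero C x (\<Sigma> x)"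
    using adm_mono_homs [OF *(2)] by (simp_all add: is_cokernel_def homs_def)
qed

lemma cokernel_ex1:
  assumes "x \<in> Obj C" "h \<in> homs C (I x) z" "h \<cdot> i x = Zero C x z"
  shows "\<exists>!t. t \<in> homs C (\<Sigma> x) z \<and> t \<cdot> p x = h"
  using suspension_sequence(4) [OF assms(1)] assms(2,3) homsD [OF suspension_sequence(2) [OF assms(1)]]
  by (simp add: is_cokernel_def)

lemma cokernel_unique:
  assumes "x \<in> Obj C" "s \<in> homs C (\<Sigma> x) z" "t \<in> homs C (\<Sigma> x) z" "s \<cdot> p x = t \<cdot> p x"
  shows "s = t"
proof -
  note q = suspension_sequence [OF assms(1)]
  have "(t \<cdot> p x) \<cdot> i x = Zero C x z"
    using Comp_assoc [OF q(2,5) assms(3)] q(6) Comp_Zero [OF assms(3,1)] by simp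
  then show ?thesis
    using cokernel_ex1 [OF assms(1) Comp_in [OF q(5) assms(3)]] assms(2-4) by blast
qed

lemma suspends_iff:
  assumes "s \<in> homs C x y"
  shows "suspends C i p s \<sigma> \<longleftrightarrow> \<sigma> \<in> homs C (\<Sigma> x) (\<Sigma> y) \<and>
    (\<exists>j\<in>homs C (I x) (I y). j \<cdot> i x = i y \<cdot> s \<and> \<sigma> \<cdot> p x = p y \<cdot> j)"
  using homsD [OF assms] by (simp add: suspends_def)

lemma suspends_homs: "\<lbrakk>s \<in> homs C x y; suspends C i p s \<sigma>\<rbrakk> \<Longrightarrow> \<sigma> \<in> homs C (\<Sigma> x) (\<Sigma> y)"
  using suspends_iff by blast

text \<open>Injectivity of \<open>I y\<close> extends \<open>i y \<cdot> s\<close> along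
  \<open>i x\<close>; composed with \<open>p y\<close> the extension kills \<open>i x\<close>, so it
  descends to the cokernel.\<close>

lemma suspends_exists:
  assumes "s \<in> homs C x y"
  obtains \<sigma> where "suspends C i p s \<sigma>"
proof -
  have xy: "x \<in> Obj C" "y \<in> Obj C"
    using homs_Obj [OF assms] by blast+
  note qx = suspension_sequence [OF xy(1)] and qy = suspension_sequence [OF xy(2)]
  obtain j where j: "j \<in> homs C (I x) (I y)" "j \<cdot> i x = i y \<cdot> s"
    using qy(3) qx(1) Comp_in [OF assms qy(2)] homsD [OF qx(2)] unfolding injective_def by metis
  have "(p y \<cdot> j) \<cdot> i x = Zero C x (\<Sigma> y)"
    using Comp_assoc [OF qx(2) j(1) qy(5)] j(2) Comp_assoc [OF assms qy(2,5)] qy(6)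
      Zero_Comp [OF assms] homs_Obj [OF qy(5)] by simp
  then obtain \<sigma> where "\<sigma> \<in> homs C (\<Sigma> x) (\<Sigma> y)" "\<sigma> \<cdot> p x = p y \<cdot> j"
    using cokernel_ex1 [OF xy(1) Comp_in [OF j(1) qy(5)]] by blast
  then show ?thesis
    using that j suspends_iff [OF assms] by blast
qed

text \<open>Independence of the extension and of the stable representative at once: changing either
  alters the suspension only by a map through \<open>I y\<close>.\<close>

lemma suspends_cong:
  assumes "s \<in> homs C x y" "s' \<in> homs C x y" "stable_class C s = stable_class C s'"
    and "suspends C i p s \<sigma>" "suspends C i p s' \<sigma>'"
  shows "stable_class C \<sigma> = stable_class C \<sigma>'"
proof -
  have xy: "x \<in> Obj C" "y \<in> Obj C"
    using homs_Obj [OF assms(1)] by blast+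
  note qx = suspension_sequence [OF xy(1)] and qy = suspension_sequence [OF xy(2)]
  obtain h where h: "h \<in> null_homs C x y" "s' = Plus C s h"
    using assms(1-3) stable_class_eq_iff by blast
  obtain k where k: "k \<in> homs C (I x) y" "h = k \<cdot> i x"
    using h(1) qx(1,2) by (rule null_homs_extend)
  obtain j where j: "j \<in> homs C (I x) (I y)" "j \<cdot> i x = i y \<cdot> s" "\<sigma> \<cdot> p x = p y \<cdot> j"
    using assms(4) suspends_iff [OF assms(1)] by blast
  obtain j' where j': "j' \<in> homs C (I x) (I y)" "j' \<cdot> i x = i y \<cdot> s'" "\<sigma>' \<cdot> p x = p y \<cdot> j'"
    using assms(5) suspends_iff [OF assms(2)] by blast
  note \<sigma> = suspends_homs [OF assms(1,4)] and \<sigma>' = suspends_homs [OF assms(2,5)]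
  have ob: "I x \<in> Obj C" "\<Sigma> y \<in> Obj C"
    using homs_Obj [OF qx(5)] homs_Obj [OF qy(5)] by blast+
  note ik = Comp_in [OF k(1) qy(2)]
  \<comment> \<open>An extension of \<open>s'\<close> made from the extension \<open>j\<close> of
    \<open>s\<close>. It induces the same \<open>\<sigma>\<close>, as \<open>p y \<cdot> i y\<close>
    is zero.\<close>
  define m where "m = Plus C j (i y \<cdot> k)"
  have m: "m \<in> homs C (I x) (I y)"
    unfolding m_def using j(1) ik by (rule Plus_homs)
  have mi: "m \<cdot> i x = j' \<cdot> i x"
    using Plus_Comp [OF j(1) ik qx(2)] Comp_assoc [OF qx(2) k(1) qy(2)] j(2) j'(2) h(2) k(2)
      Comp_Plus [OF assms(1) null_homs_homs [OF h(1)] qy(2)] by (simp add: m_def)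
  have pm: "p y \<cdot> m = \<sigma> \<cdot> p x"
    using Comp_Plus [OF j(1) ik qy(5)] Comp_assoc [OF k(1) qy(2,5)] qy(6) Zero_Comp [OF k(1) ob(2)]
      Plus_Zero [OF Comp_in [OF j(1) qy(5)]] j(3) by (simp add: m_def)
  \<comment> \<open>Two extensions of the same \<open>s'\<close> differ by a map vanishing on
    \<open>i x\<close>, which therefore factors through \<open>p x\<close>.\<close>
  define d where "d = Plus C j' (Neg C m)"
  note nm = Neg_homs [OF m]
  have d: "d \<in> homs C (I x) (I y)" "Plus C m d = j'"
    unfolding d_def using Plus_homs [OF j'(1) nm] Plus_Minus_cancel [OF j'(1) m] by simp_all
  have "d \<cdot> i x = Zero C x (I y)"
    unfolding d_def using Plus_Comp [OF j'(1) nm qx(2)] Neg_Comp [OF qx(2) m] mi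
      Plus_Neg [OF Comp_in [OF qx(2) j'(1)]] by simp
  then obtain t where t: "t \<in> homs C (\<Sigma> x) (I y)" "t \<cdot> p x = d"
    using cokernel_ex1 [OF xy(1) d(1)] by blast
  note pt = Comp_in [OF t(1) qy(5)]
  \<comment> \<open>Arrows out of the cokernel are compared after \<open>p x\<close>; the correction
    \<open>p y \<cdot> t\<close> passes through the injective \<open>I y\<close>.\<close>
  have "\<sigma>' = Plus C \<sigma> (p y \<cdot> t)"
  proof (rule cokernel_unique [OF xy(1) \<sigma>' Plus_homs [OF \<sigma> pt]])
    show "\<sigma>' \<cdot> p x = Plus C \<sigma> (p y \<cdot> t) \<cdot> p x"
      using Plus_Comp [OF \<sigma> pt qx(5)] Comp_assoc [OF qx(5) t(1) qy(5)] t(2) pm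
        Comp_Plus [OF m d(1) qy(5)] d(2) j'(3) by simp
  qed
  then show ?thesis
    using stable_class_eqI [OF \<sigma> null_homsI [OF qy(3) t(1) qy(5)]] by simp
qed

lemma suspends_Ide:
  assumes "x \<in> Obj C"
  shows "suspends C i p (Ide C x) (Ide C (\<Sigma> x))"
proof -
  note q = suspension_sequence [OF assms]
  have "I x \<in> Obj C" "\<Sigma> x \<in> Obj C"
    using homs_Obj [OF q(5)] by blast+
  then show ?thesis
    using Ide_in Ide_Comp [OF q(2)] Comp_Ide [OF q(2)] Ide_Comp [OF q(5)] Comp_Ide [OF q(5)]
    by (auto simp: suspends_iff [OF Ide_in [OF assms]] intro!: bexI [of _ "Ide C (I x)"])
qed

lemma suspends_Comp:
  assumes "s \<in> homs C x y" "t \<in> homs C y z" "suspends C i p s \<sigma>" "suspends C i p t \<tau>"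
  shows "suspends C i p (t \<cdot> s) (\<tau> \<cdot> \<sigma>)"
proof -
  have ob: "x \<in> Obj C" "y \<in> Obj C" "z \<in> Obj C"
    using homs_Obj [OF assms(1)] homs_Obj [OF assms(2)] by blast+
  note qx = suspension_sequence [OF ob(1)] and qy = suspension_sequence [OF ob(2)]
    and qz = suspension_sequence [OF ob(3)]
  note \<sigma> = suspends_homs [OF assms(1,3)] and \<tau> = suspends_homs [OF assms(2,4)]
  obtain j where j: "j \<in> homs C (I x) (I y)" "j \<cdot> i x = i y \<cdot> s" "\<sigma> \<cdot> p x = p y \<cdot> j"
    using assms(3) suspends_iff [OF assms(1)] by blast
  obtain k where k: "k \<in> homs C (I y) (I z)" "k \<cdot> i y = i z \<cdot> t" "\<tau> \<cdot> p y = p z \<cdot> k"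
    using assms(4) suspends_iff [OF assms(2)] by blast
  have "(k \<cdot> j) \<cdot> i x = i z \<cdot> t \<cdot> s"
    using Comp_assoc [OF qx(2) j(1) k(1)] Comp_assoc [OF assms(1) qy(2) k(1)]
      Comp_assoc [OF assms(1,2) qz(2)] j(2) k(2) by simp
  moreover have "(\<tau> \<cdot> \<sigma>) \<cdot> p x = p z \<cdot> k \<cdot> j"
    using Comp_assoc [OF qx(5) \<sigma> \<tau>] Comp_assoc [OF j(1) qy(5) \<tau>] Comp_assoc [OF j(1) k(1) qz(5)]
      j(3) k(3) by simp
  ultimately show ?thesis
    using suspends_iff [OF Comp_in [OF assms(1,2)]] Comp_in [OF \<sigma> \<tau>] Comp_in [OF j(1) k(1)] by blast
qed

lemma stable_suspension_omap [simp]: "omap (stable_suspension C i p) x = \<Sigma> x"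
  by (simp add: stable_suspension_def)

text \<open>The definite description ranges over all representatives and all extensions;
  \<open>suspends_cong\<close> covers both.\<close>

lemma stable_suspension_class:
  assumes "s \<in> homs C x y" "suspends C i p s \<sigma>"
  shows "amap (stable_suspension C i p) (stable_class C s) = stable_class C \<sigma>"
proof -
  have "(THE d. \<exists>s'\<in>stable_class C s. \<exists>\<sigma>'. suspends C i p s' \<sigma>' \<and> d = stable_class C \<sigma>')
      = stable_class C \<sigma>"
  proof (rule the_equality)
    show "\<exists>s'\<in>stable_class C s. \<exists>\<sigma>'. suspends C i p s' \<sigma>' \<and> stable_class C \<sigma> = stable_class C \<sigma>'"
      using stable_class_self [OF assms(1)] assms(2) by blast
  next
    fix d assume "\<exists>s'\<in>stable_class C s. \<exists>\<sigma>'. suspends C i p s' \<sigma>' \<and> d = stable_class C \<sigma>'"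
    then obtain s' \<sigma>' where s': "s' \<in> stable_class C s" "suspends C i p s' \<sigma>'" "d = stable_class C \<sigma>'"
      by blast
    show "d = stable_class C \<sigma>"
      using suspends_cong [OF stable_class_mem(1) [OF assms(1) s'(1)] assms(1)
          stable_class_mem(2) [OF assms(1) s'(1)] s'(2) assms(2)] s'(3) by simp
  qed
  then show ?thesis
    by (simp add: stable_suspension_def)
qed

lemma functor_stable_suspension:
  "is_functor (stable_category C) (stable_category C) (stable_suspension C i p)"
proof (rule is_functorI)
  let ?St = "stable_category C"
  let ?S = "stable_suspension C i p"
  show "omap ?S x \<in> Obj ?St" if "x \<in> Obj ?St" for x
    using that homs_Obj [OF suspension_sequence(5)] by simp
  show "amap ?S (Ide ?St x) = Ide ?St (omap ?S x)" if "x \<in> Obj ?St" for x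
    using that stable_suspension_class [OF Ide_in suspends_Ide] by (simp add: stable_Ide)
  show "amap ?S f \<in> homs ?St (omap ?S x) (omap ?S y)" if "f \<in> homs ?St x y" for f x y
  proof -
    obtain s where s: "s \<in> homs C x y" "f = stable_class C s"
      using \<open>f \<in> homs ?St x y\<close> by (rule stable_homsE)
    obtain \<sigma> where \<sigma>: "suspends C i p s \<sigma>"
      using s(1) by (rule suspends_exists)
    show ?thesis
      using stable_suspension_class [OF s(1) \<sigma>] stable_class_homs [OF suspends_homs [OF s(1) \<sigma>]] s(2) by simp
  qed
  show "amap ?S (g \<cdot>\<^bsub>?St\<^esub> f) = amap ?S g \<cdot>\<^bsub>?St\<^esub> amap ?S f"
    if f: "f \<in> homs ?St x y" and g: "g \<in> homs ?St y z" for f g x y z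
  proof -
    obtain s where s: "s \<in> homs C x y" "f = stable_class C s"
      using f by (rule stable_homsE)
    obtain t where t: "t \<in> homs C y z" "g = stable_class C t"
      using g by (rule stable_homsE)
    obtain \<sigma> where \<sigma>: "suspends C i p s \<sigma>"
      using s(1) by (rule suspends_exists)
    obtain \<tau> where \<tau>: "suspends C i p t \<tau>"
      using t(1) by (rule suspends_exists)
    show ?thesis
      using stable_suspension_class [OF s(1) \<sigma>] stable_suspension_class [OF t(1) \<tau>]
        stable_suspension_class [OF Comp_in [OF s(1) t(1)] suspends_Comp [OF s(1) t(1) \<sigma> \<tau>]]
        stable_Comp [OF s(1) t(1)] stable_Comp [OF suspends_homs [OF s(1) \<sigma>] suspends_homs [OF t(1) \<tau>]]
        s(2) t(2) by simp
  qed
qed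

end

locale frobenius_coslice_suspension = frobenius_coslice C A u v + frobenius_suspension C i p
  for C :: "('o, 'm, 'e) exact_cat_scheme" (structure) and A :: 'o and u v i p :: "'o \<Rightarrow> 'm" +
  fixes r :: "'m \<Rightarrow> 'o" and \<phi> :: "'m \<Rightarrow> ('m, 'm \<times> 'm \<times> 'm) loc_arr"
  assumes diag_choice: "diag_choice C A u r \<phi>"
begin

abbreviation "D \<equiv> diag_suspension C A u v i p"

section \<open>Diagonal morphisms and the suspension between the objects \<open>u x\<close>\<close>

lemma diag_Comp:
  assumes "s \<in> homs C x y" "t \<in> homs C y z"
  shows "diag C A u v t \<cdot>\<^bsub>H\<^esub> diag C A u v s = diag C A u v (t \<cdot> s)"
  using functor_Comp [OF functor_stable_shriek stable_class_homs [OF assms(1)] stable_class_homs [OF assms(2)]]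
    stable_Comp [OF assms] assms stable_shriek_class [OF Comp_in [OF assms]] by (simp add: stable_shriek_class)

lemma diag_Ide: "x \<in> Obj C \<Longrightarrow> diag C A u v (Ide C x) = Ide H (u x)"
  using functor_Ide [OF functor_stable_shriek, of x] stable_shriek_class [OF Ide_in] by (simp add: stable_Ide)

text \<open>Faithfulness of \<open>stable_shriek\<close>, from its being an equivalence.\<close>

lemma diag_eq:
  assumes "s \<in> homs C x y" "t \<in> homs C x y" "diag C A u v s = diag C A u v t"
  shows "stable_class C s = stable_class C t"
  using quasi_inverse_faithful [OF S.category_axioms quasi_inverse_stable_shriek
      stable_class_homs [OF assms(1)] stable_class_homs [OF assms(2)]]
    stable_shriek_class [OF assms(1)] stable_shriek_class [OF assms(2)] assms(3) by simp

text \<open>Fullness of \<open>stable_shriek\<close>: a morphism between objects \<open>u x\<close>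
  and \<open>u y\<close>, a priori a class of zigzags under \<open>A\<close>, is a diagonal
  matrix.\<close>

lemma diagE:
  assumes "x \<in> Obj C" "y \<in> Obj C" "g \<in> homs H (u x) (u y)"
  obtains s \<sigma> where "s \<in> homs C x y" "g = diag C A u v s" "suspends C i p s \<sigma>"
proof -
  obtain f where "f \<in> homs St x y" "amap stable_shriek f = g"
    using quasi_inverse_full [OF S.category_axioms H.category_axioms quasi_inverse_stable_shriek, of x y g]
      assms by auto
  then obtain s where s: "s \<in> homs C x y" "g = diag C A u v s"
    using stable_shriek_class by (elim stable_homsE) metis
  then show ?thesis
    using suspends_exists [OF s(1)] that by blast
qed

text \<open>Two diagonal representatives of one morphism are stably equal, so their suspensions are
  stably equal and define the same diagonal morphism.\<close>

lemma diag_suspension_diag: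
  assumes "s \<in> homs C x y" "suspends C i p s \<sigma>"
  shows "D x y (diag C A u v s) = diag C A u v \<sigma>"
  unfolding diag_suspension_def
proof (rule the_equality)
  fix h assume "\<exists>s'\<in>homs C x y. \<exists>\<sigma>'. diag C A u v s' = diag C A u v s \<and> suspends C i p s' \<sigma>' \<and>
    h = diag C A u v \<sigma>'"
  then obtain s' \<sigma>' where s': "s' \<in> homs C x y" "diag C A u v s' = diag C A u v s"
    "suspends C i p s' \<sigma>'" "h = diag C A u v \<sigma>'"
    by blast
  show "h = diag C A u v \<sigma>"
    using suspends_cong [OF s'(1) assms(1) diag_eq [OF s'(1) assms(1) s'(2)] s'(3) assms(2)] s'(4)
      stable_shriek_class [OF suspends_homs [OF s'(1,3)]] stable_shriek_class [OF suspends_homs [OF assms]]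
    by simp
qed (use assms in blast)

lemma diag_suspension_homs:
  assumes "x \<in> Obj C" "y \<in> Obj C" "g \<in> homs H (u x) (u y)"
  shows "D x y g \<in> homs H (u (\<Sigma> x)) (u (\<Sigma> y))"
proof -
  obtain s \<sigma> where s: "s \<in> homs C x y" "g = diag C A u v s" "suspends C i p s \<sigma>"
    using assms by (rule diagE)
  show ?thesis
    using diag_suspension_diag [OF s(1,3)] diag_homs [OF suspends_homs [OF s(1,3)]] s(2) by simp
qed

lemma diag_suspension_Comp:
  assumes "x \<in> Obj C" "y \<in> Obj C" "z \<in> Obj C" "f \<in> homs H (u x) (u y)" "g \<in> homs H (u y) (u z)"
  shows "D x z (g \<cdot>\<^bsub>H\<^esub> f) = D y z g \<cdot>\<^bsub>H\<^esub> D x y f"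
proof -
  obtain s \<sigma> where s: "s \<in> homs C x y" "f = diag C A u v s" "suspends C i p s \<sigma>"
    using assms(1,2,4) by (rule diagE)
  obtain t \<tau> where t: "t \<in> homs C y z" "g = diag C A u v t" "suspends C i p t \<tau>"
    using assms(2,3,5) by (rule diagE)
  show ?thesis
    using diag_Comp [OF s(1) t(1)] diag_Comp [OF suspends_homs [OF s(1,3)] suspends_homs [OF t(1,3)]]
      diag_suspension_diag [OF s(1,3)] diag_suspension_diag [OF t(1,3)]
      diag_suspension_diag [OF Comp_in [OF s(1) t(1)] suspends_Comp [OF s(1) t(1) s(3) t(3)]] s(2) t(2)
    by simp
qed

lemma diag_suspension_Ide: "x \<in> Obj C \<Longrightarrow> D x x (Ide H (u x)) = Ide H (u (\<Sigma> x))"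
  using diag_suspension_diag [OF Ide_in suspends_Ide] diag_Ide homs_Obj [OF suspension_sequence(5)]
  by simp

lemma diag_suspension_isos:
  assumes "x \<in> Obj C" "y \<in> Obj C" "g \<in> isos H (u x) (u y)"
  shows "D x y g \<in> isos H (u (\<Sigma> x)) (u (\<Sigma> y))"
proof -
  note g = H.isos_homs [OF assms(3)] H.inv_arr [OF assms(3)]
  show ?thesis
    using H.isosI [OF diag_suspension_homs [OF assms(1,2) g(1)] diag_suspension_homs [OF assms(2,1) g(2)]]
      diag_suspension_Comp [OF assms(1,2,1) g(1,2)] diag_suspension_Comp [OF assms(2,1,2) g(2,1)]
      diag_suspension_Ide [OF assms(1)] diag_suspension_Ide [OF assms(2)] g(3,4) by simp
qed

section \<open>The suspension on the whole homotopy category of the coslice\<close>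

lemma diag_choice':
  assumes "X \<in> Obj (coslice C A)"
  shows "r X \<in> Obj C" "\<phi> X \<in> isos H X (u (r X))"
  using diag_choice assms unfolding diag_choice_def H_eq by blast+

abbreviation "S' \<equiv> coslice_suspension C A u v i p r \<phi>"

lemma coslice_suspension_omap [simp]: "omap S' X = u (\<Sigma> (r X))"
  by (simp add: coslice_suspension_def)

lemma coslice_suspension_amap:
  "g \<in> homs H X Y \<Longrightarrow> amap S' g = D (r X) (r Y) (\<phi> Y \<cdot>\<^bsub>H\<^esub> g \<cdot>\<^bsub>H\<^esub> inv_arr H (\<phi> X))"
  using homsD [of g H X Y] by (simp add: coslice_suspension_def Let_def H_eq)

text \<open>Conjugation by \<open>\<phi>\<close> moves every morphism to one between objects
  \<open>u x\<close>, where \<open>D\<close> is already functorial.\<close>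

lemma functor_coslice_suspension: "is_functor H H S'"
proof (rule is_functorI)
  have conj: "\<phi> Y \<cdot>\<^bsub>H\<^esub> g \<cdot>\<^bsub>H\<^esub> inv_arr H (\<phi> X) \<in> homs H (u (r X)) (u (r Y)) \<and>
      r X \<in> Obj C \<and> r Y \<in> Obj C" if g: "g \<in> homs H X Y" for g X Y
  proof -
    have X: "X \<in> Obj (coslice C A)" and Y: "Y \<in> Obj (coslice C A)"
      using H.homs_Obj [OF g] by simp_all
    show ?thesis
      using H.Comp_in [OF H.Comp_in [OF H.inv_arr(1) [OF diag_choice'(2) [OF X]] g]
          H.isos_homs [OF diag_choice'(2) [OF Y]]] diag_choice'(1) [OF X] diag_choice'(1) [OF Y] by blast
  qed
  show "omap S' X \<in> Obj H" if "X \<in> Obj H" for X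
    using that functor_Obj [OF functor_stable_shriek, of "\<Sigma> (r X)"] diag_choice'(1) [of X]
      homs_Obj [OF suspension_sequence(5)] by simp
  show "amap S' (Ide H X) = Ide H (omap S' X)" if X: "X \<in> Obj H" for X
  proof -
    have X': "X \<in> Obj (coslice C A)"
      using X by simp
    note i = diag_choice'(2) [OF X']
    show ?thesis
      using coslice_suspension_amap [OF H.Ide_in [OF X]] H.Ide_Comp [OF H.inv_arr(1) [OF i]] H.inv_arr(3) [OF i]
        diag_suspension_Ide [OF diag_choice'(1) [OF X']] by simp
  qed
  show "amap S' f \<in> homs H (omap S' X) (omap S' Y)" if f: "f \<in> homs H X Y" for f X Y
    using coslice_suspension_amap [OF f] diag_suspension_homs conj [OF f] by simp
  show "amap S' (g \<cdot>\<^bsub>H\<^esub> f) = amap S' g \<cdot>\<^bsub>H\<^esub> amap S' f"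
    if f: "f \<in> homs H X Y" and g: "g \<in> homs H Y Z" for f g X Y Z
  proof -
    have ob: "X \<in> Obj (coslice C A)" "Y \<in> Obj (coslice C A)" "Z \<in> Obj (coslice C A)"
      using H.homs_Obj [OF f] H.homs_Obj [OF g] by simp_all
    note cX = diag_choice' [OF ob(1)] and cY = diag_choice' [OF ob(2)] and cZ = diag_choice' [OF ob(3)]
    note iX = H.inv_arr(1) [OF cX(2)] and iY = H.inv_arr(1) [OF cY(2)]
    note hY = H.isos_homs [OF cY(2)] and hZ = H.isos_homs [OF cZ(2)]
    note fX = H.Comp_in [OF iX f] and gY = H.Comp_in [OF iY g]
    \<comment> \<open>The inverse of \<open>\<phi> Y\<close> meets \<open>\<phi> Y\<close> in the
      middle and cancels.\<close>
    have "(\<phi> Z \<cdot>\<^bsub>H\<^esub> g \<cdot>\<^bsub>H\<^esub> inv_arr H (\<phi> Y)) \<cdot>\<^bsub>H\<^esub> (\<phi> Y \<cdot>\<^bsub>H\<^esub> f \<cdot>\<^bsub>H\<^esub> inv_arr H (\<phi> X))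
        = \<phi> Z \<cdot>\<^bsub>H\<^esub> (g \<cdot>\<^bsub>H\<^esub> f) \<cdot>\<^bsub>H\<^esub> inv_arr H (\<phi> X)"
      using H.Comp_assoc [OF H.Comp_in [OF fX hY] gY hZ] H.Comp_assoc [OF H.Comp_in [OF fX hY] iY g]
        H.Comp_inv_cancel(1) [OF cY(2) fX] H.Comp_assoc [OF iX f g] by simp
    then show ?thesis
      using coslice_suspension_amap [OF f] coslice_suspension_amap [OF g]
        coslice_suspension_amap [OF H.Comp_in [OF f g]]
        diag_suspension_Comp [OF cX(1) cY(1) cZ(1) conjunct1 [OF conj [OF f]] conjunct1 [OF conj [OF g]]] by simp
  qed
qed

section \<open>Compatibility with suspensions and triangles\<close>

abbreviation "\<xi> \<equiv> suspension_comparison C A u v i p r \<phi>"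

text \<open>\<open>\<xi> x\<close> is \<open>D\<close> applied to \<open>\<phi> (u x)\<close>. Both
  sides of the naturality square are \<open>D\<close> of
  \<open>\<phi> (u y) \<cdot> diag C A u v s\<close>: \<open>amap S'\<close> conjugates by
  \<open>\<phi>\<close>, and \<open>\<phi> (u x)\<close> removes the inverse.\<close>

lemma stable_shriek_suspension:
  "natural_iso St H (stable_shriek \<circ>\<^sub>F stable_suspension C i p) (S' \<circ>\<^sub>F stable_shriek) \<xi>"
proof (rule natural_isoI)
  have ux: "u x \<in> Obj (coslice C A)" if "x \<in> Obj C" for x
    using that functor_Obj [OF functor_stable_shriek, of x] by simp
  show "\<xi> x \<in> isos H (omap (stable_shriek \<circ>\<^sub>F stable_suspension C i p) x) (omap (S' \<circ>\<^sub>F stable_shriek) x)"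
    if "x \<in> Obj St" for x
    using that diag_suspension_isos [OF _ diag_choice' [OF ux]] by (simp add: suspension_comparison_def)
  fix f x y assume "f \<in> homs St x y"
  then obtain s where s: "s \<in> homs C x y" "f = stable_class C s"
    by (rule stable_homsE)
  obtain \<sigma> where \<sigma>: "suspends C i p s \<sigma>"
    using s(1) by (rule suspends_exists)
  have ob: "x \<in> Obj C" "y \<in> Obj C"
    using homs_Obj [OF s(1)] by blast+
  note cx = diag_choice' [OF ux [OF ob(1)]] and cy = diag_choice' [OF ux [OF ob(2)]]
  note hx = H.isos_homs [OF cx(2)] and hy = H.isos_homs [OF cy(2)] and ix = H.inv_arr(1) [OF cx(2)]
  note d = diag_homs [OF s(1)]
  note ds = H.Comp_in [OF H.Comp_in [OF ix d] hy]
  have e: "(\<phi> (u y) \<cdot>\<^bsub>H\<^esub> diag C A u v s \<cdot>\<^bsub>H\<^esub> inv_arr H (\<phi> (u x))) \<cdot>\<^bsub>H\<^esub> \<phi> (u x)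
      = \<phi> (u y) \<cdot>\<^bsub>H\<^esub> diag C A u v s"
    using H.Comp_assoc [OF hx H.Comp_in [OF ix d] hy] H.Comp_inv_cancel_right(2) [OF cx(2) d] by simp
  have "\<xi> y \<cdot>\<^bsub>H\<^esub> diag C A u v \<sigma> = D x (r (u y)) (\<phi> (u y) \<cdot>\<^bsub>H\<^esub> diag C A u v s)"
    using diag_suspension_Comp [OF ob cy(1) d hy] diag_suspension_diag [OF s(1) \<sigma>]
    by (simp add: suspension_comparison_def)
  also have "\<dots> = amap S' (diag C A u v s) \<cdot>\<^bsub>H\<^esub> \<xi> x"
    using diag_suspension_Comp [OF ob(1) cx(1) cy(1) hx ds] e coslice_suspension_amap [OF d]
    by (simp add: suspension_comparison_def)
  finally show "\<xi> y \<cdot>\<^bsub>H\<^esub> amap (stable_shriek \<circ>\<^sub>F stable_suspension C i p) f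
      = amap (S' \<circ>\<^sub>F stable_shriek) f \<cdot>\<^bsub>H\<^esub> \<xi> x"
    using stable_suspension_class [OF s(1) \<sigma>] stable_shriek_class [OF suspends_homs [OF s(1) \<sigma>]]
      stable_shriek_class [OF s(1)] s(2) by simp
qed

text \<open>The third map of a generating coslice triangle contains \<open>\<xi>\<close>, the very
  comparison by which \<open>stable_shriek\<close> commutes with suspensions. So
  \<open>stable_shriek\<close> takes standard triangles to generating ones, and
  \<open>triangle_transport\<close> handles both the isomorphism to a standard triangle and the
  passage to \<open>G\<close>.\<close>

lemma triangle_equivalence_of_natural_iso:
  assumes G: "is_functor St H G" and \<theta>: "natural_iso St H G stable_shriek \<theta>" and eq: "equivalence St H G"
  shows "triangle_equivalence St (stable_suspension C i p) (stable_triangles C i p)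
           H S' (coslice_triangles C A u v i p r \<phi>) G"
proof -
  let ?S = "stable_suspension C i p"
  define \<eta> where "\<eta> x = inv_arr H (amap S' (\<theta> x)) \<cdot>\<^bsub>H\<^esub> \<xi> x \<cdot>\<^bsub>H\<^esub> \<theta> (omap ?S x)" for x
  have \<eta>: "natural_iso St H (G \<circ>\<^sub>F ?S) (S' \<circ>\<^sub>F G) \<eta>"
    unfolding \<eta>_def [abs_def]
    by (rule suspension_transport [OF S.category_axioms H.category_axioms G functor_stable_shriek
          functor_stable_suspension functor_coslice_suspension \<theta> stable_shriek_suspension])
  have "(amap G f, amap G g, \<eta> (Dom St f) \<cdot>\<^bsub>H\<^esub> amap G h) \<in> coslice_triangles C A u v i p r \<phi>"
    if "(f, g, h) \<in> stable_triangles C i p" for f g h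
  proof -
    obtain s t w where seq: "standard_sequence C i p s t w"
      and iso: "iso_triangles St ?S (f, g, h) (stable_class C s, stable_class C t, stable_class C w)"
      using \<open>(f, g, h) \<in> stable_triangles C i p\<close> by (auto simp: stable_triangles_def)
    have arr: "s \<in> Arr C" "t \<in> Arr C" "w \<in> Arr C"
      using seq by (auto simp: standard_sequence_def is_pushout_def homs_def)
    have "Dom St (stable_class C s) = Dom C s"
      using homsD [OF stable_class_homs [OF Arr_homs [OF arr(1)]]] by blast
    then have "iso_triangles H S' (amap G f, amap G g, \<eta> (Dom St f) \<cdot>\<^bsub>H\<^esub> amap G h)
        (diag C A u v s, diag C A u v t, \<xi> (Dom C s) \<cdot>\<^bsub>H\<^esub> diag C A u v w)"
      using triangle_transport [OF S.category_axioms H.category_axioms G functor_stable_shriek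
          functor_stable_suspension functor_coslice_suspension \<theta> stable_shriek_suspension iso]
      by (simp add: \<eta>_def stable_shriek_class [OF Arr_homs [OF arr(1)]]
          stable_shriek_class [OF Arr_homs [OF arr(2)]] stable_shriek_class [OF Arr_homs [OF arr(3)]])
    then show ?thesis
      using seq by (auto simp: coslice_triangles_def H_eq)
  qed
  then show ?thesis
    using eq \<eta> unfolding triangle_equivalence_def by blast
qed

end

theorem corollary3p6:
  fixes F :: "('o, 'm) exact_cat" and A :: 'o
    and i p u v :: "'o \<Rightarrow> 'm"
    and r :: "'m \<Rightarrow> 'o" and \<phi> :: "'m \<Rightarrow> ('m, 'm \<times> 'm \<times> 'm) loc_arr"
    and Q :: "'o \<Rightarrow> 'o" and q :: "'o \<Rightarrow> 'm"
    and R :: "'m \<Rightarrow> 'm" and \<rho> :: "'m \<Rightarrow> 'm \<times> 'm \<times> 'm"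
  assumes "frobenius_category F" and "weakly_idempotent_complete F"
    and "A \<in> Obj F" and "projective F A" and "injective F A" and "\<not> zero_object F A"
    and "suspension_choice F i p"
    and "coproduct_choice F A u v"
    and "diag_choice F A u r \<phi>"
    and "cofibrant_replacement F (canonical_model F) Q q"
    and "fibrant_replacement (coslice F A) (coslice_canonical F A) R \<rho>"
  defines "L0 \<equiv> left_derived F (canonical_model F) (coslice F A) (coslice_canonical F A)
                  Q q (zero_shriek F u v)"
    and "R0 \<equiv> right_derived (coslice F A) (coslice_canonical F A) F (canonical_model F)
                  R \<rho> (forgetful F)"
  shows "triangle_equivalence
           (stable_category F) (stable_suspension F i p) (stable_triangles F i p)
           (Ho_coslice F A) (coslice_suspension F A u v i p r \<phi>) (coslice_triangles F A u v i p r \<phi>)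
           (L0 \<circ>\<^sub>F stable_to_Ho F)
       \<and> quasi_inverse (stable_category F) (Ho_coslice F A) (L0 \<circ>\<^sub>F stable_to_Ho F) (Ho_to_stable F \<circ>\<^sub>F R0)"
proof -
  interpret frobenius_category F by fact
  interpret frobenius_coslice_suspension F A u v i p r \<phi>
    by unfold_locales fact+
  note L = left_derived_zero_shriek [OF assms(10), folded L0_def]
  note R = right_derived_forgetful [OF assms(11), folded R0_def]
  obtain \<kappa> where "natural_iso H St (Ho_to_stable F \<circ>\<^sub>F R0) stable_forget \<kappa>"
    using R(2) by blast
  \<comment> \<open>The strict pair is quasi-inverse, and each derived functor is naturally
    isomorphic to its strict model.\<close>
  then have qi: "quasi_inverse St H (L0 \<circ>\<^sub>F stable_to_Ho F) (Ho_to_stable F \<circ>\<^sub>F R0)"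
    by (rule quasi_inverse_transport [OF S.category_axioms H.category_axioms quasi_inverse_stable_shriek L R(1)])
  then have "equivalence St H (L0 \<circ>\<^sub>F stable_to_Ho F)"
    unfolding equivalence_def by blast
  then show ?thesis
    using triangle_equivalence_of_natural_iso [OF L] qi by (simp add: H_eq)
qed

end
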